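(* Let $g\in\mathbb{N}$, let $X_i=\theta_i+\varepsilon_i\in\mathbb{R}^d$, $i\ge1$, where $\{\theta_i\}_{i\ge1}\subset\mathbb{R}^d$ is a fixed sequence and $\{\varepsilon_i\}_{i\ge1}$ are i.i.d. $\mathcal{N}(0,\Sigma)$ with $\Sigma$ nonnegative definite, and let $\nu_n=\frac1n\sum_{i=1}^n\delta_{\theta_i}$. Assume that 1. there exists a matrix $\mathfrak{S}$ such that $\frac1n\sum_{i=1}^n\operatorname{Cov}(\operatorname{vec}(M_{n,i}))\to\mathfrak{S}$ as $n\to\infty$, and 2. for every $\eta>0$, $\frac1n\sum_{i=1}^n\|\theta_i\|^{4g}\mathbf{1}_{\{\|\theta_i\|^{2g}>\sqrt n\,\eta\}}\to0$ as $n\to\infty$. Then, as $n\to\infty$, $$\|\hat{\mathbb{M}}_g-\mathbb{M}_g(\nu_n)\|_{\mathrm{Fr}}\xrightarrow{a.s.}0\qquad\text{and}\qquad\sqrt n\left(\operatorname{vec}(\hat{\mathbb{M}}_g)-\operatorname{vec}(\mathbb{M}_g(\nu_n))\right)\xrightarrow{w}\mathcal{N}(0,\mathfrak{S}),$$ where $\xrightarrow{w}$ denotes convergence in distribution.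
   Context: $\mathbb{N}=\{1,2,\dots\}$, $\mathbb{N}_0=\{0,1,\dots\}$. For $x\in\mathbb{R}^d$ write $\tilde x=(1,x_1,\dots,x_d)\in\mathbb{R}^{d+1}$ and $\tilde x^{\mathbf{i}}=x_1^{i_1}\cdots x_d^{i_d}$ for $\mathbf{i}=(i_0,\dots,i_d)\in\mathbb{N}_0^{d+1}$ ($0^0=1$). $\mathcal{B}_{d,g}=\{\mathbf{i}\in\mathbb{N}_0^{d+1}:\sum_j i_j=g\}$ with a fixed total order, $\kappa_{d,g}=\binom{d+g}{d}$ its cardinality, $\phi(x)=(\tilde x^{\mathbf{i}})_{\mathbf{i}\in\mathcal{B}_{d,g}}\in\mathbb{R}^{\kappa_{d,g}}$. $\mathbb{M}_g(\nu_n)=\frac1n\sum_{i=1}^n\phi(\theta_i)\phi(\theta_i)^\top$. $\operatorname{vec}$ stacks the columns of a matrix; $\|\cdot\|_{\mathrm{Fr}}$ is the Frobenius norm. Debiased moment matrix: $\hat{\mathbb{M}}_g=\frac1n\sum_{i=1}^nM_{n,i}$ with $$M_{n,i}=\sum_{k=0}^{g}C_{2g,k}(-1)^k\,h(\gamma_g\otimes\gamma_g)\left(\operatorname{sym}\left(\tilde X_i^{\otimes(2g-2k)}\otimes\tilde\Sigma^{\otimes k}\right)\right),\qquad C_{2g,k}=\binom{2g}{2k}\frac{(2k)!}{k!\,2^k}.$$ Here $\operatorname{sym}$ is the linear symmetrization map, $\operatorname{sym}(v_1\otimes\cdots\otimes v_m)=\frac1{m!}\sum_\tau v_{\tau(1)}\otimes\cdots\otimes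 v_{\tau(m)}$ (sum over all permutations); $\gamma_g:\operatorname{sym}((\mathbb{R}^{d+1})^{\otimes g})\to\mathbb{R}^{\kappa_{d,g}}$ is the linear bijection with $\gamma_g(\tilde x^{\otimes g})=\phi(x)$ for all $x\in\mathbb{R}^d$; $h:\mathbb{R}^{\kappa_{d,g}}\otimes\mathbb{R}^{\kappa_{d,g}}\to\mathcal{M}_{\kappa_{d,g}\times\kappa_{d,g}}(\mathbb{R})$ is linear with $h(u\otimes v)=uv^\top$; $\tilde\Sigma=\begin{pmatrix}0&0\\0&\Sigma\end{pmatrix}$, identified with an element of $\mathbb{R}^{d+1}\otimes\mathbb{R}^{d+1}$ by $uv^\top\leftrightarrow u\otimes v$. Symmetric tensors of order $2g$ are regarded as elements of $\operatorname{sym}((\mathbb{R}^{d+1})^{\otimes g})\otimes\operatorname{sym}((\mathbb{R}^{d+1})^{\otimes g})$. *)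

theory Defs
  imports "HOL-Probability.Probability" "HOL-Combinatorics.Permutations"
    "HOL-Computational_Algebra.Polynomial"
begin

section \<open>Multi-indices, monomials and moment matrices\<close>

text \<open>
  The dimension \<open>d\<close> is \<open>CARD('d)\<close> and the degree \<open>g\<close> is \<open>CARD('g)\<close>; both range over all positive
  integers as the type variables vary.  The coordinates \<open>0, 1, \<dots>, d\<close> of \<open>\<real>\<^sup>d\<^sup>+\<^sup>1\<close> are the elements of
  \<open>'d option\<close>, with \<open>None\<close> in the role of \<open>0\<close>.  Vectors and matrices of size \<open>\<kappa>\<close> are indexed
  directly by the set of multi-indices, so that no enumeration of it has to be chosen.
\<close>

typedef ('d::finite, 'g::finite) multi_index =
  "{i :: 'd option \<Rightarrow> nat. (\<Sum>j\<in>UNIV. i j) = CARD('g)}"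
  morphisms expo Abs_multi_index
proof -
  have "(\<Sum>j\<in>UNIV. if j = (None :: 'd option) then CARD('g) else 0) = CARD('g)"
    by simp
  then show ?thesis by blast
qed

lemma sum_expo: "(\<Sum>j\<in>UNIV. expo (i :: ('d::finite, 'g::finite) multi_index) j) = CARD('g)"
  using expo[of i] by simp

lemma expo_le: "expo (i :: ('d::finite, 'g::finite) multi_index) j \<le> CARD('g)"
  unfolding sum_expo[of i, symmetric] by (rule member_le_sum) auto

instance multi_index :: (finite, finite) finite
proof
  have "finite (PiE (UNIV :: 'a option set) (\<lambda>_. {..CARD('b)}))"
    by (intro finite_PiE) auto
  moreover have "range (expo :: ('a, 'b) multi_index \<Rightarrow> _) \<subseteq> PiE UNIV (\<lambda>_. {..CARD('b)})"
    using expo_le by (auto simp: PiE_def)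
  ultimately have "finite (range (expo :: ('a, 'b) multi_index \<Rightarrow> _))"
    by (rule finite_subset[rotated])
  then show "finite (UNIV :: ('a, 'b) multi_index set)"
    by (rule finite_imageD) (auto intro: injI simp: expo_inject)
qed

type_synonym ('d, 'g) moment_matrix = "((real, ('d, 'g) multi_index) vec, ('d, 'g) multi_index) vec"

definition tilde :: "real ^ 'd::finite \<Rightarrow> real ^ 'd option" where
  "tilde x = (\<chi> j. case j of None \<Rightarrow> 1 | Some a \<Rightarrow> x $ a)"

definition phi :: "real ^ 'd::finite \<Rightarrow> real ^ ('d, 'g::finite) multi_index" where
  "phi x = (\<chi> i. \<Prod>a\<in>UNIV. (x $ a) ^ expo i (Some a))"

definition outer :: "real ^ 'm::finite \<Rightarrow> real ^ 'n::finite \<Rightarrow> real ^ 'n ^ 'm" where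
  "outer u v = (\<chi> i j. u $ i * v $ j)"

text \<open>The moment matrix of the empirical measure of \<open>\<theta> 1, \<dots>, \<theta> n\<close>.\<close>

definition moment_matrix :: "nat \<Rightarrow> (nat \<Rightarrow> real ^ 'd::finite) \<Rightarrow> ('d, 'g::finite) moment_matrix" where
  "moment_matrix n \<theta> = (1 / real n) *\<^sub>R (\<Sum>i=1..n. outer (phi (\<theta> i)) (phi (\<theta> i)))"


section \<open>Tensors\<close>

text \<open>
  A tensor of order \<open>m\<close> over \<open>\<real>\<^sup>J\<close> is represented by its coordinate array, a function on the
  lists of indices which vanishes on all lists of length other than \<open>m\<close>.
\<close>

type_synonym 'j tensor = "'j list \<Rightarrow> real"

definition tensors :: "nat \<Rightarrow> 'j tensor set" where
  "tensors m = {T. \<forall>l. length l \<noteq> m \<longrightarrow> T l = 0}"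

text \<open>
  The product of the full tensor algebra.  For \<open>S\<close> of order \<open>m\<close> only the summand \<open>k = m\<close> can be
  nonzero, see \<open>tensor_prod_homogeneous\<close> below.
\<close>

definition tensor_prod :: "'j tensor \<Rightarrow> 'j tensor \<Rightarrow> 'j tensor"  (infixr "\<otimes>\<^sub>t" 75) where
  "S \<otimes>\<^sub>t T = (\<lambda>l. \<Sum>k\<le>length l. S (take k l) * T (drop k l))"

primrec tensor_pow :: "'j tensor \<Rightarrow> nat \<Rightarrow> 'j tensor" where
  "tensor_pow T 0 = (\<lambda>l. if l = [] then 1 else 0)"
| "tensor_pow T (Suc n) = T \<otimes>\<^sub>t tensor_pow T n"

definition vec_tensor :: "real ^ 'j::finite \<Rightarrow> 'j tensor" where
  "vec_tensor v = (\<lambda>l. if length l = 1 then v $ (l ! 0) else 0)"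

definition mat_tensor :: "real ^ 'j ^ 'j::finite \<Rightarrow> 'j tensor" where
  "mat_tensor A = (\<lambda>l. if length l = 2 then A $ (l ! 0) $ (l ! 1) else 0)"

text \<open>
  Permuting the indices by \<open>\<tau>\<close> permutes the factors of an elementary tensor by the inverse of \<open>\<tau>\<close>,
  which gives the same sum over all permutations.
\<close>

definition symmetrize :: "'j tensor \<Rightarrow> 'j tensor" where
  "symmetrize T =
     (\<lambda>l. (\<Sum>\<tau> | \<tau> permutes {..<length l}. T (permute_list \<tau> l)) / fact (length l))"

definition sym_tensors :: "nat \<Rightarrow> 'j tensor set" where
  "sym_tensors m = symmetrize ` tensors m"

lemma tensor_prod_homogeneous:
  assumes "S \<in> tensors m" "length l \<ge> m"
  shows "(S \<otimes>\<^sub>t T) l = S (take m l) * T (drop m l)"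
proof -
  have "(S \<otimes>\<^sub>t T) l = (\<Sum>k\<in>{m}. S (take k l) * T (drop k l))"
    unfolding tensor_prod_def using assms
    by (intro sum.mono_neutral_right) (auto simp: tensors_def)
  then show ?thesis by simp
qed

lemma tensor_prod_vec_mat:
  "vec_tensor u \<otimes>\<^sub>t vec_tensor v = mat_tensor (outer u v)"
proof
  fix l
  show "(vec_tensor u \<otimes>\<^sub>t vec_tensor v) l = mat_tensor (outer u v) l"
  proof (cases "length l \<ge> 1")
    case True
    have "vec_tensor u \<in> tensors 1" by (simp add: tensors_def vec_tensor_def)
    from tensor_prod_homogeneous[OF this True, of "vec_tensor v"] True show ?thesis
      by (auto simp: vec_tensor_def mat_tensor_def outer_def)
  next
    case False
    then have "l = []" by (cases l) auto
    then show ?thesis by (simp add: tensor_prod_def vec_tensor_def mat_tensor_def)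
  qed
qed

lemma tensor_pow_vec:
  "tensor_pow (vec_tensor v) m l = (if length l = m then prod_list (map (($) v) l) else 0)"
proof (induction m arbitrary: l)
  case 0
  show ?case by simp
next
  case (Suc m)
  have hom: "vec_tensor v \<in> tensors 1" by (simp add: tensors_def vec_tensor_def)
  show ?case
  proof (cases l)
    case Nil
    then show ?thesis by (simp add: tensor_prod_def vec_tensor_def)
  next
    case (Cons a r)
    then have "(vec_tensor v \<otimes>\<^sub>t tensor_pow (vec_tensor v) m) l
        = v $ a * tensor_pow (vec_tensor v) m r"
      using tensor_prod_homogeneous[OF hom, of l "tensor_pow (vec_tensor v) m"]
      by (simp add: vec_tensor_def)
    then show ?thesis using Suc.IH[of r] Cons by simp
  qed
qed

lemma symmetrize_id:
  assumes "\<And>l l'. mset l = mset l' \<Longrightarrow> T l = T l'"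
  shows "symmetrize T = T"
proof
  fix l
  have "(\<Sum>\<tau> | \<tau> permutes {..<length l}. T (permute_list \<tau> l))
      = (\<Sum>\<tau> | \<tau> permutes {..<length l}. T l)"
    by (intro sum.cong refl assms) auto
  also have "\<dots> = fact (length l) * T l"
    by (simp add: card_permutations[of "{..<length l}" "length l"])
  finally show "symmetrize T l = T l" by (simp add: symmetrize_def)
qed

lemma symmetrize_mset:
  assumes "mset l = mset l'"
  shows "symmetrize T l = symmetrize T l'"
proof -
  obtain p where p: "p permutes {..<length l'}" "permute_list p l' = l"
    using mset_eq_permutation[OF assms] by blast
  have len: "length l = length l'" using assms by (metis size_mset)
  have "(\<Sum>\<tau> | \<tau> permutes {..<length l'}. T (permute_list \<tau> l'))
      = (\<Sum>\<tau> | \<tau> permutes {..<length l'}. T (permute_list (p \<circ> \<tau>) l'))"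
    by (rule setum_permutations_compose_left[OF p(1)])
  also have "\<dots> = (\<Sum>\<tau> | \<tau> permutes {..<length l'}. T (permute_list \<tau> l))"
    using p by (intro sum.cong refl) (auto simp: permute_list_compose)
  finally show ?thesis by (simp add: symmetrize_def len)
qed

lemma sym_tensors_altdef:
  "sym_tensors m = {T :: 'j tensor. T \<in> tensors m \<and> (\<forall>l l'. mset l = mset l' \<longrightarrow> T l = T l')}"
  (is "_ = ?R")
proof (intro equalityI subsetI)
  fix T :: "'j tensor" assume "T \<in> sym_tensors m"
  then obtain S where "S \<in> tensors m" "T = symmetrize S" by (auto simp: sym_tensors_def)
  moreover from this have "T \<in> tensors m"
    by (simp add: tensors_def symmetrize_def)
  ultimately show "T \<in> ?R" using symmetrize_mset[of _ _ S] by blast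
next
  fix T :: "'j tensor" assume T: "T \<in> ?R"
  then have "symmetrize T = T" by (intro symmetrize_id) blast
  moreover have "T \<in> tensors m" using T by blast
  ultimately show "T \<in> sym_tensors m" unfolding sym_tensors_def by (metis imageI)
qed


section \<open>The identification of symmetric tensors with coefficient vectors\<close>

definition linear_on_sym :: "nat \<Rightarrow> ('j tensor \<Rightarrow> 'b::real_vector) \<Rightarrow> bool" where
  "linear_on_sym m G \<longleftrightarrow>
     (\<forall>S\<in>sym_tensors m. \<forall>T\<in>sym_tensors m. \<forall>a b.
        G (\<lambda>l. a * S l + b * T l) = a *\<^sub>R G S + b *\<^sub>R G T)"

definition is_gamma :: "('d option tensor \<Rightarrow> real ^ ('d::finite, 'g::finite) multi_index) \<Rightarrow> bool" where
  "is_gamma G \<longleftrightarrow> linear_on_sym CARD('g) G \<and> bij_betw G (sym_tensors CARD('g)) UNIV \<and>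
     (\<forall>x. G (tensor_pow (vec_tensor (tilde x)) CARD('g)) = phi x)"

text \<open>
  Such a map exists and its values on symmetric tensors are unique, see \<open>is_gamma_gamma\<close> and
  \<open>is_gamma_unique\<close> below.
\<close>

definition gamma :: "'d option tensor \<Rightarrow> real ^ ('d::finite, 'g::finite) multi_index" where
  "gamma = (SOME G. is_gamma G)"

text \<open>
  The map \<open>h \<circ> (\<gamma> \<otimes> \<gamma>)\<close> on \<open>Sym\<^sup>g \<otimes> Sym\<^sup>g\<close>, given by applying \<open>\<gamma>\<close> to the last and then to the first
  \<open>g\<close> tensor slots; see \<open>h_gamma_gamma_tensor_prod\<close> below for its values on elementary tensors.
\<close>

definition h_gamma_gamma :: "'d option tensor \<Rightarrow> ('d::finite, 'g::finite) moment_matrix" where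
  "h_gamma_gamma T =
     (\<chi> i j. gamma (\<lambda>l. if length l = CARD('g) then gamma (\<lambda>l'. T (l @ l')) $ j else 0) $ i)"

definition coeff_list :: "('d::finite, 'g::finite) multi_index \<Rightarrow> 'd option list" where
  "coeff_list i = (SOME l. \<forall>j. count (mset l) j = expo i j)"

lemma size_eq_sum_count: "size (M :: 'a::finite multiset) = (\<Sum>j\<in>UNIV. count M j)"
  unfolding size_multiset_overloaded_eq
  by (intro sum.mono_neutral_left) (auto simp: not_in_iff)

lemma count_coeff_list: "count (mset (coeff_list i)) j = expo i j"
proof -
  have "\<exists>l. \<forall>j. count (mset l) j = expo i j"
  proof -
    obtain l where "mset l = Abs_multiset (expo i)" using ex_mset by blast
    moreover have "count (Abs_multiset (expo i)) = expo i"
      by (rule Abs_multiset_inverse) simp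
    ultimately show ?thesis by metis
  qed
  from someI_ex[OF this] show ?thesis by (simp add: coeff_list_def)
qed

lemma length_coeff_list:
  "length (coeff_list (i :: ('d::finite, 'g::finite) multi_index)) = CARD('g)"
  using size_eq_sum_count[of "mset (coeff_list i)"] by (simp add: count_coeff_list sum_expo)

lemma mset_coeff_list:
  assumes "length l = CARD('g::finite)"
  shows "mset (coeff_list (Abs_multi_index (count (mset l)) :: ('d::finite, 'g) multi_index)) = mset l"
proof (rule multiset_eqI)
  have "(\<Sum>j\<in>UNIV. count (mset l) j) = CARD('g)"
    using size_eq_sum_count[of "mset l"] assms by simp
  then show "count (mset (coeff_list (Abs_multi_index (count (mset l)) :: ('d, 'g) multi_index))) j
      = count (mset l) j" for j
    by (simp add: count_coeff_list Abs_multi_index_inverse)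
qed

definition coord_gamma :: "'d option tensor \<Rightarrow> real ^ ('d::finite, 'g::finite) multi_index" where
  "coord_gamma T = (\<chi> i. T (coeff_list i))"

definition lift_sym :: "real ^ ('d::finite, 'g::finite) multi_index \<Rightarrow> 'd option tensor" where
  "lift_sym v = (\<lambda>l. if length l = CARD('g) then v $ Abs_multi_index (count (mset l)) else 0)"

lemma lift_sym_sym:
  "lift_sym (v :: real ^ ('d::finite, 'g::finite) multi_index) \<in> sym_tensors CARD('g)"
proof -
  have "lift_sym v l = lift_sym v l'" if "mset l = mset l'" for l l'
    using mset_eq_length[OF that] that by (simp add: lift_sym_def)
  moreover have "lift_sym v \<in> tensors CARD('g)"
    by (simp add: tensors_def lift_sym_def)
  ultimately show ?thesis
    unfolding sym_tensors_altdef by blast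
qed

lemma coord_lift: "coord_gamma (lift_sym v) = v"
proof -
  have "count (mset (coeff_list i)) = expo i" for i :: "('a::finite, 'b::finite) multi_index"
    by (rule ext) (rule count_coeff_list)
  then show ?thesis
    by (simp add: coord_gamma_def lift_sym_def vec_eq_iff length_coeff_list expo_inverse)
qed

lemma lift_coord:
  assumes "T \<in> sym_tensors CARD('g)"
  shows "lift_sym (coord_gamma T :: real ^ ('d::finite, 'g::finite) multi_index) = T"
proof
  fix l
  show "lift_sym (coord_gamma T :: real ^ ('d, 'g) multi_index) l = T l"
  proof (cases "length l = CARD('g)")
    case True
    have "T (coeff_list (Abs_multi_index (count (mset l)) :: ('d, 'g) multi_index)) = T l"
      using assms mset_coeff_list[OF True] unfolding sym_tensors_altdef by blast
    then show ?thesis using True by (simp add: lift_sym_def coord_gamma_def)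
  next
    case False
    have "T \<in> tensors CARD('g)" using assms unfolding sym_tensors_altdef by blast
    then show ?thesis using False by (simp add: tensors_def lift_sym_def)
  qed
qed

lemma prod_list_tilde:
  "prod_list (map (($) (tilde x)) l) = (\<Prod>a\<in>UNIV. (x $ a) ^ count (mset l) (Some a))"
proof (induction l)
  case Nil
  show ?case by simp
next
  case (Cons j l)
  show ?case
  proof (cases j)
    case None
    then show ?thesis using Cons.IH by (simp add: tilde_def)
  next
    case (Some b)
    have "(\<Prod>a\<in>UNIV. (x $ a) ^ count (mset (j # l)) (Some a))
        = (\<Prod>a\<in>UNIV. (if a = b then x $ a else 1) * (x $ a) ^ count (mset l) (Some a))"
      by (intro prod.cong refl) (simp add: Some)
    also have "\<dots> = x $ b * (\<Prod>a\<in>UNIV. (x $ a) ^ count (mset l) (Some a))"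
      by (simp add: prod.distrib)
    finally show ?thesis using Cons.IH Some by (simp add: tilde_def)
  qed
qed

lemma coord_gamma_pow:
  "(coord_gamma (tensor_pow (vec_tensor (tilde x)) CARD('g)) :: real ^ ('d::finite, 'g::finite) multi_index)
     = phi x"
  unfolding coord_gamma_def phi_def tensor_pow_vec length_coeff_list prod_list_tilde count_coeff_list
  by simp

lemma tensor_pow_sym: "tensor_pow (vec_tensor v) m \<in> sym_tensors m"
proof -
  have "prod_list (map (($) v) l) = prod_list (map (($) v) l')" if "mset l = mset l'" for l l'
    using that by (metis mset_map prod_mset_prod_list)
  then have "tensor_pow (vec_tensor v) m l = tensor_pow (vec_tensor v) m l'"
    if "mset l = mset l'" for l l'
    using mset_eq_length[OF that] that unfolding tensor_pow_vec by metis
  moreover have "tensor_pow (vec_tensor v) m \<in> tensors m"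
    by (simp add: tensors_def tensor_pow_vec)
  ultimately show ?thesis
    unfolding sym_tensors_altdef by blast
qed

lemma is_gamma_coord: "is_gamma (coord_gamma :: _ \<Rightarrow> real ^ ('d::finite, 'g::finite) multi_index)"
  unfolding is_gamma_def
proof (intro conjI allI)
  show "linear_on_sym CARD('g) (coord_gamma :: _ \<Rightarrow> real ^ ('d, 'g) multi_index)"
    by (simp add: linear_on_sym_def coord_gamma_def vec_eq_iff)
  show "bij_betw (coord_gamma :: _ \<Rightarrow> real ^ ('d, 'g) multi_index) (sym_tensors CARD('g)) UNIV"
    by (rule bij_betw_byWitness[where f' = lift_sym])
      (use lift_coord coord_lift lift_sym_sym in blast)+
qed (rule coord_gamma_pow)

lemma is_gamma_gamma: "is_gamma (gamma :: _ \<Rightarrow> real ^ ('d::finite, 'g::finite) multi_index)"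
  unfolding gamma_def by (rule someI[of is_gamma, OF is_gamma_coord])

lemma digits_unique:
  fixes f h :: "nat \<Rightarrow> nat"
  assumes "\<And>k. k < n \<Longrightarrow> f k < N" "\<And>k. k < n \<Longrightarrow> h k < N"
    and "(\<Sum>k<n. f k * N ^ k) = (\<Sum>k<n. h k * N ^ k)" "k < n"
  shows "f k = h k"
  using assms
proof (induction n arbitrary: f h k)
  case 0
  then show ?case by simp
next
  case (Suc n)
  have split: "(\<Sum>k<Suc n. u k * N ^ k) = u 0 + N * (\<Sum>k<n. u (Suc k) * N ^ k)" for u :: "nat \<Rightarrow> nat"
    unfolding sum.lessThan_Suc_shift by (simp add: sum_distrib_left mult_ac)
  have eq: "f 0 + N * (\<Sum>k<n. f (Suc k) * N ^ k) = h 0 + N * (\<Sum>k<n. h (Suc k) * N ^ k)"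
    using Suc.prems(3) unfolding split .
  have lt: "f 0 < N" "h 0 < N" using Suc.prems(1,2) by auto
  have z: "f 0 = h 0"
    using arg_cong[OF eq, of "\<lambda>m. m mod N"] lt by simp
  have "(\<Sum>k<n. f (Suc k) * N ^ k) = (\<Sum>k<n. h (Suc k) * N ^ k)"
    using eq z lt by simp
  then have "f (Suc j) = h (Suc j)" if "j < n" for j
    using Suc.IH[of "\<lambda>k. f (Suc k)" "\<lambda>k. h (Suc k)" j] Suc.prems(1,2) that by auto
  with z Suc.prems(4) show ?case by (cases k) auto
qed

lemma phi_separating:
  fixes c :: "('d::finite, 'g::finite) multi_index \<Rightarrow> real"
  assumes "\<And>x :: real ^ 'd. (\<Sum>i\<in>UNIV. c i * phi x $ i) = 0"
  shows "c i = 0"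
proof -
  obtain e :: "nat \<Rightarrow> 'd" where e: "bij_betw e {..<CARD('d)} UNIV"
    using ex_bij_betw_nat_finite[of "UNIV :: 'd set"] by (auto simp: atLeast0LessThan)
  define e' where "e' = inv_into {..<CARD('d)} e"
  have e'e: "e' (e k) = k" if "k < CARD('d)" for k
    using e that unfolding e'_def by (auto simp: bij_betw_def)
  define N where "N = CARD('g) + 1"
  define E :: "('d, 'g) multi_index \<Rightarrow> nat"
    where "E i = (\<Sum>a\<in>UNIV. expo i (Some a) * N ^ e' a)" for i
  have E: "E i = (\<Sum>k<CARD('d). expo i (Some (e k)) * N ^ k)" for i
    unfolding E_def sum.reindex_bij_betw[OF e, symmetric] by (simp add: e'e)
  have E_inj: "i = i'" if "E i = E i'" for i i'
  proof -
    have le: "expo i j < N" for i :: "('d, 'g) multi_index" and j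
      using expo_le[of i j] by (simp add: N_def)
    have "expo i (Some (e k)) = expo i' (Some (e k))" if "k < CARD('d)" for k
      by (rule digits_unique[of "CARD('d)" "\<lambda>k. expo i (Some (e k))" N "\<lambda>k. expo i' (Some (e k))"])
        (use le that \<open>E i = E i'\<close> in \<open>auto simp: E\<close>)
    then have S: "expo i (Some a) = expo i' (Some a)" for a
      using e by (metis UNIV_I bij_betw_def imageE lessThan_iff)
    have "expo i None + (\<Sum>a\<in>UNIV. expo i (Some a)) = expo i' None + (\<Sum>a\<in>UNIV. expo i' (Some a))"
      using sum_expo[of i] sum_expo[of i'] by (simp add: UNIV_option_conv sum.reindex)
    then have "expo i None = expo i' None" by (simp add: S)
    with S have "expo i = expo i'" by (intro ext) (metis option.exhaust)
    then show ?thesis by (simp add: expo_inject)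
  qed
  define p where "p = (\<Sum>i\<in>UNIV. monom (c i) (E i))"
  have "poly p t = 0" for t
  proof -
    have "phi (\<chi> a. t ^ (N ^ e' a)) $ i = t ^ E i" for i :: "('d, 'g) multi_index"
      by (simp add: phi_def E_def power_sum power_mult[symmetric] mult.commute)
    then show ?thesis using assms[of "\<chi> a. t ^ (N ^ e' a)"]
      by (simp add: p_def poly_sum poly_monom)
  qed
  then have "p = 0" using poly_all_0_iff_0 by blast
  then have "0 = coeff p (E i)" by simp
  also have "\<dots> = (\<Sum>i'\<in>UNIV. if i' = i then c i' else 0)"
    unfolding p_def coeff_sum by (intro sum.cong refl) (auto dest: E_inj)
  finally show ?thesis by simp
qed

lemma is_gamma_unique:
  fixes G :: "'d option tensor \<Rightarrow> real ^ ('d::finite, 'g::finite) multi_index"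
  assumes "is_gamma G" "T \<in> sym_tensors CARD('g)"
  shows "G T = coord_gamma T"
proof -
  have lin: "G (\<lambda>l. a * S l + b * T l) = a *\<^sub>R G S + b *\<^sub>R G T"
    if "S \<in> sym_tensors CARD('g)" "T \<in> sym_tensors CARD('g)" for S T a b
    using assms(1) that by (auto simp: is_gamma_def linear_on_sym_def)
  define L where "L v = G (lift_sym v)" for v :: "real ^ ('d, 'g) multi_index"
  have L2: "L (a *\<^sub>R v + b *\<^sub>R w) = a *\<^sub>R L v + b *\<^sub>R L w" for a b v w
  proof -
    have "lift_sym (a *\<^sub>R v + b *\<^sub>R w) = (\<lambda>l. a * lift_sym v l + b * lift_sym w l)"
      by (auto simp: lift_sym_def)
    then show ?thesis using lin[OF lift_sym_sym lift_sym_sym] by (simp add: L_def)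
  qed
  have "linear L"
    by (rule linearI) (use L2[of 1 _ 1] L2[of _ _ 0 0] in auto)
  have Lphi: "L (phi x) = phi x" for x
  proof -
    have "lift_sym (phi x :: real ^ ('d, 'g) multi_index) = tensor_pow (vec_tensor (tilde x)) CARD('g)"
      using lift_coord[OF tensor_pow_sym, where 'g = 'g] by (metis coord_gamma_pow)
    then show ?thesis using assms(1) by (simp add: L_def is_gamma_def)
  qed
  have L_sum: "L v $ k = (\<Sum>i\<in>UNIV. v $ i * L (axis i 1) $ k)" for v k
  proof -
    have "L v = L (\<Sum>i\<in>UNIV. v $ i *\<^sub>R axis i 1)"
      using basis_expansion[of v] by (simp add: scalar_mult_eq_scaleR)
    also have "\<dots> = (\<Sum>i\<in>UNIV. v $ i *\<^sub>R L (axis i 1))"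
      using \<open>linear L\<close> by (simp add: linear_sum linear_cmul)
    finally show ?thesis by simp
  qed
  have "L (axis i 1) $ k - (if i = k then 1 else 0) = 0" for i k
  proof (rule phi_separating[of "\<lambda>i. L (axis i 1) $ k - (if i = k then 1 else 0)"])
    fix x :: "real ^ 'd"
    have "(\<Sum>i\<in>UNIV. (L (axis i 1) $ k - (if i = k then 1 else 0)) * phi x $ i)
        = (\<Sum>i\<in>UNIV. phi x $ i * L (axis i 1) $ k) - (\<Sum>i\<in>UNIV. if i = k then phi x $ i else 0)"
      unfolding sum_subtractf[symmetric] by (intro sum.cong refl) (auto simp: algebra_simps)
    also have "\<dots> = 0" using L_sum[of "phi x" k] Lphi[of x] by simp
    finally show "(\<Sum>i\<in>UNIV. (L (axis i 1) $ k - (if i = k then 1 else 0)) * phi x $ i) = 0" .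
  qed
  then have ax: "L (axis i 1) $ k = (if i = k then 1 else 0)" for i k
    by (simp only: eq_iff_diff_eq_0[of "L (axis i 1) $ k"])
  have "L v $ k = v $ k" for v k
  proof -
    have "L v $ k = (\<Sum>i\<in>UNIV. if i = k then v $ i else 0)"
      unfolding L_sum[of v k] by (intro sum.cong refl) (simp add: ax)
    then show ?thesis by simp
  qed
  then have "L (coord_gamma T) = coord_gamma T" by (simp add: vec_eq_iff)
  then show ?thesis unfolding L_def lift_coord[OF assms(2)] .
qed

lemma h_gamma_gamma_tensor_prod:
  fixes S T :: "'d::finite option tensor"
  assumes S: "S \<in> sym_tensors CARD('g)" and T: "T \<in> sym_tensors CARD('g::finite)"
  shows "(h_gamma_gamma (S \<otimes>\<^sub>t T) :: ('d, 'g) moment_matrix) = outer (gamma S) (gamma T)"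
proof -
  have lin: "linear_on_sym CARD('g) (gamma :: _ \<Rightarrow> real ^ ('d, 'g) multi_index)"
    using is_gamma_gamma by (auto simp: is_gamma_def)
  have sc: "(gamma (\<lambda>l. a * U l) :: real ^ ('d, 'g) multi_index) = a *\<^sub>R gamma U"
    if "U \<in> sym_tensors CARD('g)" for a U
    using lin[unfolded linear_on_sym_def, rule_format, OF that that, of a 0] by simp
  have St: "S \<in> tensors CARD('g)" using S unfolding sym_tensors_altdef by blast
  have 1: "(S \<otimes>\<^sub>t T) (l @ l') = S l * T l'" if "length l = CARD('g)" for l l'
    using tensor_prod_homogeneous[OF St, of "l @ l'" T] that by simp
  have 2: "(\<lambda>l. if length l = CARD('g)
        then (gamma (\<lambda>l'. (S \<otimes>\<^sub>t T) (l @ l')) :: real ^ ('d, 'g) multi_index) $ j else 0)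
      = (\<lambda>l. (gamma T :: real ^ ('d, 'g) multi_index) $ j * S l)" for j
    using St by (auto simp: 1 sc[OF T] tensors_def fun_eq_iff)
  show ?thesis
    unfolding h_gamma_gamma_def 2 sc[OF S] outer_def by (simp add: vec_eq_iff)
qed


section \<open>The debiased moment matrix\<close>

definition C_coeff :: "nat \<Rightarrow> nat \<Rightarrow> real" where
  "C_coeff m k = real (m choose (2 * k)) * fact (2 * k) / (fact k * 2 ^ k)"

definition tilde_mat :: "real ^ 'd ^ 'd::finite \<Rightarrow> real ^ 'd option ^ 'd option" where
  "tilde_mat A = (\<chi> i j. case (i, j) of (Some a, Some b) \<Rightarrow> A $ a $ b | _ \<Rightarrow> 0)"

definition debiased_term :: "real ^ 'd ^ 'd \<Rightarrow> real ^ 'd::finite \<Rightarrow> ('d, 'g::finite) moment_matrix" where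
  "debiased_term \<Sigma> x =
     (\<Sum>k=0..CARD('g). (C_coeff (2 * CARD('g)) k * (- 1) ^ k) *\<^sub>R
        h_gamma_gamma (symmetrize
          (tensor_pow (vec_tensor (tilde x)) (2 * CARD('g) - 2 * k)
             \<otimes>\<^sub>t tensor_pow (mat_tensor (tilde_mat \<Sigma>)) k)))"

definition debiased_moment_matrix ::
    "real ^ 'd ^ 'd \<Rightarrow> nat \<Rightarrow> (nat \<Rightarrow> real ^ 'd::finite) \<Rightarrow> ('d, 'g::finite) moment_matrix" where
  "debiased_moment_matrix \<Sigma> n X = (1 / real n) *\<^sub>R (\<Sum>i=1..n. debiased_term \<Sigma> (X i))"


section \<open>Vectorization, covariance, normal laws and weak convergence\<close>

text \<open>Entry \<open>(c, r)\<close> is the entry in column \<open>c\<close> and row \<open>r\<close>.\<close>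

definition vec_of :: "real ^ 'n::finite ^ 'm::finite \<Rightarrow> real ^ ('n \<times> 'm)" where
  "vec_of A = (\<chi> p. A $ snd p $ fst p)"

definition frobenius_norm :: "real ^ 'n::finite ^ 'm::finite \<Rightarrow> real" where
  "frobenius_norm A = sqrt (\<Sum>i\<in>UNIV. \<Sum>j\<in>UNIV. (A $ i $ j)\<^sup>2)"

lemma frobenius_norm_eq_norm: "frobenius_norm A = norm A"
  by (simp add: frobenius_norm_def norm_vec_def L2_set_def sum_nonneg)

definition covariance_matrix :: "'w measure \<Rightarrow> ('w \<Rightarrow> real ^ 'n::finite) \<Rightarrow> real ^ 'n ^ 'n" where
  "covariance_matrix M Y =
     (\<chi> a b. \<integral>\<omega>. (Y \<omega> $ a - (\<integral>\<omega>'. Y \<omega>' $ a \<partial>M)) * (Y \<omega> $ b - (\<integral>\<omega>'. Y \<omega>' $ b \<partial>M)) \<partial>M)"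

definition nonneg_definite :: "real ^ 'n ^ 'n::finite \<Rightarrow> bool" where
  "nonneg_definite S \<longleftrightarrow> transpose S = S \<and> (\<forall>v. v \<bullet> (S *v v) \<ge> 0)"

definition normal_law :: "real \<Rightarrow> real \<Rightarrow> real measure" where
  "normal_law m v =
     (if v = 0 then return borel m else density lborel (\<lambda>x. ennreal (normal_density m (sqrt v) x)))"

text \<open>
  \<open>N\<close> is the possibly degenerate normal distribution with mean \<open>m\<close> and covariance matrix \<open>S\<close>:
  every linear functional is univariate normal.
\<close>

definition is_multi_normal :: "real ^ 'n::finite \<Rightarrow> real ^ 'n ^ 'n \<Rightarrow> (real ^ 'n) measure \<Rightarrow> bool" where
  "is_multi_normal m S N \<longleftrightarrow>
     nonneg_definite S \<and> prob_space N \<and> sets N = sets borel \<and>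
     (\<forall>a. distr N borel (\<lambda>x. a \<bullet> x) = normal_law (a \<bullet> m) (a \<bullet> (S *v a)))"

text \<open>For Borel probability measures \<open>\<mu> n\<close> and \<open>\<nu>\<close>.\<close>

definition weakly_converges :: "(nat \<Rightarrow> 'a::topological_space measure) \<Rightarrow> 'a measure \<Rightarrow> bool" where
  "weakly_converges \<mu> \<nu> \<longleftrightarrow>
     (\<forall>f :: 'a \<Rightarrow> real. continuous_on UNIV f \<and> bounded (range f) \<longrightarrow>
        (\<lambda>n. \<integral>x. f x \<partial>\<mu> n) \<longlonglongrightarrow> (\<integral>x. f x \<partial>\<nu>))"

end

theory Submission
  imports Defs
begin

text \<open>
  Entry \<open>(i, j)\<close> of the summand \<open>debiased_term \<Sigma> x\<close> is a polynomial in \<open>x\<close> of degree at most \<open>2g\<close>,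
  and everything rests on its being unbiased: evaluated at \<open>\<theta> + \<epsilon>\<close> with \<open>\<epsilon> \<sim> N(0, \<Sigma>)\<close> its
  expectation is the corresponding monomial in \<open>\<theta>\<close>.  To see this, contract the symmetric tensor of
  order \<open>2g\<close> that defines the summand with \<open>tilde y \<otimes> \<dots> \<otimes> tilde y\<close>.  Contraction does not see the
  symmetrization and is multiplicative, so the result is the Hermite polynomial
  \<open>\<Sum>k. C\<^sub>2\<^sub>g\<^sub>,\<^sub>k (-1)\<^sup>k v\<^sup>k (1 + y \<bullet> x)\<^sup>2\<^sup>g\<^sup>-\<^sup>2\<^sup>k\<close> with variance parameter \<open>v = y \<bullet> \<Sigma> y\<close>.  As \<open>y \<bullet> \<epsilon>\<close> is a
  univariate normal variable of variance \<open>v\<close>, the binomial theorem and the vanishing of alternating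
  binomial sums give the expectation \<open>(1 + y \<bullet> \<theta>)\<^sup>2\<^sup>g\<close> (\<open>Hermite_debiases_power\<close>), which is the contraction
  of \<open>tilde \<theta> \<otimes> \<dots> \<otimes> tilde \<theta>\<close>.  A symmetric tensor is determined by its contractions with all
  \<open>tilde y\<close> (\<open>symmetric_tensor_eq_0\<close>), hence the two tensors agree (\<open>expectation_debiased_tensor\<close>).
  
  So \<open>n\<close> times the error of the debiased moment matrix is a sum of independent centred vectors \<open>V\<^sub>i\<close>.
  The averages of their covariance matrices converge and are therefore bounded, which is enough for
  a strong law of large numbers (\<open>strong_law_bounded_average_variance\<close>): the second moments of the
  averages are summable along the squares, so these averages converge, and the fluctuation between
  consecutive squares is controlled by the Cauchy--Schwarz inequality and summation by parts.
  
  For the central limit theorem, \<open>\<parallel>V\<^sub>i\<parallel> \<le> K \<parallel>\<theta>\<^sub>i\<parallel>\<^sup>2\<^sup>g + K (1 + \<parallel>\<epsilon>\<^sub>i\<parallel>)\<^sup>2\<^sup>g\<close>.  The first part satisfies the Lindeberg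
  condition by assumption, the second because its fourth moments are bounded
  (\<open>centered_terms_Lindeberg\<close>).  The multivariate Lindeberg theorem (\<open>multivariate_Lindeberg_CLT\<close>) is
  reduced to linear functionals: for these the characteristic functions converge (\<open>Lindeberg_char\<close>), so
  the integrals of all trigonometric polynomials converge, and by tightness and the Stone--Weierstrass
  theorem so do those of all bounded continuous functions (\<open>weakly_converges_if_tight_and_waves\<close>).  The
  limit law exists because every nonnegative definite matrix is a sum of matrices \<open>v v\<^sup>T\<close>, so that a
  combination of independent standard normal variables has the required law (\<open>multi_normal_exists\<close>).
\<close>

section \<open>Weak convergence via trigonometric polynomials\<close>

text \<open>
  The phase \<open>b\<close> makes sine waves a special case of cosine waves.
\<close>

inductive trig_poly :: "('a::real_inner \<Rightarrow> real) \<Rightarrow> bool" where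
  wave: "trig_poly (\<lambda>x. c * cos (a \<bullet> x + b))"
| add: "trig_poly f \<Longrightarrow> trig_poly g \<Longrightarrow> trig_poly (\<lambda>x. f x + g x)"

lemma trig_poly_const: "trig_poly (\<lambda>x. c)"
  using trig_poly.wave[of c 0 0] by simp

text \<open>
  A product of two waves is again a sum of two waves, by the addition theorems for the cosine; hence
  trigonometric polynomials form an algebra.
\<close>

lemma trig_poly_mult_wave:
  assumes "trig_poly g"
  shows "trig_poly (\<lambda>x. (c * cos (a \<bullet> x + b)) * g x)"
  using assms
proof (induction rule: trig_poly.induct)
  case (wave c' a' b')
  have "(c * cos (a \<bullet> x + b)) * (c' * cos (a' \<bullet> x + b')) =
      (c * c' / 2) * cos ((a - a') \<bullet> x + (b - b')) + (c * c' / 2) * cos ((a + a') \<bullet> x + (b + b'))" for x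
  proof -
    have prod: "(c * cos A) * (c' * cos B) = (c * c' / 2) * cos (A - B) + (c * c' / 2) * cos (A + B)" for A B
      by (simp add: cos_diff cos_add algebra_simps)
    have "(a - a') \<bullet> x + (b - b') = (a \<bullet> x + b) - (a' \<bullet> x + b')"
      "(a + a') \<bullet> x + (b + b') = (a \<bullet> x + b) + (a' \<bullet> x + b')"
      by (simp_all add: inner_diff_left inner_add_left)
    then show ?thesis by (simp only: prod)
  qed
  then show ?case
    by (simp only:) (intro trig_poly.intros)
next
  case (add f g)
  then show ?case by (simp add: distrib_left trig_poly.add)
qed

lemma trig_poly_mult:
  assumes "trig_poly f" "trig_poly g"
  shows "trig_poly (\<lambda>x. f x * g x)"
  using assms
  by (induction rule: trig_poly.induct) (auto simp: distrib_right intro: trig_poly_mult_wave trig_poly.add)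

lemma trig_poly_continuous: "trig_poly f \<Longrightarrow> continuous_on UNIV f"
  by (induction rule: trig_poly.induct) (auto intro!: continuous_intros)

lemma trig_poly_bounded: "trig_poly f \<Longrightarrow> \<exists>C. \<forall>x. \<bar>f x\<bar> \<le> C"
proof (induction rule: trig_poly.induct)
  case (wave c a b)
  have "\<bar>c * cos (a \<bullet> x + b)\<bar> \<le> \<bar>c\<bar>" for x
    by (simp add: abs_mult mult_left_le)
  then show ?case by blast
next
  case (add f g)
  then obtain C D where "\<And>x. \<bar>f x\<bar> \<le> C" "\<And>x. \<bar>g x\<bar> \<le> D" by blast
  then have "\<bar>f x + g x\<bar> \<le> C + D" for x
    by (meson abs_triangle_ineq add_mono order_trans)
  then show ?case by blast
qed

lemma trig_poly_separates:
  assumes "x \<noteq> y"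
  shows "\<exists>f. trig_poly f \<and> f x \<noteq> f y"
proof -
  \<comment> \<open>The frequency is chosen so that the phases at \<open>x\<close> and \<open>y\<close> differ by exactly \<open>pi\<close>.\<close>
  define v where "v = (pi / ((x - y) \<bullet> (x - y))) *\<^sub>R (x - y)"
  have "(x - y) \<bullet> (x - y) \<noteq> 0" using assms by simp
  then have "v \<bullet> x - v \<bullet> y = pi"
    unfolding inner_diff_right[symmetric] v_def by simp
  then have "1 * cos (v \<bullet> x + - (v \<bullet> y)) \<noteq> 1 * cos (v \<bullet> y + - (v \<bullet> y))" by simp
  then show ?thesis using trig_poly.wave[of 1 v "- (v \<bullet> y)"] by blast
qed

lemma trig_poly_compose_polynomial:
  fixes q :: "real \<Rightarrow> real"
  assumes "real_polynomial_function q" "trig_poly f"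
  shows "trig_poly (\<lambda>x. q (f x))"
  using assms(1)
proof (induction rule: real_polynomial_function.induct)
  case (linear h)
  then obtain c where "h = (\<lambda>x. x * c)" using real_bounded_linear by blast
  then show ?case using trig_poly_mult[OF assms(2) trig_poly_const[of c]] by simp
qed (auto intro: trig_poly_const trig_poly.add trig_poly_mult)

text \<open>
  The Stone--Weierstrass theorem alone gives an approximation on a ball and no control outside.
  A global bound is obtained by clipping the approximation \<open>p\<close> at height \<open>B\<close>, which does not increase
  the error since \<open>\<bar>f\<bar> \<le> B\<close>.  Clipping is approximated by a univariate polynomial on the bounded range
  of \<open>p\<close>, and polynomials of trigonometric polynomials are trigonometric polynomials.
\<close>

lemma trig_poly_approximation:
  fixes f :: "'a::euclidean_space \<Rightarrow> real"
  assumes f: "continuous_on UNIV f" "\<And>x. \<bar>f x\<bar> \<le> B" and e: "e > 0"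
  obtains g where "trig_poly g" "\<And>x. norm x \<le> R \<Longrightarrow> \<bar>f x - g x\<bar> \<le> e" "\<And>x. \<bar>g x\<bar> \<le> B + e"
proof -
  have "\<exists>p. trig_poly p \<and> (\<forall>x\<in>cball 0 R. \<bar>f x - p x\<bar> < e/2)"
  proof (rule Stone_Weierstrass_HOL)
    show "continuous_on (cball 0 R) h" if "trig_poly h" for h :: "'a \<Rightarrow> real"
      using trig_poly_continuous[OF that] by (rule continuous_on_subset) simp
    show "continuous_on (cball 0 R) f"
      using f(1) by (rule continuous_on_subset) simp
  qed (use e in \<open>auto intro: trig_poly_const trig_poly.add trig_poly_mult trig_poly_separates\<close>)
  then obtain p where p: "trig_poly p" "\<And>x. norm x \<le> R \<Longrightarrow> \<bar>f x - p x\<bar> < e/2" by auto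
  obtain C where C: "\<And>x. \<bar>p x\<bar> \<le> C" using trig_poly_bounded[OF p(1)] by blast
  have cont: "continuous_on {-C..C} (\<lambda>y. max (-B) (min B y))" by (intro continuous_intros)
  obtain q where q: "real_polynomial_function q"
      "\<And>y. y \<in> {-C..C} \<Longrightarrow> \<bar>max (-B) (min B y) - q y\<bar> < e/2"
    using Stone_Weierstrass_real_polynomial_function[OF compact_Icc cont, of "e/2"] e by auto
  have *: "\<bar>max (-B) (min B (p x)) - q (p x)\<bar> < e/2" for x
    using q(2)[of "p x"] C[of x] by (simp add: abs_le_iff)
  show ?thesis
  proof (rule that[of "\<lambda>x. q (p x)"])
    show "trig_poly (\<lambda>x. q (p x))" by (rule trig_poly_compose_polynomial[OF q(1) p(1)])
    show "\<bar>f x - q (p x)\<bar> \<le> e" if "norm x \<le> R" for x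
      using p(2)[OF that] *[of x] f(2)[of x] by linarith
    show "\<bar>q (p x)\<bar> \<le> B + e" for x
      using *[of x] f(2)[of x] e by linarith
  qed
qed

text \<open>
  The point of tightness is that outside a large ball only the global bound on the approximating
  trigonometric polynomial matters.
\<close>

lemma weakly_converges_if_tight_and_waves:
  fixes \<mu> :: "nat \<Rightarrow> 'a::euclidean_space measure"
  assumes \<mu>: "\<And>n. prob_space (\<mu> n)" "\<And>n. sets (\<mu> n) = sets borel"
    and \<nu>: "prob_space \<nu>" "sets \<nu> = sets borel"
    and tight: "\<And>e. e > 0 \<Longrightarrow> \<exists>R. \<forall>n. measure (\<mu> n) {x. norm x > R} \<le> e"
    and waves: "\<And>a b. (\<lambda>n. \<integral>x. cos (a \<bullet> x + b) \<partial>\<mu> n) \<longlonglongrightarrow> (\<integral>x. cos (a \<bullet> x + b) \<partial>\<nu>)"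
  shows "weakly_converges \<mu> \<nu>"
  unfolding weakly_converges_def
proof (intro allI impI, elim conjE)
  fix f :: "'a \<Rightarrow> real"
  assume f: "continuous_on UNIV f" "bounded (range f)"
  obtain B where B: "B > 0" "\<And>x. \<bar>f x\<bar> \<le> B"
    using f(2) unfolding bounded_pos by auto
  have int: "integrable N h" if "prob_space N" "sets N = sets borel" "continuous_on UNIV h" "\<And>x. \<bar>h x\<bar> \<le> C"
    for N and h :: "'a \<Rightarrow> real" and C
  proof -
    interpret prob_space N by fact
    have [measurable]: "h \<in> borel_measurable N"
      using borel_measurable_continuous_onI[OF that(3)] measurable_cong_sets[OF that(2) refl] by blast
    show ?thesis by (rule integrable_const_bound[of _ C]) (use that(4) in auto)
  qed
  have int_trig: "integrable N g" if "prob_space N" "sets N = sets borel" "trig_poly g" for N and g :: "'a \<Rightarrow> real"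
    using trig_poly_bounded[OF that(3)] trig_poly_continuous[OF that(3)] int[OF that(1,2)] by blast
  have trig: "(\<lambda>n. \<integral>x. g x \<partial>\<mu> n) \<longlonglongrightarrow> (\<integral>x. g x \<partial>\<nu>)" if "trig_poly g" for g
    using that
  proof (induction rule: trig_poly.induct)
    case (wave c a b)
    then show ?case using tendsto_mult_left[OF waves[of a b], of c] by simp
  next
    case (add g h)
    have "(\<integral>x. g x + h x \<partial>N) = (\<integral>x. g x \<partial>N) + (\<integral>x. h x \<partial>N)" if "prob_space N" "sets N = sets borel" for N
      using add int_trig[OF that] by simp
    then show ?case using \<mu> \<nu> tendsto_add[OF add.IH] by simp
  qed
  show "(\<lambda>n. \<integral>x. f x \<partial>\<mu> n) \<longlonglongrightarrow> (\<integral>x. f x \<partial>\<nu>)"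
  proof (rule LIMSEQ_I)
    fix r :: real assume r: "r > 0"
    \<comment> \<open>\<open>e \<le> B\<close> makes \<open>\<bar>f - g\<bar> \<le> 3 * B\<close> everywhere for the approximation \<open>g\<close> below; the total error is \<open>5 * e < r\<close>.\<close>
    define e where "e = min (r / 9) B"
    have e: "e > 0" "e \<le> B" "9 * e \<le> r" using r B by (auto simp: e_def)
    obtain R1 where R1: "\<And>n. measure (\<mu> n) {x. norm x > R1} \<le> e / (3 * B)"
      using tight[of "e / (3 * B)"] e B by auto
    interpret N: prob_space \<nu> by fact
    have "(\<lambda>n. measure \<nu> {x. norm x > real n}) \<longlonglongrightarrow> measure \<nu> (\<Inter>n. {x. norm x > real n})"
      by (rule N.finite_Lim_measure_decseq) (auto simp: decseq_def \<nu>(2))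
    also have "(\<Inter>n. {x::'a. norm x > real n}) = {}"
    proof -
      have "\<exists>n. \<not> real n < norm x" for x :: 'a
        using reals_Archimedean2[of "norm x"] by (meson less_asym)
      then show ?thesis by blast
    qed
    finally have "(\<lambda>n. measure \<nu> {x. norm x > real n}) \<longlonglongrightarrow> 0" by simp
    then have "\<forall>\<^sub>F n in sequentially. measure \<nu> {x. norm x > real n} < e / (3 * B)"
      by (rule order_tendstoD) (use e B in auto)
    then obtain R2 where R2: "measure \<nu> {x. norm x > real R2} \<le> e / (3 * B)"
      unfolding eventually_sequentially by (meson less_imp_le order_refl)
    define R where "R = max R1 (real R2)"
    obtain g where g: "trig_poly g" "\<And>x. norm x \<le> R \<Longrightarrow> \<bar>f x - g x\<bar> \<le> e" "\<And>x. \<bar>g x\<bar> \<le> B + e"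
      using trig_poly_approximation[OF f(1) B(2) e(1)] by blast
    have close: "\<bar>(\<integral>x. f x \<partial>N) - (\<integral>x. g x \<partial>N)\<bar> \<le> 2 * e"
      if N: "prob_space N" "sets N = sets borel" and tail: "measure N {x. norm x > R'} \<le> e / (3 * B)" and "R' \<le> R" for N R'
    proof -
      interpret prob_space N by fact
      have [measurable_cong]: "sets N = sets borel" by fact
      have *: "{x. norm x > R} \<in> sets N" "{x. norm x > R'} \<in> sets N" by simp_all
      have i: "integrable N f" "integrable N g"
        using int[OF N f(1) B(2)] int_trig[OF N g(1)] .
      have "\<bar>(\<integral>x. f x \<partial>N) - (\<integral>x. g x \<partial>N)\<bar> = \<bar>\<integral>x. f x - g x \<partial>N\<bar>"
        using i by simp
      also have "\<dots> \<le> (\<integral>x. \<bar>f x - g x\<bar> \<partial>N)" by (rule integral_abs_bound)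
      also have "\<dots> \<le> (\<integral>x. e + 3 * B * indicator {x. norm x > R} x \<partial>N)"
      proof (rule integral_mono)
        show "integrable N (\<lambda>x. \<bar>f x - g x\<bar>)" using i by simp
        show "integrable N (\<lambda>x. e + 3 * B * indicator {x. norm x > R} x)"
          using * by (intro Bochner_Integration.integrable_add integrable_mult_right) (auto simp: emeasure_eq_measure)
        show "\<bar>f x - g x\<bar> \<le> e + 3 * B * indicator {x. norm x > R} x" for x
          using g(2)[of x] g(3)[of x] B(2)[of x] e by (auto simp: indicator_def)
      qed
      also have "\<dots> = e + 3 * B * measure N {x. norm x > R}"
        using * prob_space by (subst Bochner_Integration.integral_add) (auto simp: emeasure_eq_measure)
      also have "\<dots> \<le> e + 3 * B * measure N {x. norm x > R'}"
        using * B \<open>R' \<le> R\<close> by (intro add_left_mono mult_left_mono finite_measure_mono) auto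
      also have "\<dots> \<le> e + 3 * B * (e / (3 * B))"
        using tail B by (intro add_left_mono mult_left_mono) auto
      finally show ?thesis using B by simp
    qed
    obtain n0 where n0: "\<And>n. n \<ge> n0 \<Longrightarrow> \<bar>(\<integral>x. g x \<partial>\<mu> n) - (\<integral>x. g x \<partial>\<nu>)\<bar> < e"
      using LIMSEQ_D[OF trig[OF g(1)] e(1)] by auto
    show "\<exists>n0. \<forall>n\<ge>n0. norm ((\<integral>x. f x \<partial>\<mu> n) - (\<integral>x. f x \<partial>\<nu>)) < r"
    proof (intro exI allI impI)
      fix n assume "n \<ge> n0"
      have "\<bar>(\<integral>x. f x \<partial>\<mu> n) - (\<integral>x. g x \<partial>\<mu> n)\<bar> \<le> 2 * e"
        by (rule close[OF \<mu> R1]) (simp add: R_def)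
      moreover have "\<bar>(\<integral>x. f x \<partial>\<nu>) - (\<integral>x. g x \<partial>\<nu>)\<bar> \<le> 2 * e"
        by (rule close[OF \<nu> R2]) (simp add: R_def)
      ultimately show "norm ((\<integral>x. f x \<partial>\<mu> n) - (\<integral>x. f x \<partial>\<nu>)) < r"
        using n0[OF \<open>n \<ge> n0\<close>] e unfolding real_norm_def by linarith
    qed
  qed
qed

section \<open>Multivariate normal laws with arbitrary covariance\<close>

lemma nonneg_definite_symmetric: "nonneg_definite S \<Longrightarrow> S $ a $ b = S $ b $ a"
  unfolding nonneg_definite_def by (metis transpose_def vec_lambda_beta)

lemma quadratic_form_expand: "x \<bullet> (S *v y) = (\<Sum>a\<in>UNIV. \<Sum>b\<in>UNIV. x $ a * S $ a $ b * y $ b)"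
  for S :: "real ^ 'n ^ 'n"
  by (simp add: inner_vec_def matrix_vector_mult_def sum_distrib_left mult.assoc)

lemma nonneg_definite_bilinear_sym:
  assumes "nonneg_definite S"
  shows "x \<bullet> (S *v y) = y \<bullet> (S *v x)"
proof -
  have "transpose S = S" using assms by (simp add: nonneg_definite_def)
  then show ?thesis by (metis dot_lmul_matrix inner_commute transpose_matrix_vector)
qed

lemma nonneg_definite_zero_diagonal:
  assumes S: "nonneg_definite S" and "S $ a $ a = 0"
  shows "S $ a $ b = 0"
proof (rule ccontr)
  assume ne: "S $ a $ b \<noteq> 0"
  have ax: "axis i 1 \<bullet> (S *v axis j 1) = S $ i $ j" for i j
    by (simp add: inner_axis' matrix_vector_mult_basis column_def)
  \<comment> \<open>With \<open>S $ a $ a = 0\<close> the quadratic form on \<open>t e\<^sub>a + e\<^sub>b\<close> is affine in \<open>t\<close>; this \<open>t\<close> gives it the value \<open>-1\<close>.\<close>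
  define t where "t = (- S $ b $ b - 1) / (2 * S $ a $ b)"
  have "0 \<le> (t *\<^sub>R axis a 1 + axis b 1) \<bullet> (S *v (t *\<^sub>R axis a 1 + axis b 1))"
    using S by (simp add: nonneg_definite_def)
  also have "\<dots> = t * t * S $ a $ a + t * S $ a $ b + t * S $ b $ a + S $ b $ b"
    by (simp add: matrix_vector_right_distrib matrix_vector_mult_scaleR inner_add_left inner_add_right ax algebra_simps)
  also have "\<dots> = 2 * t * S $ a $ b + S $ b $ b"
    using nonneg_definite_symmetric[OF S, of b a] assms(2) by simp
  also have "\<dots> = - 1" using ne by (simp add: t_def field_simps)
  finally show False by simp
qed

text \<open>
  Gaussian elimination: subtracting \<open>w w\<^sup>T\<close> for a normalized column \<open>w\<close> with nonzero diagonal entry \<open>c\<close>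
  leaves a Schur complement, which is again nonnegative definite and whose row and column \<open>c\<close> vanish.
  Rows that vanished before stay zero, so the number of nonzero diagonal entries decreases.
\<close>

lemma nonneg_definite_rank_one_sum:
  fixes S :: "real ^ 'n::finite ^ 'n"
  assumes "nonneg_definite S"
  shows "\<exists>(m :: nat) (v :: nat \<Rightarrow> real ^ 'n). \<forall>a b. S $ a $ b = (\<Sum>k<m. v k $ a * v k $ b)"
  using assms
proof (induction "card {a. S $ a $ a \<noteq> 0}" arbitrary: S rule: less_induct)
  case less
  show ?case
  proof (cases "\<forall>a. S $ a $ a = 0")
    case True
    then have "S $ a $ b = 0" for a b
      using nonneg_definite_zero_diagonal[OF less.prems] by blast
    then show ?thesis by (intro exI[of _ 0]) simp
  next
    case False
    then obtain c where c: "S $ c $ c \<noteq> 0" by blast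
    have ax: "x \<bullet> (S *v axis c 1) = x \<bullet> column c S" for x
      by (simp add: matrix_vector_mult_basis)
    have cc: "axis c 1 \<bullet> (S *v axis c 1) = S $ c $ c"
      by (simp add: inner_axis' matrix_vector_mult_basis column_def)
    have pos: "S $ c $ c > 0"
      using less.prems c cc by (metis nonneg_definite_def order_le_less)
    define w where "w = (1 / sqrt (S $ c $ c)) *\<^sub>R column c S"
    define S' where "S' = (\<chi> a b. S $ a $ b - w $ a * w $ b)"
    have w: "w $ a * w $ b = S $ a $ c * S $ b $ c / S $ c $ c" for a b
      using pos by (simp add: w_def column_def)
    have S'q: "x \<bullet> (S' *v x) = x \<bullet> (S *v x) - (x \<bullet> w)\<^sup>2" for x
      unfolding quadratic_form_expand
      by (simp add: S'_def inner_vec_def power2_eq_square sum_product algebra_simps sum_subtractf)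
    have "nonneg_definite S'"
      unfolding nonneg_definite_def
    proof (intro conjI allI)
      show "transpose S' = S'"
        using nonneg_definite_symmetric[OF less.prems]
        by (simp add: S'_def transpose_def vec_eq_iff mult.commute)
      fix x
      \<comment> \<open>This \<open>t\<close> minimizes the quadratic form of \<open>S\<close> on the line \<open>x - t e\<^sub>c\<close>; the minimum is the form of \<open>S'\<close> at \<open>x\<close>.\<close>
      define t where "t = (x \<bullet> column c S) / S $ c $ c"
      have "0 \<le> (x - t *\<^sub>R axis c 1) \<bullet> (S *v (x - t *\<^sub>R axis c 1))"
        using less.prems by (simp add: nonneg_definite_def)
      also have "\<dots> = x \<bullet> (S *v x) - 2 * t * (x \<bullet> (S *v axis c 1)) + t * t * S $ c $ c"
        using nonneg_definite_bilinear_sym[OF less.prems, of "axis c 1" x] cc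
        by (simp add: matrix_vector_mult_diff_distrib matrix_vector_mult_scaleR inner_diff_left inner_diff_right algebra_simps)
      also have "\<dots> = x \<bullet> (S' *v x)"
        unfolding S'q using pos by (simp add: ax t_def w_def power_divide power2_eq_square field_simps)
      finally show "0 \<le> x \<bullet> (S' *v x)" .
    qed
    moreover have "{a. S' $ a $ a \<noteq> 0} \<subset> {a. S $ a $ a \<noteq> 0}"
    proof -
      have "S' $ a $ a = 0" if "S $ a $ a = 0" for a
        using nonneg_definite_zero_diagonal[OF less.prems that] that by (simp add: S'_def w)
      moreover have "S' $ c $ c = 0" using pos by (simp add: S'_def w)
      ultimately show ?thesis using c by auto
    qed
    then have "card {a. S' $ a $ a \<noteq> 0} < card {a. S $ a $ a \<noteq> 0}"
      by (rule psubset_card_mono[rotated]) simp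
    ultimately obtain m :: nat and v where v: "\<And>a b. S' $ a $ b = (\<Sum>k<m. v k $ a * v k $ b)"
      using less.hyps by blast
    have "S $ a $ b = (\<Sum>k<Suc m. (v(m := w)) k $ a * (v(m := w)) k $ b)" for a b
      using v[of a b] by (simp add: S'_def)
    then show ?thesis by blast
  qed
qed

lemma char_normal_law:
  assumes "v \<ge> 0"
  shows "char (normal_law 0 v) t = of_real (exp (- (t\<^sup>2 * v) / 2))"
proof (cases "v = 0")
  case True
  then show ?thesis by (simp add: normal_law_def char_def integral_return)
next
  case False
  then have v: "v > 0" using assms by simp
  interpret std: real_distribution std_normal_distribution by (rule real_dist_normal_dist)
  have "distributed std_normal_distribution lborel (\<lambda>x. 0 + sqrt v * x) (normal_density (0 + sqrt v * 0) (\<bar>sqrt v\<bar> * 1))"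
    by (rule std.normal_density_affine) (use v in \<open>auto simp: distributed_def distr_id2\<close>)
  then have "distr std_normal_distribution lborel (\<lambda>x. sqrt v * x) = density lborel (normal_density 0 (sqrt v))"
    using v by (auto simp: distributed_def)
  then have "normal_law 0 v = distr std_normal_distribution borel (\<lambda>x. sqrt v * x)"
    using v by (simp add: normal_law_def cong: distr_cong)
  then have "char (normal_law 0 v) t = char std_normal_distribution (t * sqrt v)"
    by (simp add: char_def integral_distr mult.assoc)
  then show ?thesis
    using v by (simp add: char_std_normal_distribution power_mult_distrib)
qed

lemma real_distribution_normal_law:
  assumes "v \<ge> 0"
  shows "real_distribution (normal_law m v)"
  using assms prob_space_normal_density[of "sqrt v" m] prob_space_return[of m borel]
  by (auto simp: normal_law_def real_distribution_def real_distribution_axioms_def)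

text \<open>
  If \<open>S = \<Sum>k<m. v\<^sub>k v\<^sub>k\<^sup>T\<close> and \<open>z\<^sub>k\<close> are independent standard normal, then \<open>\<Sum>k<m. z\<^sub>k v\<^sub>k\<close> has law \<open>N(0, S)\<close>.
  Univariate marginals are identified through their characteristic functions, which treats degenerate
  directions on the same footing as the others.
\<close>

lemma multi_normal_exists:
  fixes S :: "real ^ 'n::finite ^ 'n"
  assumes S: "nonneg_definite S"
  shows "\<exists>N. is_multi_normal 0 S N"
proof -
  obtain m :: nat and v where v: "\<And>a b. S $ a $ b = (\<Sum>k<m. v k $ a * v k $ b)"
    using nonneg_definite_rank_one_sum[OF S] by blast
  \<comment> \<open>Infinitely many coordinates avoid a case distinction on whether \<open>m = 0\<close>.\<close>
  define P where "P = PiM (UNIV :: nat set) (\<lambda>_. std_normal_distribution)"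
  interpret std: real_distribution std_normal_distribution by (rule real_dist_normal_dist)
  interpret P: prob_space P unfolding P_def by (intro prob_space_PiM std.prob_space_axioms)
  have coord[measurable]: "(\<lambda>z. z k) \<in> borel_measurable P" for k
  proof -
    have "(\<lambda>z. z k) \<in> P \<rightarrow>\<^sub>M std_normal_distribution"
      unfolding P_def by (rule measurable_component_singleton) simp
    then show ?thesis by simp
  qed
  have distr_coord: "distr P borel (\<lambda>z. z k) = std_normal_distribution" for k
  proof -
    have "distr P std_normal_distribution (\<lambda>z. z k) = std_normal_distribution"
      unfolding P_def by (rule distr_PiM_component) (auto intro: std.prob_space_axioms)
    then show ?thesis by (metis distr_cong sets_density sets_lborel)
  qed
  have indep: "P.indep_vars (\<lambda>_. borel) (\<lambda>k z. z k) UNIV"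
  proof -
    have "sets P = sets (\<Pi>\<^sub>M i\<in>(UNIV::nat set). (borel :: real measure))"
      unfolding P_def by (intro sets_PiM_cong) auto
    then have "distr P (\<Pi>\<^sub>M i\<in>UNIV. borel) (\<lambda>x. \<lambda>i\<in>UNIV. x i) = P"
      using distr_id2[of "\<Pi>\<^sub>M i\<in>(UNIV::nat set). borel" P] by (simp add: restrict_UNIV)
    also have "\<dots> = (\<Pi>\<^sub>M i\<in>UNIV. distr P borel (\<lambda>z. z i))"
      by (simp add: distr_coord P_def[symmetric])
    finally show ?thesis
      by (subst P.indep_vars_iff_distr_eq_PiM') auto
  qed
  define X where "X z = (\<Sum>k<m. z k *\<^sub>R v k)" for z :: "nat \<Rightarrow> real"
  have [measurable]: "X \<in> borel_measurable P" unfolding X_def by measurable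
  have quad: "a \<bullet> (S *v a) = (\<Sum>k<m. (a \<bullet> v k)\<^sup>2)" for a
  proof -
    have "a \<bullet> (S *v a) = (\<Sum>i\<in>UNIV. \<Sum>j\<in>UNIV. \<Sum>k<m. (a $ i * v k $ i) * (a $ j * v k $ j))"
      unfolding quadratic_form_expand v by (simp add: sum_distrib_left sum_distrib_right mult_ac)
    also have "\<dots> = (\<Sum>i\<in>UNIV. \<Sum>k<m. \<Sum>j\<in>UNIV. (a $ i * v k $ i) * (a $ j * v k $ j))"
      by (intro sum.cong refl sum.swap)
    also have "\<dots> = (\<Sum>k<m. \<Sum>i\<in>UNIV. \<Sum>j\<in>UNIV. (a $ i * v k $ i) * (a $ j * v k $ j))"
      by (rule sum.swap)
    finally show ?thesis by (simp add: inner_vec_def power2_eq_square sum_product)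
  qed
  define N where "N = distr P borel X"
  have "distr N borel (\<lambda>x. a \<bullet> x) = normal_law (a \<bullet> 0) (a \<bullet> (S *v a))" for a
  proof (rule Levy_uniqueness)
    have nn: "a \<bullet> (S *v a) \<ge> 0" using S by (simp add: nonneg_definite_def)
    show "real_distribution (normal_law (a \<bullet> 0) (a \<bullet> (S *v a)))"
      using nn by (rule real_distribution_normal_law)
    have eq: "distr N borel (\<lambda>x. a \<bullet> x) = distr P borel (\<lambda>z. \<Sum>k<m. z k * (a \<bullet> v k))"
      unfolding N_def by (subst distr_distr) (auto simp: comp_def X_def inner_sum_right)
    show "real_distribution (distr N borel (\<lambda>x. a \<bullet> x))"
      unfolding eq by (intro P.real_distribution_distr) measurable
    show "char (distr N borel (\<lambda>x. a \<bullet> x)) = char (normal_law (a \<bullet> 0) (a \<bullet> (S *v a)))"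
    proof
      fix t
      have ind: "P.indep_vars (\<lambda>_. borel) (\<lambda>k z. z k * (a \<bullet> v k)) {..<m}"
        by (rule P.indep_vars_compose2[OF P.indep_vars_subset[OF indep]]) auto
      have "char (distr P borel (\<lambda>z. z k * (a \<bullet> v k))) t = of_real (exp (- (t\<^sup>2 * (a \<bullet> v k)\<^sup>2) / 2))" for k
      proof -
        have "char (distr P borel (\<lambda>z. z k * (a \<bullet> v k))) t = char (distr P borel (\<lambda>z. z k)) (t * (a \<bullet> v k))"
          by (simp add: char_def integral_distr mult_ac)
        then show ?thesis
          by (simp add: distr_coord char_std_normal_distribution power_mult_distrib)
      qed
      then have "char (distr N borel (\<lambda>x. a \<bullet> x)) t = (\<Prod>k<m. of_real (exp (- (t\<^sup>2 * (a \<bullet> v k)\<^sup>2) / 2)))"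
        unfolding eq P.char_distr_sum[OF ind] by simp
      also have "\<dots> = of_real (exp (- (t\<^sup>2 * (a \<bullet> (S *v a))) / 2))"
        unfolding quad of_real_prod[symmetric] exp_sum[symmetric, OF finite_lessThan]
        by (simp add: sum_distrib_left sum_negf sum_divide_distrib)
      finally show "char (distr N borel (\<lambda>x. a \<bullet> x)) t = char (normal_law (a \<bullet> 0) (a \<bullet> (S *v a))) t"
        using char_normal_law[OF nn] by simp
    qed
  qed
  then have "is_multi_normal 0 S N"
    using S by (auto simp: is_multi_normal_def N_def intro!: P.prob_space_distr)
  then show ?thesis ..
qed

section \<open>Second moments of independent sums\<close>

lemma (in prob_space) indep_vars_pair:
  assumes "indep_vars (\<lambda>_. borel) Y I" "i \<in> I" "j \<in> I" "i \<noteq> j"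
  shows "indep_var borel (Y i) borel (Y j)"
proof -
  have "indep_var (PiM {i} (\<lambda>_. borel)) (\<lambda>\<omega>. restrict (\<lambda>i. Y i \<omega>) {i}) (PiM {j} (\<lambda>_. borel)) (\<lambda>\<omega>. restrict (\<lambda>i. Y i \<omega>) {j})"
    by (rule indep_var_restrict[OF assms(1)]) (use assms in auto)
  from indep_var_compose[OF this, of "\<lambda>z. z i" borel "\<lambda>z. z j" borel]
  show ?thesis by (simp add: comp_def)
qed

lemma (in prob_space) second_moment_sum_indep:
  fixes Y :: "'b \<Rightarrow> 'a \<Rightarrow> real"
  assumes indep: "indep_vars (\<lambda>_. borel) Y J" and "I \<subseteq> J" "finite I"
    and int: "\<And>i. i \<in> J \<Longrightarrow> integrable M (\<lambda>\<omega>. (Y i \<omega>)\<^sup>2)"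
    and mean: "\<And>i. i \<in> J \<Longrightarrow> expectation (Y i) = 0"
  shows "integrable M (\<lambda>\<omega>. (\<Sum>i\<in>I. Y i \<omega>)\<^sup>2)" (is ?int)
    and "expectation (\<lambda>\<omega>. (\<Sum>i\<in>I. Y i \<omega>)\<^sup>2) = (\<Sum>i\<in>I. expectation (\<lambda>\<omega>. (Y i \<omega>)\<^sup>2))" (is ?eq)
proof -
  have rv: "random_variable borel (Y i)" if "i \<in> J" for i
    using indep that by (auto simp: indep_vars_def2)
  have int1: "integrable M (Y i)" if "i \<in> J" for i
    by (rule square_integrable_imp_integrable[OF rv[OF that] int[OF that]])
  have prod: "integrable M (\<lambda>\<omega>. Y i \<omega> * Y j \<omega>) \<and>
      expectation (\<lambda>\<omega>. Y i \<omega> * Y j \<omega>) = (if i = j then expectation (\<lambda>\<omega>. (Y i \<omega>)\<^sup>2) else 0)"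
    if "i \<in> J" "j \<in> J" for i j
  proof (cases "i = j")
    case True
    then show ?thesis using int[OF that(1)] by (simp add: power2_eq_square)
  next
    case False
    then show ?thesis
      using indep_var_integrable[OF indep_vars_pair[OF indep that False] int1 int1]
        indep_var_lebesgue_integral[OF indep_vars_pair[OF indep that False] int1 int1] that mean by simp
  qed
  have sq: "(\<Sum>i\<in>I. Y i \<omega>)\<^sup>2 = (\<Sum>i\<in>I. \<Sum>j\<in>I. Y i \<omega> * Y j \<omega>)" for \<omega>
    by (simp add: power2_eq_square sum_product)
  have I: "i \<in> J" if "i \<in> I" for i using assms(2) that by blast
  show ?int unfolding sq using prod I by (intro Bochner_Integration.integrable_sum) auto
  have "expectation (\<lambda>\<omega>. (\<Sum>i\<in>I. Y i \<omega>)\<^sup>2) = (\<Sum>i\<in>I. \<Sum>j\<in>I. expectation (\<lambda>\<omega>. Y i \<omega> * Y j \<omega>))"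
    unfolding sq using prod I by (simp add: Bochner_Integration.integral_sum)
  also have "\<dots> = (\<Sum>i\<in>I. \<Sum>j\<in>I. if i = j then expectation (\<lambda>\<omega>. (Y i \<omega>)\<^sup>2) else 0)"
    using prod I by (intro sum.cong refl) auto
  also have "\<dots> = (\<Sum>i\<in>I. expectation (\<lambda>\<omega>. (Y i \<omega>)\<^sup>2))"
    using assms(3) by simp
  finally show ?eq .
qed

section \<open>Lindeberg condition and characteristic functions\<close>

lemma exp_minus_approx:
  fixes x :: real
  assumes "x \<ge> 0"
  shows "\<bar>exp (- x) - (1 - x)\<bar> \<le> x\<^sup>2"
proof -
  have "1 - x \<le> exp (- x)" using exp_ge_add_one_self[of "- x"] by simp
  moreover have "exp (- x) \<le> 1 / (1 + x)"
    using exp_ge_add_one_self[of x] assms by (simp add: exp_minus field_simps)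
  moreover have "1 / (1 + x) \<le> 1 - x + x\<^sup>2"
  proof -
    have "0 \<le> x ^ 3" using assms by simp
    then have "1 \<le> (1 - x + x\<^sup>2) * (1 + x)" by (simp add: algebra_simps power2_eq_square power3_eq_cube)
    then show ?thesis using assms by (simp add: pos_divide_le_eq)
  qed
  ultimately show ?thesis by linarith
qed

text \<open>
  Both the characteristic function of the normalized sum and \<open>exp (- t\<^sup>2 A\<^sub>n / 2)\<close>, with \<open>A\<^sub>n\<close> the average
  variance, are products of \<open>n\<close> factors of modulus at most one, so they differ by at most the sum of the
  differences of the factors.  Each factor is compared with its Taylor polynomial \<open>1 - t\<^sup>2 v\<^sub>i / (2 n)\<close>.
  The resulting error \<open>E\<close> consists of the Lindeberg terms \<open>L\<close>, which vanish for each fixed truncation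
  level \<open>\<eta>\<close>, and of terms that are small with \<open>\<eta>\<close>.
\<close>

lemma (in prob_space) Lindeberg_char:
  fixes Y :: "nat \<Rightarrow> 'a \<Rightarrow> real"
  assumes indep: "indep_vars (\<lambda>_. borel) Y {1..}"
    and int: "\<And>i. i \<ge> 1 \<Longrightarrow> integrable M (\<lambda>\<omega>. (Y i \<omega>)\<^sup>2)"
    and mean: "\<And>i. i \<ge> 1 \<Longrightarrow> expectation (Y i) = 0"
    and var: "(\<lambda>n. (1 / real n) * (\<Sum>i=1..n. expectation (\<lambda>\<omega>. (Y i \<omega>)\<^sup>2))) \<longlonglongrightarrow> s"
    and Lindeberg: "\<And>\<eta>. \<eta> > 0 \<Longrightarrow> (\<lambda>n. (1 / real n) * (\<Sum>i=1..n.
        expectation (\<lambda>\<omega>. (Y i \<omega>)\<^sup>2 * of_bool (\<bar>Y i \<omega>\<bar> > sqrt (real n) * \<eta>)))) \<longlonglongrightarrow> 0"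
  shows "(\<lambda>n. char (distr M borel (\<lambda>\<omega>. (\<Sum>i=1..n. Y i \<omega>) / sqrt (real n))) t)
           \<longlonglongrightarrow> of_real (exp (- (t\<^sup>2 * s) / 2))"
proof -
  define v where "v i = expectation (\<lambda>\<omega>. (Y i \<omega>)\<^sup>2)" for i
  define l where "l n \<eta> i = expectation (\<lambda>\<omega>. (Y i \<omega>)\<^sup>2 * of_bool (\<bar>Y i \<omega>\<bar> > sqrt (real n) * \<eta>))" for n \<eta> i
  define A where "A n = (1 / real n) * (\<Sum>i=1..n. v i)" for n
  define L where "L n \<eta> = (1 / real n) * (\<Sum>i=1..n. l n \<eta> i)" for n \<eta>
  define x where "x n i = t\<^sup>2 * v i / (2 * real n)" for n i
  define \<phi> where "\<phi> n i = char (distr M borel (\<lambda>\<omega>. Y i \<omega> / sqrt (real n))) t" for n i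
  have A: "A \<longlonglongrightarrow> s" using var by (simp add: A_def[abs_def] v_def)
  have L: "(\<lambda>n. L n \<eta>) \<longlonglongrightarrow> 0" if "\<eta> > 0" for \<eta>
    using Lindeberg[OF that] by (simp add: L_def[abs_def] l_def)
  have rv: "random_variable borel (Y i)" if "i \<ge> 1" for i
    using indep that by (auto simp: indep_vars_def2)
  have int1: "integrable M (Y i)" if "i \<ge> 1" for i
    by (rule square_integrable_imp_integrable[OF rv[OF that] int[OF that]])
  have intl: "integrable M (\<lambda>\<omega>. (Y i \<omega>)\<^sup>2 * of_bool (\<bar>Y i \<omega>\<bar> > c))" if "i \<ge> 1" for i c
    using rv[OF that]
    by (intro Bochner_Integration.integrable_bound[OF int[OF that]]) auto
  have v0: "v i \<ge> 0" for i by (simp add: v_def)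
  have l0: "l n \<eta> i \<ge> 0" for n \<eta> i unfolding l_def by (intro integral_nonneg_AE) auto
  have A0: "A n \<ge> 0" and L0: "L n \<eta> \<ge> 0" for n \<eta>
    using v0 l0 by (auto simp: A_def L_def intro!: divide_nonneg_nonneg sum_nonneg)
  have x0: "x n i \<ge> 0" for n i by (simp add: x_def v0)
  have s0: "s \<ge> 0" using LIMSEQ_le_const[OF A] A0 by blast
  define E where "E n \<eta> = t\<^sup>2 * L n \<eta> + t\<^sup>2 * (\<bar>t\<bar> * \<eta> * A n) / 6 + t\<^sup>2 * t\<^sup>2 / 4 * ((\<eta>\<^sup>2 + L n \<eta>) * A n)" for n \<eta>
  have main: "norm (char (distr M borel (\<lambda>\<omega>. (\<Sum>i=1..n. Y i \<omega>) / sqrt (real n))) t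
      - of_real (exp (- (t\<^sup>2 * A n) / 2))) \<le> E n \<eta>" if n: "n \<ge> 1" and \<eta>: "\<eta> > 0" for n \<eta>
  proof -
    have n0: "real n > 0" using n by simp
    \<comment> \<open>Uniform negligibility of the individual variances, needed for the second-order terms.\<close>
    have vle: "v i \<le> real n * \<eta>\<^sup>2 + l n \<eta> i" if i: "i \<ge> 1" for i
    proof -
      have "v i \<le> expectation (\<lambda>\<omega>. real n * \<eta>\<^sup>2 + (Y i \<omega>)\<^sup>2 * of_bool (\<bar>Y i \<omega>\<bar> > sqrt (real n) * \<eta>))"
        unfolding v_def
      proof (rule integral_mono[OF int[OF i]])
        show "integrable M (\<lambda>\<omega>. real n * \<eta>\<^sup>2 + (Y i \<omega>)\<^sup>2 * of_bool (\<bar>Y i \<omega>\<bar> > sqrt (real n) * \<eta>))"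
          using intl[OF i] by simp
        fix \<omega>
        have "(Y i \<omega>)\<^sup>2 \<le> real n * \<eta>\<^sup>2" if "\<bar>Y i \<omega>\<bar> \<le> sqrt (real n) * \<eta>"
          using power_mono[OF that, of 2] by (simp add: power_mult_distrib)
        then show "(Y i \<omega>)\<^sup>2 \<le> real n * \<eta>\<^sup>2 + (Y i \<omega>)\<^sup>2 * of_bool (\<bar>Y i \<omega>\<bar> > sqrt (real n) * \<eta>)"
          by (cases "\<bar>Y i \<omega>\<bar> > sqrt (real n) * \<eta>") auto
      qed
      also have "\<dots> = real n * \<eta>\<^sup>2 + l n \<eta> i"
        using intl[OF i] by (simp add: l_def prob_space)
      finally show ?thesis .
    qed
    have term_bound: "norm (\<phi> n i - of_real (exp (- x n i))) \<le>
        t\<^sup>2 * (l n \<eta> i / n) + t\<^sup>2 * (\<bar>t\<bar> * \<eta> * (v i / n)) / 6 + t\<^sup>2 * t\<^sup>2 / 4 * ((\<eta>\<^sup>2 + L n \<eta>) * (v i / n))"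
      if i: "i \<in> {1..n}" for i
    proof -
      have i1: "i \<ge> 1" using i by simp
      define Z where "Z \<omega> = Y i \<omega> / sqrt (real n)" for \<omega>
      have Z2: "(Z \<omega>)\<^sup>2 = (Y i \<omega>)\<^sup>2 / n" for \<omega> by (simp add: Z_def power_divide)
      have [measurable]: "random_variable borel Z" unfolding Z_def using rv[OF i1] by measurable
      have Zint: "integrable M (\<lambda>\<omega>. (Z \<omega>)\<^sup>2)" using int[OF i1] by (simp add: Z2)
      have Zint1: "integrable M Z" unfolding Z_def using int1[OF i1] by simp
      have Zmean: "expectation Z = 0" unfolding Z_def using mean[OF i1] by simp
      have Zvar: "variance Z = v i / n" using Zmean by (simp add: Z2 v_def)
      have "norm (\<phi> n i - of_real (1 - t\<^sup>2 * (v i / n) / 2)) \<le>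
          (t\<^sup>2 / 6) * expectation (\<lambda>\<omega>. min (6 * (Z \<omega>)\<^sup>2) (\<bar>t\<bar> * \<bar>Z \<omega>\<bar> ^ 3))"
      proof -
        have "\<phi> n i = char (distr M borel Z) t" by (simp add: \<phi>_def Z_def[abs_def])
        then show ?thesis using char_approx3'[OF _ Zint1 Zint Zmean Zvar refl, of t] by simp
      qed
      also have "\<dots> \<le> (t\<^sup>2 / 6) * expectation (\<lambda>\<omega>. 6 * ((Y i \<omega>)\<^sup>2 * of_bool (\<bar>Y i \<omega>\<bar> > sqrt (real n) * \<eta>) / n) + \<bar>t\<bar> * \<eta> * (Z \<omega>)\<^sup>2)"
      proof (rule mult_left_mono[OF integral_mono])
        show "0 \<le> t\<^sup>2 / 6" by simp
        show "integrable M (\<lambda>\<omega>. min (6 * (Z \<omega>)\<^sup>2) (\<bar>t\<bar> * \<bar>Z \<omega>\<bar> ^ 3))"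
          by (rule Bochner_Integration.integrable_bound[of _ "\<lambda>\<omega>. 6 * (Z \<omega>)\<^sup>2"]) (use Zint in auto)
        show "integrable M (\<lambda>\<omega>. 6 * ((Y i \<omega>)\<^sup>2 * of_bool (\<bar>Y i \<omega>\<bar> > sqrt (real n) * \<eta>) / n) + \<bar>t\<bar> * \<eta> * (Z \<omega>)\<^sup>2)"
          using intl[OF i1] Zint by simp
        \<comment> \<open>Use the quadratic bound where \<open>\<bar>Z\<bar> > \<eta>\<close> and the cubic bound elsewhere.\<close>
        fix \<omega>
        show "min (6 * (Z \<omega>)\<^sup>2) (\<bar>t\<bar> * \<bar>Z \<omega>\<bar> ^ 3) \<le>
            6 * ((Y i \<omega>)\<^sup>2 * of_bool (\<bar>Y i \<omega>\<bar> > sqrt (real n) * \<eta>) / n) + \<bar>t\<bar> * \<eta> * (Z \<omega>)\<^sup>2"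
        proof (cases "\<bar>Y i \<omega>\<bar> > sqrt (real n) * \<eta>")
          case True
          have "min (6 * (Z \<omega>)\<^sup>2) (\<bar>t\<bar> * \<bar>Z \<omega>\<bar> ^ 3) \<le> 6 * (Z \<omega>)\<^sup>2" by simp
          also have "\<dots> \<le> 6 * (Z \<omega>)\<^sup>2 + \<bar>t\<bar> * \<eta> * (Z \<omega>)\<^sup>2" using \<eta> by simp
          finally show ?thesis using True by (simp add: Z2)
        next
          case False
          then have "\<bar>Z \<omega>\<bar> \<le> \<eta>" using n0 by (simp add: Z_def field_simps)
          then have "\<bar>t\<bar> * (\<bar>Z \<omega>\<bar> * (Z \<omega>)\<^sup>2) \<le> \<bar>t\<bar> * (\<eta> * (Z \<omega>)\<^sup>2)"
            by (intro mult_left_mono mult_right_mono) auto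
          moreover have "\<bar>Z \<omega>\<bar> ^ 3 = \<bar>Z \<omega>\<bar> * (Z \<omega>)\<^sup>2" by (simp add: power3_eq_cube power2_eq_square)
          ultimately show ?thesis using False by (simp add: mult.assoc min.coboundedI2)
        qed
      qed
      also have "\<dots> = (t\<^sup>2 / 6) * (6 * (l n \<eta> i / n) + \<bar>t\<bar> * \<eta> * (v i / n))"
      proof -
        have "integrable M (\<lambda>\<omega>. 6 * ((Y i \<omega>)\<^sup>2 * of_bool (\<bar>Y i \<omega>\<bar> > sqrt (real n) * \<eta>) / n))"
          "integrable M (\<lambda>\<omega>. \<bar>t\<bar> * \<eta> * (Z \<omega>)\<^sup>2)"
          using intl[OF i1] Zint by simp_all
        from Bochner_Integration.integral_add[OF this] show ?thesis
          by (simp add: l_def v_def Z2)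
      qed
      finally have 1: "norm (\<phi> n i - of_real (1 - x n i)) \<le> t\<^sup>2 * (l n \<eta> i / n) + t\<^sup>2 * (\<bar>t\<bar> * \<eta> * (v i / n)) / 6"
        by (simp add: x_def algebra_simps add_divide_distrib)
      have "l n \<eta> i \<le> (\<Sum>j=1..n. l n \<eta> j)"
        using i l0 by (intro member_le_sum) auto
      then have "l n \<eta> i / n \<le> L n \<eta>" using n0 by (simp add: L_def divide_right_mono)
      then have vn: "v i / n \<le> \<eta>\<^sup>2 + L n \<eta>"
        using divide_right_mono[OF vle[OF i1], of n] n0 by (simp add: add_divide_distrib)
      have "\<bar>exp (- x n i) - (1 - x n i)\<bar> \<le> (x n i)\<^sup>2"
        by (rule exp_minus_approx[OF x0])
      also have "(x n i)\<^sup>2 = t\<^sup>2 * t\<^sup>2 / 4 * ((v i / n) * (v i / n))"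
        by (simp add: x_def power2_eq_square)
      also have "\<dots> \<le> t\<^sup>2 * t\<^sup>2 / 4 * ((\<eta>\<^sup>2 + L n \<eta>) * (v i / n))"
        using vn v0 by (intro mult_left_mono mult_right_mono) auto
      finally have 2: "norm (of_real (exp (- x n i)) - of_real (1 - x n i) :: complex) \<le> t\<^sup>2 * t\<^sup>2 / 4 * ((\<eta>\<^sup>2 + L n \<eta>) * (v i / n))"
        by (simp only: of_real_diff[symmetric] norm_of_real)
      have "norm (\<phi> n i - of_real (exp (- x n i))) \<le> norm (\<phi> n i - of_real (1 - x n i)) + norm (of_real (exp (- x n i)) - of_real (1 - x n i) :: complex)"
        by (metis norm_triangle_ineq4 diff_diff_eq2 diff_add_cancel add_diff_cancel_right)
      then show ?thesis using 1 2 by linarith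
    qed
    have ind: "indep_vars (\<lambda>_. borel) (\<lambda>i \<omega>. Y i \<omega> / sqrt (real n)) {1..n}"
      by (rule indep_vars_compose2[OF indep_vars_subset[OF indep]]) auto
    have "char (distr M borel (\<lambda>\<omega>. (\<Sum>i=1..n. Y i \<omega>) / sqrt (real n))) t = (\<Prod>i=1..n. \<phi> n i)"
      unfolding sum_divide_distrib \<phi>_def by (rule char_distr_sum[OF ind])
    moreover have "of_real (exp (- (t\<^sup>2 * A n) / 2)) = (\<Prod>i=1..n. of_real (exp (- x n i)) :: complex)"
      unfolding of_real_prod[symmetric] exp_sum[symmetric, OF finite_atLeastAtMost]
      by (simp add: A_def x_def sum_negf sum_distrib_left sum_divide_distrib mult.commute)
    moreover have "norm ((\<Prod>i=1..n. \<phi> n i) - (\<Prod>i=1..n. of_real (exp (- x n i)))) \<le> (\<Sum>i=1..n. norm (\<phi> n i - of_real (exp (- x n i))))"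
    proof (rule norm_prod_diff)
      fix i assume "i \<in> {1..n}"
      then have "random_variable borel (\<lambda>\<omega>. Y i \<omega> / sqrt (real n))" using rv[of i] by simp
      then show "norm (\<phi> n i) \<le> 1"
        unfolding \<phi>_def by (intro real_distribution.cmod_char_le_1 real_distribution_distr)
      show "norm (of_real (exp (- x n i)) :: complex) \<le> 1" using x0[of n i] by simp
    qed
    moreover have "\<dots> \<le> (\<Sum>i=1..n. t\<^sup>2 * (l n \<eta> i / n) + t\<^sup>2 * (\<bar>t\<bar> * \<eta> * (v i / n)) / 6 + t\<^sup>2 * t\<^sup>2 / 4 * ((\<eta>\<^sup>2 + L n \<eta>) * (v i / n)))"
      by (rule sum_mono) (rule term_bound)
    moreover have "\<dots> = E n \<eta>"
      by (simp add: E_def A_def L_def sum.distrib sum_distrib_left sum_divide_distrib)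
    ultimately show ?thesis by simp
  qed
  have D: "(\<lambda>n. char (distr M borel (\<lambda>\<omega>. (\<Sum>i=1..n. Y i \<omega>) / sqrt (real n))) t
      - of_real (exp (- (t\<^sup>2 * A n) / 2))) \<longlonglongrightarrow> 0"
  proof (rule tendstoI)
    fix e :: real assume e: "e > 0"
    have "((\<lambda>\<eta>. t\<^sup>2 * (\<bar>t\<bar> * \<eta> * s) / 6 + t\<^sup>2 * t\<^sup>2 / 4 * (\<eta>\<^sup>2 * s)) \<longlongrightarrow> t\<^sup>2 * (\<bar>t\<bar> * 0 * s) / 6 + t\<^sup>2 * t\<^sup>2 / 4 * (0\<^sup>2 * s)) (at_right 0)"
      by (intro tendsto_intros) simp_all
    then have "\<forall>\<^sub>F \<eta> in at_right 0. t\<^sup>2 * (\<bar>t\<bar> * \<eta> * s) / 6 + t\<^sup>2 * t\<^sup>2 / 4 * (\<eta>\<^sup>2 * s) < e"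
      by (rule order_tendstoD) (use e in simp)
    moreover have "\<forall>\<^sub>F \<eta>::real in at_right 0. \<eta> > 0" by (rule eventually_at_right_less)
    ultimately have "\<forall>\<^sub>F \<eta> in at_right 0. \<eta> > 0 \<and> t\<^sup>2 * (\<bar>t\<bar> * \<eta> * s) / 6 + t\<^sup>2 * t\<^sup>2 / 4 * (\<eta>\<^sup>2 * s) < e"
      by eventually_elim simp
    then obtain \<eta> where \<eta>: "\<eta> > 0" "t\<^sup>2 * (\<bar>t\<bar> * \<eta> * s) / 6 + t\<^sup>2 * t\<^sup>2 / 4 * (\<eta>\<^sup>2 * s) < e"
      using eventually_happens'[OF trivial_limit_at_right_real] by blast
    have "(\<lambda>n. E n \<eta>) \<longlonglongrightarrow> t\<^sup>2 * 0 + t\<^sup>2 * (\<bar>t\<bar> * \<eta> * s) / 6 + t\<^sup>2 * t\<^sup>2 / 4 * ((\<eta>\<^sup>2 + 0) * s)"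
      unfolding E_def by (intro tendsto_intros A L[OF \<eta>(1)]) simp_all
    then have "\<forall>\<^sub>F n in sequentially. E n \<eta> < e"
      by (rule order_tendstoD) (use \<eta>(2) in simp)
    then show "\<forall>\<^sub>F n in sequentially. dist (char (distr M borel (\<lambda>\<omega>. (\<Sum>i=1..n. Y i \<omega>) / sqrt (real n))) t
        - of_real (exp (- (t\<^sup>2 * A n) / 2))) 0 < e"
      using eventually_ge_at_top[of 1]
      by eventually_elim (use main[OF _ \<eta>(1)] in \<open>auto intro: le_less_trans\<close>)
  qed
  have "(\<lambda>n. of_real (exp (- (t\<^sup>2 * A n) / 2)) :: complex) \<longlonglongrightarrow> of_real (exp (- (t\<^sup>2 * s) / 2))"
    by (intro tendsto_intros A) simp_all
  from tendsto_add[OF D this] show ?thesis by simp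
qed

section \<open>A strong law of large numbers\<close>

text \<open>
  By monotone convergence the series itself has finite expectation, so it converges almost everywhere.
\<close>

lemma AE_tendsto_0_if_summable_expectations:
  fixes f :: "nat \<Rightarrow> 'a \<Rightarrow> real"
  assumes int: "\<And>k. integrable M (f k)" and nn: "\<And>k x. f k x \<ge> 0"
    and sum: "summable (\<lambda>k. \<integral>x. f k x \<partial>M)"
  shows "AE x in M. (\<lambda>k. f k x) \<longlonglongrightarrow> 0"
proof -
  have [measurable]: "f k \<in> borel_measurable M" for k using int by auto
  have i0: "(\<integral>x. f k x \<partial>M) \<ge> 0" for k by (simp add: nn)
  have "(\<integral>\<^sup>+x. (\<Sum>k. ennreal (f k x)) \<partial>M) = (\<Sum>k. \<integral>\<^sup>+x. ennreal (f k x) \<partial>M)"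
    by (rule nn_integral_suminf) measurable
  also have "\<dots> = (\<Sum>k. ennreal (\<integral>x. f k x \<partial>M))"
    using int nn by (simp add: nn_integral_eq_integral)
  also have "\<dots> \<noteq> \<infinity>"
    using suminf_ennreal2[OF i0 sum] by simp
  finally have "AE x in M. (\<Sum>k. ennreal (f k x)) \<noteq> \<infinity>"
    by (intro nn_integral_noteq_infinite) auto
  then show ?thesis
  proof eventually_elim
    case (elim x)
    then have "summable (\<lambda>k. f k x)"
      by (intro summable_suminf_not_top) (auto simp: nn)
    then show ?case by (rule summable_LIMSEQ_zero)
  qed
qed

text \<open>
  Summation by parts: since \<open>a k\<close> grows at most quadratically and \<open>1/k\<^sup>3 - 1/(k+1)\<^sup>3\<close> is of order \<open>1/k\<^sup>4\<close>, the
  series is dominated by \<open>\<Sum>k. 1/k\<^sup>2\<close>.  Bounding each increment separately by \<open>C (k+1)\<^sup>2\<close> would only give a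
  harmonic series.
\<close>

lemma summable_increments_over_cubes:
  fixes a :: "nat \<Rightarrow> real"
  assumes mono: "\<And>k. a k \<le> a (Suc k)" and a0: "\<And>k. a k \<ge> 0"
    and bound: "\<And>k. a k \<le> C * (real k)\<^sup>2"
  shows "summable (\<lambda>k. (a (Suc (Suc k)) - a (Suc k)) / (real (Suc k)) ^ 3)"
proof (rule summableI_nonneg_bounded)
  have C: "C \<ge> 0" using bound[of 1] a0[of 1] by simp
  show "0 \<le> (a (Suc (Suc k)) - a (Suc k)) / (real (Suc k)) ^ 3" for k using mono[of "Suc k"] by simp
  have step: "a (Suc m) / (real m)^3 - a (Suc m) / (real (Suc m))^3 \<le> 7 * C * (1 / real m - 1 / real (Suc m))" if "m \<ge> 1" for m
  proof -
    define r where "r = real m"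
    have r: "r \<ge> 1" using that by (simp add: r_def)
    have "a (Suc m) / r^3 - a (Suc m) / (r+1)^3 = a (Suc m) * ((3 * r\<^sup>2 + 3 * r + 1) / (r^3 * (r+1)^3))"
    proof -
      have frac: "x / p - x / q = x * ((q - p) / (p * q))" if "p \<noteq> 0" "q \<noteq> 0" for x p q :: real
        using that by (simp add: field_simps)
      have "(r+1)^3 - r^3 = 3 * r\<^sup>2 + 3 * r + 1"
        by (simp add: power3_eq_cube power2_eq_square algebra_simps)
      then show ?thesis using frac[of "r^3" "(r+1)^3" "a (Suc m)"] r by simp
    qed
    also have "\<dots> \<le> (C * (r+1)\<^sup>2) * ((7 * r\<^sup>2) / (r^3 * (r+1)^3))"
    proof (intro mult_mono divide_right_mono)
      show "a (Suc m) \<le> C * (r+1)\<^sup>2" using bound[of "Suc m"] by (simp add: r_def add.commute)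
      show "3 * r\<^sup>2 + 3 * r + 1 \<le> 7 * r\<^sup>2"
      proof -
        have "r \<le> r * r" using mult_right_mono[OF r, of r] r by simp
        then show ?thesis using r unfolding power2_eq_square by linarith
      qed
    qed (use r C in auto)
    also have "\<dots> = 7 * C * (1 / r - 1 / (r + 1))"
    proof -
      have "(C * p\<^sup>2) * ((7 * r\<^sup>2) / (r^3 * p^3)) = 7 * C * (1 / (r * p))" if "p > 0" for p
        using that r by (simp add: power3_eq_cube power2_eq_square)
      moreover have "1 / r - 1 / (r + 1) = 1 / (r * (r + 1))"
        using r by (simp add: diff_frac_eq)
      ultimately show ?thesis using r by simp
    qed
    finally show ?thesis by (simp add: r_def add.commute)
  qed
  \<comment> \<open>The telescoping \<open>1 / m - 1 / Suc m\<close> of the previous step accumulates to \<open>1 - 1 / n\<close>; the extra 1 is slack.\<close>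
  have ind: "(\<Sum>k<n. (a (Suc (Suc k)) - a (Suc k)) / (real (Suc k)) ^ 3) \<le> a (Suc n) / (real n)^3 + 7 * C * (2 - 1 / real n)" if "n \<ge> 1" for n
    using that
  proof (induction n rule: nat_induct_at_least)
    case base
    have "a (Suc 0) \<ge> 0" by (rule a0)
    then show ?case using C by simp
  next
    case (Suc n)
    have "(\<Sum>k<Suc n. (a (Suc (Suc k)) - a (Suc k)) / (real (Suc k)) ^ 3) \<le>
        a (Suc n) / (real n)^3 + 7 * C * (2 - 1 / real n) + (a (Suc (Suc n)) - a (Suc n)) / (real (Suc n)) ^ 3"
      using Suc.IH by simp
    also have "\<dots> \<le> a (Suc (Suc n)) / (real (Suc n))^3 + 7 * C * (2 - 1 / real (Suc n))"
      using step[OF Suc.hyps] unfolding diff_divide_distrib right_diff_distrib by linarith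
    finally show ?case .
  qed
  show "(\<Sum>k<n. (a (Suc (Suc k)) - a (Suc k)) / (real (Suc k)) ^ 3) \<le> 22 * C" for n
  proof (cases "n \<ge> 1")
    case True
    define r where "r = real n"
    have r: "r \<ge> 1" using True by (simp add: r_def)
    have "a (Suc n) / (real n)^3 \<le> (C * (r+1)\<^sup>2) / r^3"
      using bound[of "Suc n"] unfolding r_def by (intro divide_right_mono) (auto simp: add.commute)
    also have "\<dots> \<le> C * (8 * r ^ 3) / r^3"
    proof (intro divide_right_mono mult_left_mono)
      have "(r + 1)\<^sup>2 \<le> (2 * r)\<^sup>2" using r by (intro power_mono) auto
      also have "\<dots> \<le> 8 * r ^ 3"
        using mult_left_mono[OF r, of "r * r"] r by (simp add: power2_eq_square power3_eq_cube)
      finally show "(r + 1)\<^sup>2 \<le> 8 * r ^ 3" .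
    qed (use r C in auto)
    also have "\<dots> = 8 * C" using r by simp
    finally have "a (Suc n) / (real n)^3 \<le> 8 * C" .
    moreover have "7 * C * (2 - 1 / real n) \<le> 7 * C * 2"
      using C by (intro mult_left_mono) auto
    ultimately show ?thesis using ind[OF True] by linarith
  next
    case False
    then have "n = 0" by simp
    then show ?thesis using C by simp
  qed
qed

text \<open>
  The variance of the average of the first \<open>k\<^sup>2\<close> terms is at most \<open>C / k\<^sup>2\<close>, which is summable, so the averages
  converge along the squares.  For \<open>k\<^sup>2 \<le> n \<le> (k+1)\<^sup>2\<close> the additional terms are dominated by the block
  \<open>B k\<close> of \<open>2k+1\<close> absolute values, whose squared expectation over \<open>k\<^sup>4\<close> is summable by the previous lemma.
\<close>

lemma (in prob_space) strong_law_bounded_average_variance: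
  fixes Y :: "nat \<Rightarrow> 'a \<Rightarrow> real"
  assumes indep: "indep_vars (\<lambda>_. borel) Y {1..}"
    and int: "\<And>i. i \<ge> 1 \<Longrightarrow> integrable M (\<lambda>\<omega>. (Y i \<omega>)\<^sup>2)"
    and mean: "\<And>i. i \<ge> 1 \<Longrightarrow> expectation (Y i) = 0"
    and var: "\<And>n. (\<Sum>i=1..n. expectation (\<lambda>\<omega>. (Y i \<omega>)\<^sup>2)) \<le> C * real n"
  shows "AE \<omega> in M. (\<lambda>n. (\<Sum>i=1..n. Y i \<omega>) / real n) \<longlonglongrightarrow> 0"
proof -
  define v where "v i = expectation (\<lambda>\<omega>. (Y i \<omega>)\<^sup>2)" for i
  define V where "V n = (\<Sum>i=1..n. v i)" for n
  define a where "a k = V (k\<^sup>2)" for k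
  define B where "B k \<omega> = (\<Sum>i\<in>{k\<^sup>2<..(Suc k)\<^sup>2}. \<bar>Y i \<omega>\<bar>)" for k \<omega>
  have v0: "v i \<ge> 0" for i by (simp add: v_def)
  have V_mono: "V m \<le> V n" if "m \<le> n" for m n
    unfolding V_def using v0 that by (intro sum_mono2) auto
  have V_le: "V n \<le> C * real n" for n using var[of n] by (simp add: V_def v_def)
  have a_bound: "a k \<le> C * (real k)\<^sup>2" for k using V_le[of "k\<^sup>2"] by (simp add: a_def)
  have "0 \<le> a 1" unfolding a_def V_def by (simp add: v0)
  then have C: "C \<ge> 0" using a_bound[of 1] by simp
  have 1: "AE \<omega> in M. (\<lambda>k. ((\<Sum>i=1..(Suc k)\<^sup>2. Y i \<omega>) / (real (Suc k))\<^sup>2)\<^sup>2) \<longlonglongrightarrow> 0"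
  proof (rule AE_tendsto_0_if_summable_expectations)
    show "integrable M (\<lambda>\<omega>. ((\<Sum>i=1..(Suc k)\<^sup>2. Y i \<omega>) / (real (Suc k))\<^sup>2)\<^sup>2)" for k
      using second_moment_sum_indep(1)[OF indep _ _ int mean, of "{1..(Suc k)\<^sup>2}"]
      unfolding power_divide by simp
    have e: "expectation (\<lambda>\<omega>. ((\<Sum>i=1..(Suc k)\<^sup>2. Y i \<omega>) / (real (Suc k))\<^sup>2)\<^sup>2) = a (Suc k) / (real (Suc k))^4" for k
      using second_moment_sum_indep(2)[OF indep _ _ int mean, of "{1..(Suc k)\<^sup>2}"]
      unfolding power_divide power_mult[symmetric] by (simp add: a_def V_def v_def)
    show "summable (\<lambda>k. expectation (\<lambda>\<omega>. ((\<Sum>i=1..(Suc k)\<^sup>2. Y i \<omega>) / (real (Suc k))\<^sup>2)\<^sup>2))"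
      unfolding e
    proof (rule summable_comparison_test')
      have "summable (\<lambda>k. inverse ((real (Suc k))\<^sup>2))"
        using inverse_power_summable[of 2, where 'a = real] summable_Suc_iff[of "\<lambda>k. inverse ((real k)\<^sup>2)"] by simp
      then show "summable (\<lambda>k. C * inverse ((real (Suc k))\<^sup>2))" by (rule summable_mult)
      fix k
      have "a (Suc k) / (real (Suc k))^4 \<le> (C * (real (Suc k))\<^sup>2) / (real (Suc k))^4"
        by (intro divide_right_mono a_bound) auto
      also have "\<dots> = C * inverse ((real (Suc k))\<^sup>2)"
        by (simp add: field_simps power2_eq_square power4_eq_xxxx del: of_nat_Suc)
      finally show "norm (a (Suc k) / (real (Suc k))^4) \<le> C * inverse ((real (Suc k))\<^sup>2)"
        using v0 by (simp add: a_def V_def sum_nonneg del: of_nat_Suc)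
    qed
  qed simp
  have B_sq: "(B k \<omega>)\<^sup>2 \<le> real (2 * k + 1) * (\<Sum>i\<in>{k\<^sup>2<..(Suc k)\<^sup>2}. (Y i \<omega>)\<^sup>2)" for k \<omega>
  proof -
    have "(\<Sum>i\<in>{k\<^sup>2<..(Suc k)\<^sup>2}. \<bar>Y i \<omega>\<bar> * 1)\<^sup>2 \<le> (\<Sum>i\<in>{k\<^sup>2<..(Suc k)\<^sup>2}. \<bar>Y i \<omega>\<bar>\<^sup>2) * (\<Sum>i\<in>{k\<^sup>2<..(Suc k)\<^sup>2}. 1\<^sup>2)"
      by (rule Cauchy_Schwarz_ineq_sum)
    moreover have "(Suc k)\<^sup>2 - k\<^sup>2 = 2 * k + 1" by (simp add: power2_eq_square)
    ultimately show ?thesis by (simp add: B_def mult.commute)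
  qed
  have Bint: "integrable M (\<lambda>\<omega>. (\<Sum>i\<in>{k\<^sup>2<..(Suc k)\<^sup>2}. (Y i \<omega>)\<^sup>2))" for k
    by (intro Bochner_Integration.integrable_sum int) auto
  have 2: "AE \<omega> in M. (\<lambda>k. real (2 * Suc k + 1) * (\<Sum>i\<in>{(Suc k)\<^sup>2<..(Suc (Suc k))\<^sup>2}. (Y i \<omega>)\<^sup>2) / (real (Suc k))^4) \<longlonglongrightarrow> 0"
  proof (rule AE_tendsto_0_if_summable_expectations)
    show "integrable M (\<lambda>\<omega>. real (2 * Suc k + 1) * (\<Sum>i\<in>{(Suc k)\<^sup>2<..(Suc (Suc k))\<^sup>2}. (Y i \<omega>)\<^sup>2) / (real (Suc k))^4)" for k
      using Bint[of "Suc k"] by (intro integrable_divide integrable_mult_right) auto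
    have blk: "(\<Sum>i\<in>{(Suc k)\<^sup>2<..(Suc (Suc k))\<^sup>2}. v i) = a (Suc (Suc k)) - a (Suc k)" for k
    proof -
      have "{1..(Suc (Suc k))\<^sup>2} = {1..(Suc k)\<^sup>2} \<union> {(Suc k)\<^sup>2<..(Suc (Suc k))\<^sup>2}"
        by (rule ivl_disj_un_two[symmetric]) (auto simp: power_mono)
      then have "V ((Suc (Suc k))\<^sup>2) = V ((Suc k)\<^sup>2) + (\<Sum>i\<in>{(Suc k)\<^sup>2<..(Suc (Suc k))\<^sup>2}. v i)"
        unfolding V_def by (subst sum.union_disjoint[symmetric]) auto
      then show ?thesis by (simp add: a_def)
    qed
    have e: "expectation (\<lambda>\<omega>. real (2 * Suc k + 1) * (\<Sum>i\<in>{(Suc k)\<^sup>2<..(Suc (Suc k))\<^sup>2}. (Y i \<omega>)\<^sup>2) / (real (Suc k))^4)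
        = real (2 * Suc k + 1) * (a (Suc (Suc k)) - a (Suc k)) / (real (Suc k))^4" for k
    proof -
      have "expectation (\<lambda>\<omega>. (\<Sum>i\<in>{(Suc k)\<^sup>2<..(Suc (Suc k))\<^sup>2}. (Y i \<omega>)\<^sup>2)) = (\<Sum>i\<in>{(Suc k)\<^sup>2<..(Suc (Suc k))\<^sup>2}. v i)"
        unfolding v_def by (intro Bochner_Integration.integral_sum int) auto
      then show ?thesis by (simp add: blk del: of_nat_Suc)
    qed
    have a_mono: "a k \<le> a (Suc k)" for k unfolding a_def by (intro V_mono) (simp add: power2_eq_square)
    have a0: "a k \<ge> 0" for k using v0 by (simp add: a_def V_def sum_nonneg)
    show "summable (\<lambda>k. expectation (\<lambda>\<omega>. real (2 * Suc k + 1) * (\<Sum>i\<in>{(Suc k)\<^sup>2<..(Suc (Suc k))\<^sup>2}. (Y i \<omega>)\<^sup>2) / (real (Suc k))^4))"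
      unfolding e
    proof (rule summable_comparison_test')
      show "summable (\<lambda>k. 3 * ((a (Suc (Suc k)) - a (Suc k)) / (real (Suc k)) ^ 3))"
        by (intro summable_mult summable_increments_over_cubes[OF a_mono a0 a_bound])
      fix k
      have "real (2 * Suc k + 1) * (a (Suc (Suc k)) - a (Suc k)) / (real (Suc k))^4
          \<le> (3 * real (Suc k)) * (a (Suc (Suc k)) - a (Suc k)) / (real (Suc k))^4"
        using a_mono[of "Suc k"] by (intro divide_right_mono mult_right_mono) auto
      also have "\<dots> = 3 * ((a (Suc (Suc k)) - a (Suc k)) / (real (Suc k)) ^ 3)"
        by (simp add: power3_eq_cube power4_eq_xxxx del: of_nat_Suc)
      finally show "norm (real (2 * Suc k + 1) * (a (Suc (Suc k)) - a (Suc k)) / (real (Suc k))^4) \<le> 3 * ((a (Suc (Suc k)) - a (Suc k)) / (real (Suc k)) ^ 3)"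
        using a_mono[of "Suc k"] by (simp del: of_nat_Suc)
    qed
  qed (auto intro!: divide_nonneg_nonneg mult_nonneg_nonneg sum_nonneg)
  show ?thesis
    using 1 2
  proof eventually_elim
    case (elim \<omega>)
    have s1: "(\<lambda>k. \<bar>(\<Sum>i=1..(Suc k)\<^sup>2. Y i \<omega>) / (real (Suc k))\<^sup>2\<bar>) \<longlonglongrightarrow> 0"
      using tendsto_real_sqrt[OF elim(1)] by simp
    have "(\<lambda>k. (B (Suc k) \<omega> / (real (Suc k))\<^sup>2)\<^sup>2) \<longlonglongrightarrow> 0"
    proof (rule tendsto_sandwich[OF _ _ tendsto_const elim(2)])
      show "\<forall>\<^sub>F k in sequentially. (B (Suc k) \<omega> / (real (Suc k))\<^sup>2)\<^sup>2
          \<le> real (2 * Suc k + 1) * (\<Sum>i\<in>{(Suc k)\<^sup>2<..(Suc (Suc k))\<^sup>2}. (Y i \<omega>)\<^sup>2) / (real (Suc k))^4"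
      proof (intro always_eventually allI)
        fix k
        show "(B (Suc k) \<omega> / (real (Suc k))\<^sup>2)\<^sup>2
          \<le> real (2 * Suc k + 1) * (\<Sum>i\<in>{(Suc k)\<^sup>2<..(Suc (Suc k))\<^sup>2}. (Y i \<omega>)\<^sup>2) / (real (Suc k))^4"
          using divide_right_mono[OF B_sq[of "Suc k" \<omega>], of "(real (Suc k))^4"]
          by (simp add: power_divide power_mult[symmetric] del: of_nat_Suc)
      qed
    qed simp
    from tendsto_real_sqrt[OF this]
    have s2: "(\<lambda>k. \<bar>B (Suc k) \<omega> / (real (Suc k))\<^sup>2\<bar>) \<longlonglongrightarrow> 0"
      by simp
    \<comment> \<open>The two sequences are indexed by \<open>Suc k\<close> to avoid division by zero; hence \<open>floor_sqrt n - 1\<close> below.\<close>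
    define g where "g k = \<bar>(\<Sum>i=1..(Suc k)\<^sup>2. Y i \<omega>) / (real (Suc k))\<^sup>2\<bar> + \<bar>B (Suc k) \<omega> / (real (Suc k))\<^sup>2\<bar>" for k
    have g: "g \<longlonglongrightarrow> 0" unfolding g_def using tendsto_add[OF s1 s2] by simp
    have lim: "filterlim (\<lambda>n. floor_sqrt n - 1) at_top sequentially"
      unfolding filterlim_at_top
    proof
      fix Z :: nat
      show "\<forall>\<^sub>F n in sequentially. Z \<le> floor_sqrt n - 1"
        using eventually_ge_at_top[of "(Suc Z)\<^sup>2"]
      proof eventually_elim
        case (elim n)
        then have "Suc Z \<le> floor_sqrt n" by (simp add: le_floor_sqrt_iff)
        then show ?case by simp
      qed
    qed
    show "(\<lambda>n. (\<Sum>i=1..n. Y i \<omega>) / real n) \<longlonglongrightarrow> 0"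
    proof (rule Lim_null_comparison[OF _ filterlim_compose[OF g lim]])
      show "\<forall>\<^sub>F n in sequentially. norm ((\<Sum>i=1..n. Y i \<omega>) / real n) \<le> g (floor_sqrt n - 1)"
        using eventually_ge_at_top[of 1]
      proof eventually_elim
        case (elim n)
        define k where "k = floor_sqrt n"
        have k: "k \<ge> 1" using elim by (simp add: k_def le_floor_sqrt_iff)
        have kn: "k\<^sup>2 \<le> n" "n \<le> (Suc k)\<^sup>2"
          by (simp_all add: k_def Suc_floor_sqrt_power2_gt less_imp_le)
        have "{1..n} = {1..k\<^sup>2} \<union> {k\<^sup>2<..n}" using kn k by auto
        then have "(\<Sum>i=1..n. Y i \<omega>) = (\<Sum>i=1..k\<^sup>2. Y i \<omega>) + (\<Sum>i\<in>{k\<^sup>2<..n}. Y i \<omega>)"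
          by (simp add: sum.union_disjoint ivl_disj_int)
        moreover have "\<bar>\<Sum>i\<in>{k\<^sup>2<..n}. Y i \<omega>\<bar> \<le> B k \<omega>"
        proof -
          have "\<bar>\<Sum>i\<in>{k\<^sup>2<..n}. Y i \<omega>\<bar> \<le> (\<Sum>i\<in>{k\<^sup>2<..n}. \<bar>Y i \<omega>\<bar>)" by (rule sum_abs)
          also have "\<dots> \<le> B k \<omega>" unfolding B_def using kn by (intro sum_mono2) auto
          finally show ?thesis .
        qed
        ultimately have "\<bar>\<Sum>i=1..n. Y i \<omega>\<bar> \<le> \<bar>\<Sum>i=1..k\<^sup>2. Y i \<omega>\<bar> + \<bar>B k \<omega>\<bar>" by linarith
        then have "\<bar>\<Sum>i=1..n. Y i \<omega>\<bar> / real n \<le> (\<bar>\<Sum>i=1..k\<^sup>2. Y i \<omega>\<bar> + \<bar>B k \<omega>\<bar>) / (real k)\<^sup>2"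
          using kn k by (intro frac_le) (auto simp flip: of_nat_power)
        also have "\<dots> = g (k - 1)" using k by (simp add: g_def add_divide_distrib)
        finally show ?case by (simp add: k_def)
      qed
    qed
  qed
qed

section \<open>The multivariate Lindeberg theorem\<close>

lemma nonneg_definite_covariance_matrix:
  fixes V :: "'w \<Rightarrow> real ^ 'k::finite"
  assumes "prob_space M" and [measurable]: "V \<in> borel_measurable M"
    and int: "integrable M (\<lambda>\<omega>. (norm (V \<omega>))\<^sup>2)" and mean: "\<And>a. (\<integral>\<omega>. V \<omega> $ a \<partial>M) = 0"
  shows covariance_quadratic_form: "c \<bullet> (covariance_matrix M V *v c) = (\<integral>\<omega>. (c \<bullet> V \<omega>)\<^sup>2 \<partial>M)"
    and "nonneg_definite (covariance_matrix M V)"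
    and integrable_inner_square: "integrable M (\<lambda>\<omega>. (c \<bullet> V \<omega>)\<^sup>2)"
proof -
  interpret prob_space M by fact
  have nth: "V \<omega> $ a = V \<omega> \<bullet> axis a 1" for \<omega> a by (simp add: inner_axis)
  have [measurable]: "(\<lambda>\<omega>. V \<omega> $ a) \<in> borel_measurable M" for a
    unfolding nth by measurable
  have prod: "integrable M (\<lambda>\<omega>. V \<omega> $ a * V \<omega> $ b)" for a b
  proof (rule Bochner_Integration.integrable_bound[OF int])
    have "norm (V \<omega> $ a * V \<omega> $ b) \<le> norm ((norm (V \<omega>))\<^sup>2)" for \<omega>
      using mult_mono[OF component_le_norm_cart[of "V \<omega>" a] component_le_norm_cart[of "V \<omega>" b]]
      by (simp add: abs_mult power2_eq_square)
    then show "AE \<omega> in M. norm (V \<omega> $ a * V \<omega> $ b) \<le> norm ((norm (V \<omega>))\<^sup>2)" by simp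
  qed measurable
  have cov: "covariance_matrix M V $ a $ b = (\<integral>\<omega>. V \<omega> $ a * V \<omega> $ b \<partial>M)" for a b
    by (simp add: covariance_matrix_def mean)
  have sq: "(c \<bullet> V \<omega>)\<^sup>2 = (\<Sum>a\<in>UNIV. \<Sum>b\<in>UNIV. (c $ a * c $ b) * (V \<omega> $ a * V \<omega> $ b))" for c \<omega>
    by (simp add: inner_vec_def power2_eq_square sum_product mult_ac)
  show int2: "integrable M (\<lambda>\<omega>. (c \<bullet> V \<omega>)\<^sup>2)" for c
    unfolding sq using prod by (intro Bochner_Integration.integrable_sum integrable_mult_right) auto
  show q: "c \<bullet> (covariance_matrix M V *v c) = (\<integral>\<omega>. (c \<bullet> V \<omega>)\<^sup>2 \<partial>M)" for c
    unfolding sq quadratic_form_expand cov using prod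
    by (simp add: Bochner_Integration.integral_sum mult_ac)
  show "nonneg_definite (covariance_matrix M V)"
    unfolding nonneg_definite_def q
    by (auto simp: transpose_def vec_eq_iff cov mult.commute)
qed

lemma integral_cos_eq_char:
  assumes "prob_space N" and [measurable]: "f \<in> borel_measurable N"
  shows "(\<integral>x. cos (f x + b) \<partial>N) = Re (iexp b * char (distr N borel f) 1)"
proof -
  interpret prob_space N by fact
  have int: "integrable N (\<lambda>x. iexp (f x))"
    by (rule integrable_iexp) auto
  have "iexp b * char (distr N borel f) 1 = (\<integral>x. iexp b * iexp (f x) \<partial>N)"
    using int by (simp add: char_def integral_distr)
  also have "Re \<dots> = (\<integral>x. Re (iexp b * iexp (f x)) \<partial>N)"
    using int by (subst integral_Re) auto
  also have "\<dots> = (\<integral>x. cos (f x + b) \<partial>N)"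
    by (intro Bochner_Integration.integral_cong refl) (simp add: exp_add[symmetric] Re_exp add.commute)
  finally show ?thesis by simp
qed

lemma tendsto_quadratic_form:
  fixes A :: "nat \<Rightarrow> real ^ 'k::finite ^ 'k"
  assumes "A \<longlonglongrightarrow> S"
  shows "(\<lambda>n. x \<bullet> (A n *v y)) \<longlonglongrightarrow> x \<bullet> (S *v y)"
  unfolding quadratic_form_expand
  by (intro tendsto_intros tendsto_vec_nth assms)

lemma nonneg_definite_limit:
  fixes A :: "nat \<Rightarrow> real ^ 'k::finite ^ 'k"
  assumes lim: "A \<longlonglongrightarrow> S" and A: "\<And>n. nonneg_definite (A n)"
  shows "nonneg_definite S"
  unfolding nonneg_definite_def
proof (intro conjI allI)
  have "S $ a $ b = S $ b $ a" for a b
  proof (rule LIMSEQ_unique)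
    show "(\<lambda>n. A n $ a $ b) \<longlonglongrightarrow> S $ a $ b" by (intro tendsto_vec_nth lim)
    show "(\<lambda>n. A n $ a $ b) \<longlonglongrightarrow> S $ b $ a"
      unfolding nonneg_definite_symmetric[OF A, of _ a b] by (intro tendsto_vec_nth lim)
  qed
  then show "transpose S = S" by (simp add: transpose_def vec_eq_iff)
  show "0 \<le> v \<bullet> (S *v v)" for v
    by (rule LIMSEQ_le_const[OF tendsto_quadratic_form[OF lim]]) (use A in \<open>auto simp: nonneg_definite_def\<close>)
qed

lemma nonneg_definite_scaled_sum:
  fixes A :: "'i \<Rightarrow> real ^ 'k::finite ^ 'k"
  assumes "\<And>i. i \<in> I \<Longrightarrow> nonneg_definite (A i)" "c \<ge> 0"
  shows "nonneg_definite (c *\<^sub>R (\<Sum>i\<in>I. A i))"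
    and quadratic_form_scaled_sum: "v \<bullet> ((c *\<^sub>R (\<Sum>i\<in>I. A i)) *v v) = c * (\<Sum>i\<in>I. v \<bullet> (A i *v v))"
proof -
  show q: "v \<bullet> ((c *\<^sub>R (\<Sum>i\<in>I. A i)) *v v) = c * (\<Sum>i\<in>I. v \<bullet> (A i *v v))" for v
  proof (cases "finite I")
    case True
    then have "v \<bullet> ((\<Sum>i\<in>I. A i) *v v) = (\<Sum>i\<in>I. v \<bullet> (A i *v v))"
      by (induction I rule: finite_induct) (simp_all add: matrix_vector_mult_add_rdistrib inner_add_right)
    then show ?thesis by (simp add: scaleR_matrix_vector_assoc[symmetric])
  qed simp
  show "nonneg_definite (c *\<^sub>R (\<Sum>i\<in>I. A i))"
    unfolding nonneg_definite_def q
    using assms nonneg_definite_symmetric[OF assms(1)]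
    by (auto simp: transpose_def vec_eq_iff nonneg_definite_def intro!: mult_nonneg_nonneg sum_nonneg)
qed

text \<open>
  Each functional \<open>c \<bullet> V\<^sub>i\<close> inherits the Lindeberg condition because \<open>\<bar>c \<bullet> V\<^sub>i\<bar> \<le> C \<parallel>V\<^sub>i\<parallel>\<close>, and its average variance
  converges to \<open>c \<bullet> S c\<close>.  Tightness is Chebyshev's inequality: the second moment of the normalized sum
  is the trace of the average covariance matrix, which converges.
\<close>

theorem multivariate_Lindeberg_CLT:
  fixes V :: "nat \<Rightarrow> 'w \<Rightarrow> real ^ 'k::finite"
  assumes "prob_space M"
    and indep: "prob_space.indep_vars M (\<lambda>_. borel) V {1..}"
    and int: "\<And>i. i \<ge> 1 \<Longrightarrow> integrable M (\<lambda>\<omega>. (norm (V i \<omega>))\<^sup>2)"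
    and mean: "\<And>i a. i \<ge> 1 \<Longrightarrow> (\<integral>\<omega>. V i \<omega> $ a \<partial>M) = 0"
    and cov: "(\<lambda>n. (1 / real n) *\<^sub>R (\<Sum>i=1..n. covariance_matrix M (V i))) \<longlonglongrightarrow> S"
    and Lindeberg: "\<And>\<eta>. \<eta> > 0 \<Longrightarrow> (\<lambda>n. (1 / real n) * (\<Sum>i=1..n.
        \<integral>\<omega>. (norm (V i \<omega>))\<^sup>2 * of_bool (norm (V i \<omega>) > sqrt (real n) * \<eta>) \<partial>M)) \<longlonglongrightarrow> 0"
  shows "\<exists>N. is_multi_normal 0 S N \<and>
    weakly_converges (\<lambda>n. distr M borel (\<lambda>\<omega>. (1 / sqrt (real n)) *\<^sub>R (\<Sum>i=1..n. V i \<omega>))) N"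
proof -
  interpret prob_space M by fact
  have rv: "V i \<in> borel_measurable M" if "i \<ge> 1" for i
    using indep that by (auto simp: indep_vars_def2)
  define A where "A n = (1 / real n) *\<^sub>R (\<Sum>i=1..n. covariance_matrix M (V i))" for n
  have A: "A \<longlonglongrightarrow> S" using cov by (simp add: A_def[abs_def])
  have psd: "nonneg_definite (covariance_matrix M (V i))" if "i \<ge> 1" for i
    using nonneg_definite_covariance_matrix(2)[OF \<open>prob_space M\<close> rv int mean] that by blast
  have Apsd: "nonneg_definite (A n)" for n
    unfolding A_def using psd by (intro nonneg_definite_scaled_sum(1)) auto
  have S: "nonneg_definite S" by (rule nonneg_definite_limit[OF A Apsd])
  then obtain N where N: "is_multi_normal 0 S N" using multi_normal_exists by blast
  then have Np: "prob_space N" "sets N = sets borel"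
    and Nl: "\<And>a. distr N borel (\<lambda>x. a \<bullet> x) = normal_law 0 (a \<bullet> (S *v a))"
    by (auto simp: is_multi_normal_def)
  define Z where "Z n \<omega> = (1 / sqrt (real n)) *\<^sub>R (\<Sum>i=1..n. V i \<omega>)" for n \<omega>
  have [measurable]: "Z n \<in> borel_measurable M" for n
    unfolding Z_def using rv by (intro borel_measurable_scaleR borel_measurable_sum borel_measurable_const) auto
  have indepc: "indep_vars (\<lambda>_. borel) (\<lambda>i \<omega>. c \<bullet> V i \<omega>) {1..}" for c
    by (rule indep_vars_compose2[OF indep]) auto
  have intc: "integrable M (\<lambda>\<omega>. (c \<bullet> V i \<omega>)\<^sup>2)" if "i \<ge> 1" for c i
    using integrable_inner_square[OF \<open>prob_space M\<close> rv int mean] that by blast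
  have varc: "expectation (\<lambda>\<omega>. (c \<bullet> V i \<omega>)\<^sup>2) = c \<bullet> (covariance_matrix M (V i) *v c)" if "i \<ge> 1" for c i
    using covariance_quadratic_form[OF \<open>prob_space M\<close> rv int mean] that by metis
  have meanc: "expectation (\<lambda>\<omega>. c \<bullet> V i \<omega>) = 0" if i: "i \<ge> 1" for c i
  proof -
    have "integrable M (\<lambda>\<omega>. axis a 1 \<bullet> V i \<omega>)" for a
      by (rule square_integrable_imp_integrable[OF _ intc[OF i]])
        (intro borel_measurable_inner borel_measurable_const rv i)
    then have "integrable M (\<lambda>\<omega>. V i \<omega> $ a)" for a by (simp add: inner_axis')
    then show ?thesis using mean[OF i] by (simp add: inner_vec_def)
  qed
  have Aquad: "(1 / real n) * (\<Sum>i=1..n. expectation (\<lambda>\<omega>. (c \<bullet> V i \<omega>)\<^sup>2)) = c \<bullet> (A n *v c)" for n c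
  proof -
    have "c \<bullet> (A n *v c) = (1 / real n) * (\<Sum>i=1..n. c \<bullet> (covariance_matrix M (V i) *v c))"
      unfolding A_def using psd by (intro quadratic_form_scaled_sum) auto
    then show ?thesis using varc by simp
  qed
  have Z_inner: "c \<bullet> Z n \<omega> = (\<Sum>i=1..n. c \<bullet> V i \<omega>) / sqrt (real n)" for c n \<omega>
    by (simp add: Z_def inner_sum_right)
  have char_lim: "(\<lambda>n. char (distr M borel (\<lambda>\<omega>. c \<bullet> Z n \<omega>)) 1) \<longlonglongrightarrow> of_real (exp (- (1\<^sup>2 * (c \<bullet> (S *v c))) / 2))" for c
    unfolding Z_inner
  proof (rule Lindeberg_char[OF indepc intc meanc])
    show "(\<lambda>n. (1 / real n) * (\<Sum>i=1..n. expectation (\<lambda>\<omega>. (c \<bullet> V i \<omega>)\<^sup>2))) \<longlonglongrightarrow> c \<bullet> (S *v c)"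
      unfolding Aquad by (rule tendsto_quadratic_form[OF A])
    fix \<eta> :: real assume \<eta>: "\<eta> > 0"
    \<comment> \<open>The summand 1 keeps \<open>\<eta> / C\<close> meaningful when \<open>c = 0\<close>.\<close>
    define C where "C = norm c + 1"
    have C: "C > 0" "norm c \<le> C" by (simp_all add: C_def add_nonneg_pos)
    have le: "expectation (\<lambda>\<omega>. (c \<bullet> V i \<omega>)\<^sup>2 * of_bool (\<bar>c \<bullet> V i \<omega>\<bar> > sqrt (real n) * \<eta>))
        \<le> C\<^sup>2 * expectation (\<lambda>\<omega>. (norm (V i \<omega>))\<^sup>2 * of_bool (norm (V i \<omega>) > sqrt (real n) * (\<eta> / C)))"
      if i: "i \<ge> 1" for i n
    proof -
      have "expectation (\<lambda>\<omega>. (c \<bullet> V i \<omega>)\<^sup>2 * of_bool (\<bar>c \<bullet> V i \<omega>\<bar> > sqrt (real n) * \<eta>))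
        \<le> expectation (\<lambda>\<omega>. C\<^sup>2 * ((norm (V i \<omega>))\<^sup>2 * of_bool (norm (V i \<omega>) > sqrt (real n) * (\<eta> / C))))"
      proof (rule integral_mono)
        show "integrable M (\<lambda>\<omega>. (c \<bullet> V i \<omega>)\<^sup>2 * of_bool (\<bar>c \<bullet> V i \<omega>\<bar> > sqrt (real n) * \<eta>))"
          using rv[OF i] by (intro Bochner_Integration.integrable_bound[OF intc[OF i, of c]]) auto
        show "integrable M (\<lambda>\<omega>. C\<^sup>2 * ((norm (V i \<omega>))\<^sup>2 * of_bool (norm (V i \<omega>) > sqrt (real n) * (\<eta> / C))))"
          using rv[OF i] by (intro integrable_mult_right Bochner_Integration.integrable_bound[OF int[OF i]]) auto
        fix \<omega>
        have b: "\<bar>c \<bullet> V i \<omega>\<bar> \<le> C * norm (V i \<omega>)"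
          using Cauchy_Schwarz_ineq2[of c "V i \<omega>"] mult_right_mono[OF C(2), of "norm (V i \<omega>)"] by simp
        then have "(c \<bullet> V i \<omega>)\<^sup>2 \<le> C\<^sup>2 * (norm (V i \<omega>))\<^sup>2"
          using power_mono[OF b, of 2] by (simp add: power_mult_distrib)
        moreover have "norm (V i \<omega>) > sqrt (real n) * (\<eta> / C)" if "\<bar>c \<bullet> V i \<omega>\<bar> > sqrt (real n) * \<eta>"
          using that b C by (simp add: divide_less_eq mult.commute)
        ultimately show "(c \<bullet> V i \<omega>)\<^sup>2 * of_bool (\<bar>c \<bullet> V i \<omega>\<bar> > sqrt (real n) * \<eta>)
            \<le> C\<^sup>2 * ((norm (V i \<omega>))\<^sup>2 * of_bool (norm (V i \<omega>) > sqrt (real n) * (\<eta> / C)))"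
          by (cases "\<bar>c \<bullet> V i \<omega>\<bar> > sqrt (real n) * \<eta>") auto
      qed
      then show ?thesis by simp
    qed
    show "(\<lambda>n. (1 / real n) * (\<Sum>i=1..n. expectation (\<lambda>\<omega>. (c \<bullet> V i \<omega>)\<^sup>2 * of_bool (\<bar>c \<bullet> V i \<omega>\<bar> > sqrt (real n) * \<eta>)))) \<longlonglongrightarrow> 0"
    proof (rule tendsto_sandwich[OF _ _ tendsto_const])
      have "(\<lambda>n. C\<^sup>2 * ((1 / real n) * (\<Sum>i=1..n.
          expectation (\<lambda>\<omega>. (norm (V i \<omega>))\<^sup>2 * of_bool (norm (V i \<omega>) > sqrt (real n) * (\<eta> / C)))))) \<longlonglongrightarrow> C\<^sup>2 * 0"
        using \<eta> C by (intro tendsto_mult_left Lindeberg) auto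
      then show "(\<lambda>n. C\<^sup>2 * ((1 / real n) * (\<Sum>i=1..n.
          expectation (\<lambda>\<omega>. (norm (V i \<omega>))\<^sup>2 * of_bool (norm (V i \<omega>) > sqrt (real n) * (\<eta> / C)))))) \<longlonglongrightarrow> 0"
        by simp
      show "\<forall>\<^sub>F n in sequentially. (1 / real n) * (\<Sum>i=1..n. expectation (\<lambda>\<omega>. (c \<bullet> V i \<omega>)\<^sup>2 * of_bool (\<bar>c \<bullet> V i \<omega>\<bar> > sqrt (real n) * \<eta>)))
          \<le> C\<^sup>2 * ((1 / real n) * (\<Sum>i=1..n. expectation (\<lambda>\<omega>. (norm (V i \<omega>))\<^sup>2 * of_bool (norm (V i \<omega>) > sqrt (real n) * (\<eta> / C)))))"
      proof (intro always_eventually allI)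
        fix n
        have "(\<Sum>i=1..n. expectation (\<lambda>\<omega>. (c \<bullet> V i \<omega>)\<^sup>2 * of_bool (\<bar>c \<bullet> V i \<omega>\<bar> > sqrt (real n) * \<eta>)))
          \<le> C\<^sup>2 * (\<Sum>i=1..n. expectation (\<lambda>\<omega>. (norm (V i \<omega>))\<^sup>2 * of_bool (norm (V i \<omega>) > sqrt (real n) * (\<eta> / C))))"
          unfolding sum_distrib_left using le by (intro sum_mono) auto
        from mult_left_mono[OF this, of "1 / real n"]
        show "(1 / real n) * (\<Sum>i=1..n. expectation (\<lambda>\<omega>. (c \<bullet> V i \<omega>)\<^sup>2 * of_bool (\<bar>c \<bullet> V i \<omega>\<bar> > sqrt (real n) * \<eta>)))
          \<le> C\<^sup>2 * ((1 / real n) * (\<Sum>i=1..n. expectation (\<lambda>\<omega>. (norm (V i \<omega>))\<^sup>2 * of_bool (norm (V i \<omega>) > sqrt (real n) * (\<eta> / C)))))"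
          by (simp add: mult.left_commute)
      qed
    qed (auto intro!: always_eventually divide_nonneg_nonneg sum_nonneg integral_nonneg_AE)
  qed
  have sq: "(norm x)\<^sup>2 = (\<Sum>a\<in>UNIV. (axis a 1 \<bullet> x)\<^sup>2)" for x :: "real ^ 'k"
  proof -
    have "(norm x)\<^sup>2 = (\<Sum>a\<in>UNIV. (x $ a)\<^sup>2)"
      unfolding power2_norm_eq_inner by (simp add: inner_vec_def power2_eq_square)
    then show ?thesis by (simp add: inner_axis')
  qed
  have Z2: "integrable M (\<lambda>\<omega>. (c \<bullet> Z n \<omega>)\<^sup>2)" "expectation (\<lambda>\<omega>. (c \<bullet> Z n \<omega>)\<^sup>2) = c \<bullet> (A n *v c)" for c n
  proof -
    show "integrable M (\<lambda>\<omega>. (c \<bullet> Z n \<omega>)\<^sup>2)"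
      using second_moment_sum_indep(1)[OF indepc _ _ intc meanc, of "{1..n}" c]
      unfolding Z_inner power_divide by simp
    show "expectation (\<lambda>\<omega>. (c \<bullet> Z n \<omega>)\<^sup>2) = c \<bullet> (A n *v c)"
      using second_moment_sum_indep(2)[OF indepc _ _ intc meanc, of "{1..n}" c]
      unfolding Z_inner power_divide Aquad[symmetric] by simp
  qed
  have "weakly_converges (\<lambda>n. distr M borel (Z n)) N"
  proof (rule weakly_converges_if_tight_and_waves)
    show "prob_space (distr M borel (Z n))" for n by (rule prob_space_distr) measurable
    show "prob_space N" "sets N = sets borel" by fact+
    fix a b
    have "(\<lambda>n. Re (iexp b * char (distr M borel (\<lambda>\<omega>. a \<bullet> Z n \<omega>)) 1)) \<longlonglongrightarrow> Re (iexp b * of_real (exp (- (1\<^sup>2 * (a \<bullet> (S *v a))) / 2)))"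
      by (intro tendsto_Re tendsto_mult_left char_lim)
    moreover have "(\<integral>x. cos (a \<bullet> x + b) \<partial>distr M borel (Z n)) = Re (iexp b * char (distr M borel (\<lambda>\<omega>. a \<bullet> Z n \<omega>)) 1)" for n
      by (subst integral_cos_eq_char[OF \<open>prob_space M\<close>, symmetric]) (auto simp: integral_distr)
    moreover have "(\<integral>x. cos (a \<bullet> x + b) \<partial>N) = Re (iexp b * of_real (exp (- (1\<^sup>2 * (a \<bullet> (S *v a))) / 2)))"
    proof -
      have [measurable_cong]: "sets N = sets borel" by fact
      have "(\<lambda>x. a \<bullet> x) \<in> borel_measurable N" by measurable
      from integral_cos_eq_char[OF Np(1) this, of b] show ?thesis
        using S by (simp add: Nl char_normal_law nonneg_definite_def)
    qed
    ultimately show "(\<lambda>n. \<integral>x. cos (a \<bullet> x + b) \<partial>distr M borel (Z n)) \<longlonglongrightarrow> (\<integral>x. cos (a \<bullet> x + b) \<partial>N)"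
      by simp
  next
    fix e :: real assume e: "e > 0"
    have "(\<lambda>n. \<Sum>a\<in>UNIV. axis a 1 \<bullet> (A n *v axis a 1)) \<longlonglongrightarrow> (\<Sum>a\<in>UNIV. axis a 1 \<bullet> (S *v axis a 1))"
      by (intro tendsto_sum tendsto_quadratic_form A)
    from convergent_imp_Bseq[OF convergentI[OF this]]
    obtain K where K: "K > 0" "\<And>n. norm (\<Sum>a\<in>UNIV. axis a 1 \<bullet> (A n *v axis a 1)) \<le> K"
      by (auto simp: Bseq_def)
    define R where "R = sqrt (K / e)"
    have R: "R > 0" using K e by (simp add: R_def)
    have "measure (distr M borel (Z n)) {x. norm x > R} \<le> e" for n
    proof -
      have i: "integrable M (\<lambda>\<omega>. (norm (Z n \<omega>))\<^sup>2)" unfolding sq using Z2(1) by simp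
      have "measure (distr M borel (Z n)) {x. norm x > R} = measure M {\<omega> \<in> space M. norm (Z n \<omega>) > R}"
        by (subst measure_distr) (auto intro!: arg_cong[where f = "measure M"])
      also have "\<dots> \<le> measure M {\<omega> \<in> space M. (norm (Z n \<omega>))\<^sup>2 \<ge> R\<^sup>2}"
        using R by (intro finite_measure_mono) (auto intro!: power_mono)
      also have "\<dots> \<le> expectation (\<lambda>\<omega>. (norm (Z n \<omega>))\<^sup>2) / R\<^sup>2"
        by (rule integral_Markov_inequality_measure[OF i, of "{}"]) (use R in auto)
      also have "expectation (\<lambda>\<omega>. (norm (Z n \<omega>))\<^sup>2) = (\<Sum>a\<in>UNIV. axis a 1 \<bullet> (A n *v axis a 1))"
        unfolding sq using Z2 by simp
      also have "\<dots> / R\<^sup>2 \<le> K / R\<^sup>2" using K(2)[of n] by (intro divide_right_mono) auto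
      also have "\<dots> = e" using K e by (simp add: R_def)
      finally show ?thesis .
    qed
    then show "\<exists>R. \<forall>n. measure (distr M borel (Z n)) {x. norm x > R} \<le> e" by blast
  qed simp
  then show ?thesis using N unfolding Z_def[abs_def] by blast
qed

section \<open>Hermite polynomials\<close>

lemma central_normal_moments:
  assumes "v \<ge> 0"
  shows "integrable (normal_law 0 v) (\<lambda>x. x ^ k)"
    and "(\<integral>x. x ^ (2 * j) \<partial>normal_law 0 v) = fact (2 * j) / (fact j * 2 ^ j) * v ^ j"
    and "(\<integral>x. x ^ (2 * j + 1) \<partial>normal_law 0 v) = 0"
proof -
  have "integrable (normal_law 0 v) (\<lambda>x. x ^ k) \<and>
      (\<integral>x. x ^ (2 * j) \<partial>normal_law 0 v) = fact (2 * j) / (fact j * 2 ^ j) * v ^ j \<and>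
      (\<integral>x. x ^ (2 * j + 1) \<partial>normal_law 0 v) = 0"
  proof (cases "v = 0")
    case True
    interpret R: prob_space "return borel (0::real)" by (rule prob_space_return) simp
    have "integrable (return borel 0) (\<lambda>x::real. x ^ k)"
      by (rule integrableI_bounded) (auto simp: nn_integral_return)
    then show ?thesis using True R.prob_space by (cases j) (simp_all add: normal_law_def integral_return)
  next
    case False
    then have v: "sqrt v > 0" using assms by simp
    have "integrable lborel (\<lambda>x. normal_density 0 (sqrt v) x * x ^ k)"
      using integrable_normal_moment[OF v, of 0 k] by simp
    moreover have "(\<integral>x. normal_density 0 (sqrt v) x * x ^ (2 * j) \<partial>lborel) = fact (2 * j) / (fact j * 2 ^ j) * v ^ j"
    proof -
      have "(\<integral>x. normal_density 0 (sqrt v) x * x ^ (2 * j) \<partial>lborel) = fact (2 * j) / ((2 / (sqrt v)\<^sup>2) ^ j * fact j)"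
        using integral_normal_moment_even[OF v, of 0 j] by simp
      also have "(sqrt v)\<^sup>2 = v" using v by simp
      finally show ?thesis using v by (simp add: power_divide field_simps)
    qed
    moreover have "(\<integral>x. normal_density 0 (sqrt v) x * x ^ (2 * j + 1) \<partial>lborel) = 0"
      using integral_normal_moment_odd[OF v, of 0 j] by simp
    ultimately show ?thesis
      using False by (simp add: normal_law_def integrable_density integral_density)
  qed
  then show "integrable (normal_law 0 v) (\<lambda>x. x ^ k)"
    and "(\<integral>x. x ^ (2 * j) \<partial>normal_law 0 v) = fact (2 * j) / (fact j * 2 ^ j) * v ^ j"
    and "(\<integral>x. x ^ (2 * j + 1) \<partial>normal_law 0 v) = 0" by blast+
qed

text \<open>
  The coefficient \<open>C_coeff n j\<close> is a binomial coefficient times the moment of order \<open>2j\<close> of a standard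
  normal variable, so it appears here with positive signs and in the debiased estimator with
  alternating ones.
\<close>

lemma shifted_normal_even_moment:
  assumes "v \<ge> 0"
  shows "integrable (normal_law 0 v) (\<lambda>y. (c + y) ^ m)"
    and "(\<integral>y. (c + y) ^ (2 * n) \<partial>normal_law 0 v) = (\<Sum>j\<le>n. C_coeff (2 * n) j * v ^ j * c ^ (2 * n - 2 * j))"
proof -
  have binom: "(c + y) ^ m = (\<Sum>r\<le>m. real (m choose r) * c ^ (m - r) * y ^ r)" for y m
    using binomial_ring[of y c m] by (simp add: add.commute mult_ac)
  show "integrable (normal_law 0 v) (\<lambda>y. (c + y) ^ m)"
    unfolding binom using central_normal_moments(1)[OF assms] by (intro Bochner_Integration.integrable_sum integrable_mult_right)
  define f where "f r = real (2 * n choose r) * c ^ (2 * n - r) * (\<integral>y. y ^ r \<partial>normal_law 0 v)" for r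
  have "(\<integral>y. (c + y) ^ (2 * n) \<partial>normal_law 0 v) = (\<Sum>r\<le>2 * n. f r)"
    unfolding binom f_def using central_normal_moments(1)[OF assms]
    by (subst Bochner_Integration.integral_sum) auto
  also have "\<dots> = (\<Sum>r\<in>(\<lambda>j. 2 * j) ` {..n}. f r)"
  proof (rule sum.mono_neutral_right)
    show "\<forall>r\<in>{..2 * n} - (\<lambda>j. 2 * j) ` {..n}. f r = 0"
    proof
      fix r assume "r \<in> {..2 * n} - (\<lambda>j. 2 * j) ` {..n}"
      then have "odd r" by (auto elim!: evenE)
      then obtain j where "r = 2 * j + 1" by (rule oddE)
      then show "f r = 0" unfolding f_def by (simp only: central_normal_moments(3)[OF assms] mult_zero_right)
    qed
  qed auto
  also have "\<dots> = (\<Sum>j\<le>n. f (2 * j))" by (subst sum.reindex) (auto simp: inj_on_def)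
  finally show "(\<integral>y. (c + y) ^ (2 * n) \<partial>normal_law 0 v) = (\<Sum>j\<le>n. C_coeff (2 * n) j * v ^ j * c ^ (2 * n - 2 * j))"
    unfolding f_def central_normal_moments(2)[OF assms] by (simp add: C_coeff_def mult_ac)
qed

lemma C_coeff_altdef:
  assumes "k \<le> g"
  shows "C_coeff (2 * g) k = fact (2 * g) / (fact (2 * (g - k)) * fact k * 2 ^ k)"
proof -
  have "2 * g - 2 * k = 2 * (g - k)" using assms by simp
  then show ?thesis
    using assms by (simp add: C_coeff_def binomial_fact field_simps)
qed

lemma C_coeff_convolution:
  assumes "k \<le> s" "s \<le> g"
  shows "C_coeff (2 * g) k * C_coeff (2 * (g - k)) (s - k) = C_coeff (2 * g) s * real (s choose k)"
proof -
  have k: "k \<le> g" "s - k \<le> g - k" and e: "g - k - (s - k) = g - s"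
    using assms by auto
  have p: "(2::real) ^ s = 2 ^ k * 2 ^ (s - k)"
    using assms by (simp flip: power_add)
  show ?thesis
    unfolding C_coeff_altdef[OF k(1)] C_coeff_altdef[OF k(2)] C_coeff_altdef[OF assms(2)]
      binomial_fact[OF assms(1)] e p
    by (simp add: field_simps)
qed

text \<open>
  Expanding the moments turns the left-hand side into a double sum over \<open>k\<close> and \<open>j\<close>.  Collecting the
  terms with \<open>k + j = s\<close>, the product of the coefficients depends on \<open>k\<close> only through \<open>(-1)\<^sup>k (s choose k)\<close>, and
  these cancel unless \<open>s = 0\<close>.
\<close>

lemma Hermite_debiases_power:
  assumes v: "v \<ge> 0"
  shows "(\<integral>y. (\<Sum>k\<le>g. C_coeff (2 * g) k * (- 1) ^ k * v ^ k * (c + y) ^ (2 * g - 2 * k)) \<partial>normal_law 0 v) = c ^ (2 * g)"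
proof -
  have "(\<integral>y. (\<Sum>k\<le>g. C_coeff (2 * g) k * (- 1) ^ k * v ^ k * (c + y) ^ (2 * g - 2 * k)) \<partial>normal_law 0 v)
      = (\<Sum>k\<le>g. C_coeff (2 * g) k * (- 1) ^ k * v ^ k * (\<integral>y. (c + y) ^ (2 * (g - k)) \<partial>normal_law 0 v))"
    using shifted_normal_even_moment(1)[OF v] by (subst Bochner_Integration.integral_sum) (auto simp: diff_mult_distrib2)
  also have "\<dots> = (\<Sum>k\<le>g. \<Sum>j\<le>g - k. C_coeff (2 * g) k * (- 1) ^ k * v ^ k * (C_coeff (2 * (g - k)) j * v ^ j * c ^ (2 * (g - k) - 2 * j)))"
    by (simp add: shifted_normal_even_moment(2)[OF v] sum_distrib_left)
  also have "\<dots> = (\<Sum>(k, j)\<in>{(k, j). k + j \<le> g}. C_coeff (2 * g) k * (- 1) ^ k * v ^ k * (C_coeff (2 * (g - k)) j * v ^ j * c ^ (2 * (g - k) - 2 * j)))"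
    by (subst sum.Sigma) (auto intro!: sum.cong)
  also have "\<dots> = (\<Sum>s\<le>g. \<Sum>k\<le>s. C_coeff (2 * g) k * (- 1) ^ k * v ^ k * (C_coeff (2 * (g - k)) (s - k) * v ^ (s - k) * c ^ (2 * (g - k) - 2 * (s - k))))"
    by (rule sum.triangle_reindex_eq)
  also have "\<dots> = (\<Sum>s\<le>g. C_coeff (2 * g) s * v ^ s * c ^ (2 * (g - s)) * (\<Sum>k\<le>s. (- 1) ^ k * real (s choose k)))"
    unfolding sum_distrib_left
  proof (intro sum.cong refl)
    fix s k assume "s \<in> {..g}" "k \<in> {..s}"
    then have le: "k \<le> s" "s \<le> g" by auto
    then have e: "2 * (g - k) - 2 * (s - k) = 2 * (g - s)" "v ^ s = v ^ k * v ^ (s - k)"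
      by (auto simp flip: power_add)
    have "C_coeff (2 * g) k * (- 1) ^ k * v ^ k * (C_coeff (2 * (g - k)) (s - k) * v ^ (s - k) * c ^ (2 * (g - k) - 2 * (s - k)))
        = (C_coeff (2 * g) k * C_coeff (2 * (g - k)) (s - k)) * (v ^ s * (- 1) ^ k * c ^ (2 * (g - s)))"
      unfolding e by (simp only: mult_ac)
    then show "C_coeff (2 * g) k * (- 1) ^ k * v ^ k * (C_coeff (2 * (g - k)) (s - k) * v ^ (s - k) * c ^ (2 * (g - k) - 2 * (s - k)))
        = C_coeff (2 * g) s * v ^ s * c ^ (2 * (g - s)) * ((- 1) ^ k * real (s choose k))"
      unfolding C_coeff_convolution[OF le] by (simp only: mult_ac)
  qed
  also have "\<dots> = (\<Sum>s\<le>g. if s = 0 then C_coeff (2 * g) 0 * c ^ (2 * g) else 0)"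
  proof (intro sum.cong refl)
    fix s
    show "C_coeff (2 * g) s * v ^ s * c ^ (2 * (g - s)) * (\<Sum>k\<le>s. (- 1) ^ k * real (s choose k))
        = (if s = 0 then C_coeff (2 * g) 0 * c ^ (2 * g) else 0)"
      using choose_alternating_sum[of s, where 'a = real] by auto
  qed
  also have "\<dots> = c ^ (2 * g)" by (simp add: C_coeff_def)
  finally show ?thesis .
qed

section \<open>Contraction of tensors\<close>

text \<open>
  The pairing of \<open>T\<close> with \<open>u \<otimes> \<dots> \<otimes> u\<close> (\<open>m\<close> factors).
\<close>

definition contract :: "real ^ 'j::finite \<Rightarrow> nat \<Rightarrow> 'j tensor \<Rightarrow> real" where
  "contract u m T = (\<Sum>l | length l = m. T l * prod_list (map (($) u) l))"

lemma finite_lists_length: "finite {l :: 'j::finite list. length l = m}"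
  using finite_lists_length_eq[of "UNIV :: 'j set" m] by simp

lemma tensor_prod_tensors:
  assumes "S \<in> tensors m" "T \<in> tensors n"
  shows "S \<otimes>\<^sub>t T \<in> tensors (m + n)"
proof -
  have "S (take k l) * T (drop k l) = 0" if "length l \<noteq> m + n" "k \<le> length l" for l k
    using assms that unfolding tensors_def by (cases "k = m") auto
  then show ?thesis unfolding tensors_def tensor_prod_def by (auto intro!: sum.neutral)
qed

lemma tensor_pow_tensors:
  assumes "T \<in> tensors m"
  shows "tensor_pow T k \<in> tensors (m * k)"
proof (induction k)
  case 0
  show ?case by (simp add: tensors_def)
next
  case (Suc k)
  show ?case using tensor_prod_tensors[OF assms Suc] by simp
qed

lemma contract_tensor_prod:
  assumes "S \<in> tensors m"
  shows "contract u (m + n) (S \<otimes>\<^sub>t T) = contract u m S * contract u n T"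
proof -
  have "contract u m S * contract u n T = (\<Sum>(l, l')\<in>{l. length l = m} \<times> {l. length l = n}.
      (S l * prod_list (map (($) u) l)) * (T l' * prod_list (map (($) u) l')))"
    by (simp add: contract_def sum_product sum.cartesian_product)
  also have "\<dots> = contract u (m + n) (S \<otimes>\<^sub>t T)"
    unfolding contract_def
  proof (rule sum.reindex_bij_witness[where i = "\<lambda>l. (take m l, drop m l)" and j = "\<lambda>(l, l'). l @ l'"])
    fix a :: "'a list \<times> 'a list" assume "a \<in> {l. length l = m} \<times> {l. length l = n}"
    then show "(S \<otimes>\<^sub>t T) (case a of (l, l') \<Rightarrow> l @ l') * prod_list (map (($) u) (case a of (l, l') \<Rightarrow> l @ l'))
        = (case a of (l, l') \<Rightarrow> S l * prod_list (map (($) u) l) * (T l' * prod_list (map (($) u) l')))"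
      using tensor_prod_homogeneous[OF assms, of "fst a @ snd a" T] by (auto simp: mult_ac)
  qed auto
  finally show ?thesis by simp
qed

lemma contract_tensor_pow:
  assumes "T \<in> tensors m"
  shows "contract u (m * k) (tensor_pow T k) = (contract u m T) ^ k"
proof (induction k)
  case 0
  have "{l :: 'a list. length l = 0} = {[]}" by auto
  then show ?case by (simp add: contract_def)
next
  case (Suc k)
  then show ?case using contract_tensor_prod[OF assms, of u "m * k" "tensor_pow T k"] by simp
qed

lemma lists_of_length_1: "{l :: 'j list. length l = 1} = (\<lambda>a. [a]) ` UNIV"
  by (auto simp: length_Suc_conv)

lemma contract_vec_tensor: "contract u 1 (vec_tensor v) = u \<bullet> v"
proof -
  have "contract u 1 (vec_tensor v) = (\<Sum>a\<in>UNIV. vec_tensor v [a] * prod_list (map (($) u) [a]))"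
    unfolding contract_def lists_of_length_1 by (subst sum.reindex) (auto simp: inj_on_def)
  then show ?thesis by (simp add: vec_tensor_def inner_vec_def mult.commute)
qed

lemma contract_mat_tensor: "contract u 2 (mat_tensor A) = u \<bullet> (A *v u)"
proof -
  have "{l :: 'a list. length l = 2} = (\<lambda>(a, b). [a, b]) ` (UNIV \<times> UNIV)"
    by (auto simp: numeral_2_eq_2 length_Suc_conv)
  then have "contract u 2 (mat_tensor A) = (\<Sum>(a, b)\<in>UNIV \<times> UNIV. mat_tensor A [a, b] * prod_list (map (($) u) [a, b]))"
    unfolding contract_def by (simp only:, subst sum.reindex) (auto simp: inj_on_def intro!: sum.cong)
  also have "\<dots> = (\<Sum>a\<in>UNIV. \<Sum>b\<in>UNIV. A $ a $ b * (u $ a * u $ b))"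
    by (simp add: mat_tensor_def sum.cartesian_product)
  finally show ?thesis by (simp add: quadratic_form_expand mult_ac)
qed

text \<open>
  Permuting the indices of \<open>T\<close> permutes the factors of a product that is commutative.
\<close>

lemma contract_symmetrize: "contract u m (symmetrize T) = contract u m T"
proof -
  have perm: "(\<Sum>l | length l = m. T (permute_list \<tau> l) * prod_list (map (($) u) l)) = contract u m T"
    if \<tau>: "\<tau> permutes {..<m}" for \<tau>
    unfolding contract_def
  proof (rule sum.reindex_bij_witness[where j = "permute_list \<tau>" and i = "permute_list (inv \<tau>)"])
    fix l :: "'a list" assume "l \<in> {l. length l = m}"
    then have l: "length l = m" by simp
    show "permute_list (inv \<tau>) (permute_list \<tau> l) = l"
      using permute_list_compose[of "inv \<tau>" l \<tau>] permutes_inv[OF \<tau>] permutes_inv_o(1)[OF \<tau>] l by simp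
    show "permute_list \<tau> (permute_list (inv \<tau>) l) = l"
      using permute_list_compose[of \<tau> l "inv \<tau>"] \<tau> permutes_inv_o(2)[OF \<tau>] l by simp
    have "mset (map (($) u) (permute_list \<tau> l)) = mset (map (($) u) l)"
      using \<tau> l by simp
    then have "prod_list (map (($) u) (permute_list \<tau> l)) = prod_list (map (($) u) l)"
      by (metis prod_mset_prod_list)
    then show "T (permute_list \<tau> l) * prod_list (map (($) u) (permute_list \<tau> l)) = T (permute_list \<tau> l) * prod_list (map (($) u) l)"
      by simp
  qed (auto)
  have "contract u m (symmetrize T) = (\<Sum>l | length l = m. \<Sum>\<tau> | \<tau> permutes {..<m}. T (permute_list \<tau> l) * prod_list (map (($) u) l) / fact m)"
    unfolding contract_def symmetrize_def by (intro sum.cong refl) (simp add: sum_distrib_right sum_divide_distrib)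
  also have "\<dots> = (\<Sum>\<tau> | \<tau> permutes {..<m}. \<Sum>l | length l = m. T (permute_list \<tau> l) * prod_list (map (($) u) l) / fact m)"
    by (rule sum.swap)
  also have "\<dots> = (\<Sum>\<tau> | \<tau> permutes {..<m}. contract u m T / fact m)"
    by (intro sum.cong refl) (simp add: perm flip: sum_divide_distrib)
  also have "\<dots> = contract u m T"
    by (simp add: card_permutations[of "{..<m}" m])
  finally show ?thesis .
qed

text \<open>
  On lists of length \<open>CARD('h)\<close> the contraction collects, for each multi-index \<open>i\<close>, the equal entries of \<open>T\<close>
  with content \<open>i\<close>.  This makes it a linear combination of the monomials \<open>phi y $ i\<close>, which are linearly
  independent as functions of \<open>y\<close>.  It suffices to contract with vectors \<open>tilde y\<close> whose first coordinate is
  1, since the degree is fixed.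
\<close>

lemma symmetric_tensor_eq_0:
  fixes T :: "'d::finite option tensor"
  assumes T: "T \<in> sym_tensors CARD('h::finite)"
    and zero: "\<And>y :: real ^ 'd. contract (tilde y) CARD('h) T = 0"
  shows "T l = 0"
proof (cases "length l = CARD('h)")
  case True
  define idx :: "'d option list \<Rightarrow> ('d, 'h) multi_index" where "idx l = Abs_multi_index (count (mset l))" for l
  have idx: "mset (coeff_list (idx l)) = mset l" if "length l = CARD('h)" for l
    unfolding idx_def by (rule mset_coeff_list[OF that])
  have Tidx: "T l = T (coeff_list (idx l))" if "length l = CARD('h)" for l
    using T idx[OF that] unfolding sym_tensors_altdef by (metis (mono_tags, lifting) mem_Collect_eq)
  have monomial: "prod_list (map (($) (tilde y)) l) = phi y $ idx l" if "length l = CARD('h)" for y :: "real ^ 'd" and l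
  proof -
    have "count (mset l) j = expo (idx l) j" for j
      using idx[OF that] count_coeff_list[of "idx l" j] by simp
    then show ?thesis by (simp add: prod_list_tilde phi_def)
  qed
  define c where "c i = real (card {l. length l = CARD('h) \<and> idx l = i}) * T (coeff_list i)" for i
  have "(\<Sum>i\<in>UNIV. c i * phi y $ i) = 0" for y :: "real ^ 'd"
  proof -
    have "contract (tilde y) CARD('h) T = (\<Sum>l | length l = CARD('h). T (coeff_list (idx l)) * phi y $ idx l)"
      unfolding contract_def by (intro sum.cong refl) (simp add: monomial Tidx[symmetric])
    also have "\<dots> = (\<Sum>i\<in>UNIV. \<Sum>l\<in>{l \<in> {l. length l = CARD('h)}. idx l = i}. T (coeff_list (idx l)) * phi y $ idx l)"
      by (rule sum.group[symmetric]) (auto intro: finite_lists_length)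
    also have "\<dots> = (\<Sum>i\<in>UNIV. c i * phi y $ i)"
      by (intro sum.cong refl) (simp add: c_def)
    finally show ?thesis using zero[of y] by simp
  qed
  from phi_separating[OF this] have "c (idx l) = 0" .
  moreover have "card {l'. length l' = CARD('h) \<and> idx l' = idx l} > 0"
  proof (subst card_gt_0_iff, intro conjI)
    show "finite {l'. length l' = CARD('h) \<and> idx l' = idx l}"
      by (rule finite_subset[OF _ finite_lists_length[of "CARD('h)"]]) auto
  qed (use True in blast)
  ultimately show ?thesis using Tidx[OF True] by (simp add: c_def)
next
  case False
  then show ?thesis using T unfolding sym_tensors_altdef tensors_def by blast
qed

text \<open>
  On symmetric tensors \<open>gamma\<close> reads off coordinates, by its uniqueness; both of its applications in
  \<open>h_gamma_gamma\<close> are to symmetric tensors because freezing some slots of \<open>T\<close> leaves it symmetric in the others.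
\<close>

lemma h_gamma_gamma_entry:
  fixes T :: "'d::finite option tensor"
  assumes T: "T \<in> sym_tensors (2 * CARD('g::finite))"
  shows "(h_gamma_gamma T :: ('d, 'g) moment_matrix) $ i $ j = T (coeff_list i @ coeff_list j)"
proof -
  have sym: "T l = T l'" if "mset l = mset l'" for l l' using T that unfolding sym_tensors_altdef by blast
  have tens: "T l = 0" if "length l \<noteq> 2 * CARD('g)" for l using T that unfolding sym_tensors_altdef tensors_def by blast
  have inner: "(gamma (\<lambda>l'. T (l @ l')) :: real ^ ('d, 'g) multi_index) $ j = T (l @ coeff_list j)"
    if l: "length l = CARD('g)" for l
  proof -
    have "(\<lambda>l'. T (l @ l')) \<in> sym_tensors CARD('g)"
      unfolding sym_tensors_altdef tensors_def using l by (auto intro!: tens sym)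
    from is_gamma_unique[OF is_gamma_gamma this] show ?thesis by (simp add: coord_gamma_def)
  qed
  have "(\<lambda>l. if length l = CARD('g) then T (l @ coeff_list j) else 0) \<in> sym_tensors CARD('g)"
    unfolding sym_tensors_altdef tensors_def by (auto dest: mset_eq_length intro!: sym)
  from is_gamma_unique[OF is_gamma_gamma this]
  have "(gamma (\<lambda>l. if length l = CARD('g) then T (l @ coeff_list j) else 0) :: real ^ ('d, 'g) multi_index) $ i = T (coeff_list i @ coeff_list j)"
    by (simp add: coord_gamma_def length_coeff_list)
  moreover have "(\<lambda>l. if length l = CARD('g) then (gamma (\<lambda>l'. T (l @ l')) :: real ^ ('d, 'g) multi_index) $ j else 0)
      = (\<lambda>l. if length l = CARD('g) then T (l @ coeff_list j) else 0)"
    using inner by (intro ext) auto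
  ultimately show ?thesis by (simp add: h_gamma_gamma_def)
qed

section \<open>The debiased tensor and its contractions\<close>

text \<open>
  The combination of the tensors to which \<open>h_gamma_gamma\<close> is applied in \<open>debiased_term\<close>.  Keeping all of
  them in a single symmetric tensor of order \<open>2g\<close> allows it to be identified by its contractions.
\<close>

definition debiased_tensor :: "nat \<Rightarrow> real ^ 'd ^ 'd \<Rightarrow> real ^ 'd::finite \<Rightarrow> 'd option tensor" where
  "debiased_tensor g \<Sigma> x l = (\<Sum>k\<le>g. C_coeff (2 * g) k * (- 1) ^ k *
     symmetrize (tensor_pow (vec_tensor (tilde x)) (2 * g - 2 * k) \<otimes>\<^sub>t tensor_pow (mat_tensor (tilde_mat \<Sigma>)) k) l)"

lemma vec_tensor_tensors: "vec_tensor v \<in> tensors 1"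
  by (simp add: tensors_def vec_tensor_def)

lemma mat_tensor_tensors: "mat_tensor A \<in> tensors 2"
  by (simp add: tensors_def mat_tensor_def)

lemma Hermite_summand_tensors:
  assumes "k \<le> g"
  shows "tensor_pow (vec_tensor v) (2 * g - 2 * k) \<otimes>\<^sub>t tensor_pow (mat_tensor A) k \<in> tensors (2 * g)"
  using tensor_prod_tensors[OF tensor_pow_tensors[OF vec_tensor_tensors] tensor_pow_tensors[OF mat_tensor_tensors],
    of v "2 * g - 2 * k" A k] assms by simp

lemma debiased_tensor_sym: "debiased_tensor g \<Sigma> x \<in> sym_tensors (2 * g)"
  unfolding sym_tensors_altdef
proof (intro CollectI conjI allI impI)
  have "symmetrize (tensor_pow (vec_tensor (tilde x)) (2 * g - 2 * k) \<otimes>\<^sub>t tensor_pow (mat_tensor (tilde_mat \<Sigma>)) k) \<in> tensors (2 * g)"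
    if "k \<le> g" for k
    using Hermite_summand_tensors[OF that] unfolding sym_tensors_altdef[symmetric]
    by (metis (mono_tags, lifting) imageI mem_Collect_eq sym_tensors_altdef sym_tensors_def)
  then show "debiased_tensor g \<Sigma> x \<in> tensors (2 * g)"
    unfolding tensors_def debiased_tensor_def by auto
  show "debiased_tensor g \<Sigma> x l = debiased_tensor g \<Sigma> x l'" if "mset l = mset l'" for l l'
    unfolding debiased_tensor_def by (intro sum.cong refl arg_cong2[where f = "(*)"] symmetrize_mset that)
qed

lemma debiased_term_entry:
  "(debiased_term \<Sigma> x :: ('d::finite, 'g::finite) moment_matrix) $ i $ j
     = debiased_tensor CARD('g) \<Sigma> x (coeff_list i @ coeff_list j)"
proof -
  have "(h_gamma_gamma (symmetrize (tensor_pow (vec_tensor (tilde x)) (2 * CARD('g) - 2 * k) \<otimes>\<^sub>t tensor_pow (mat_tensor (tilde_mat \<Sigma>)) k))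
        :: ('d, 'g) moment_matrix) $ i $ j
      = symmetrize (tensor_pow (vec_tensor (tilde x)) (2 * CARD('g) - 2 * k) \<otimes>\<^sub>t tensor_pow (mat_tensor (tilde_mat \<Sigma>)) k) (coeff_list i @ coeff_list j)"
    if "k \<le> CARD('g)" for k
    by (rule h_gamma_gamma_entry) (use Hermite_summand_tensors[OF that] in \<open>auto simp: sym_tensors_def\<close>)
  then show ?thesis
    by (simp add: debiased_term_def debiased_tensor_def atLeast0AtMost)
qed

lemma inner_tilde: "tilde y \<bullet> tilde x = 1 + y \<bullet> x"
  by (simp add: inner_vec_def tilde_def UNIV_option_conv sum.reindex)

lemma quadratic_form_tilde_mat: "tilde y \<bullet> (tilde_mat A *v tilde y) = y \<bullet> (A *v y)"
  unfolding quadratic_form_expand by (simp add: tilde_def tilde_mat_def UNIV_option_conv sum.reindex)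

lemma contract_debiased_tensor:
  "contract (tilde y) (2 * g) (debiased_tensor g \<Sigma> x)
     = (\<Sum>k\<le>g. C_coeff (2 * g) k * (- 1) ^ k * (y \<bullet> (\<Sigma> *v y)) ^ k * (1 + y \<bullet> x) ^ (2 * g - 2 * k))"
proof -
  have "contract (tilde y) (2 * g) (debiased_tensor g \<Sigma> x)
      = (\<Sum>k\<le>g. C_coeff (2 * g) k * (- 1) ^ k * contract (tilde y) (2 * g)
          (symmetrize (tensor_pow (vec_tensor (tilde x)) (2 * g - 2 * k) \<otimes>\<^sub>t tensor_pow (mat_tensor (tilde_mat \<Sigma>)) k)))"
    unfolding contract_def debiased_tensor_def sum_distrib_right sum_distrib_left mult.assoc by (rule sum.swap)
  also have "\<dots> = (\<Sum>k\<le>g. C_coeff (2 * g) k * (- 1) ^ k * (y \<bullet> (\<Sigma> *v y)) ^ k * (1 + y \<bullet> x) ^ (2 * g - 2 * k))"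
  proof (intro sum.cong refl)
    fix k assume "k \<in> {..g}"
    then have g: "2 * g - 2 * k + 2 * k = 2 * g" by auto
    have "contract (tilde y) (2 * g) (tensor_pow (vec_tensor (tilde x)) (2 * g - 2 * k) \<otimes>\<^sub>t tensor_pow (mat_tensor (tilde_mat \<Sigma>)) k)
        = contract (tilde y) (2 * g - 2 * k) (tensor_pow (vec_tensor (tilde x)) (2 * g - 2 * k))
          * contract (tilde y) (2 * k) (tensor_pow (mat_tensor (tilde_mat \<Sigma>)) k)"
      using contract_tensor_prod[OF tensor_pow_tensors[OF vec_tensor_tensors[of "tilde x"], of "2 * g - 2 * k"],
          of "tilde y" "2 * k" "tensor_pow (mat_tensor (tilde_mat \<Sigma>)) k"]
      unfolding mult_1 g .
    also have "\<dots> = (1 + y \<bullet> x) ^ (2 * g - 2 * k) * (y \<bullet> (\<Sigma> *v y)) ^ k"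
      unfolding contract_tensor_pow[OF vec_tensor_tensors, unfolded mult_1] contract_tensor_pow[OF mat_tensor_tensors]
        contract_vec_tensor contract_mat_tensor inner_tilde quadratic_form_tilde_mat ..
    finally show "C_coeff (2 * g) k * (- 1) ^ k * contract (tilde y) (2 * g)
          (symmetrize (tensor_pow (vec_tensor (tilde x)) (2 * g - 2 * k) \<otimes>\<^sub>t tensor_pow (mat_tensor (tilde_mat \<Sigma>)) k))
        = C_coeff (2 * g) k * (- 1) ^ k * (y \<bullet> (\<Sigma> *v y)) ^ k * (1 + y \<bullet> x) ^ (2 * g - 2 * k)"
      by (simp add: contract_symmetrize)
  qed
  finally show ?thesis .
qed

section \<open>Polynomial growth and normal moments\<close>

definition poly_growth :: "nat \<Rightarrow> ('a::real_normed_vector \<Rightarrow> real) \<Rightarrow> bool" where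
  "poly_growth m f \<longleftrightarrow> continuous_on UNIV f \<and> (\<exists>K\<ge>0. \<forall>x. \<bar>f x\<bar> \<le> K * (1 + norm x) ^ m)"

lemma poly_growth_cmult:
  assumes "poly_growth m f"
  shows "poly_growth m (\<lambda>x. c * f x)"
proof -
  obtain K where K: "K \<ge> 0" "\<And>x. \<bar>f x\<bar> \<le> K * (1 + norm x) ^ m" using assms by (auto simp: poly_growth_def)
  have "\<bar>c * f x\<bar> \<le> (\<bar>c\<bar> * K) * (1 + norm x) ^ m" for x
    using mult_left_mono[OF K(2)[of x], of "\<bar>c\<bar>"] by (simp add: abs_mult mult.assoc)
  moreover have "\<bar>c\<bar> * K \<ge> 0" using K by simp
  ultimately show ?thesis using assms unfolding poly_growth_def by (blast intro: continuous_on_mult_left)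
qed

lemma poly_growth_sum:
  assumes "\<And>i. i \<in> I \<Longrightarrow> poly_growth m (f i)"
  shows "poly_growth m (\<lambda>x. \<Sum>i\<in>I. f i x)"
proof -
  have "\<forall>i\<in>I. \<exists>K\<ge>0. \<forall>x. \<bar>f i x\<bar> \<le> K * (1 + norm x) ^ m" using assms by (auto simp: poly_growth_def)
  then obtain K where K: "\<And>i. i \<in> I \<Longrightarrow> K i \<ge> 0" "\<And>i x. i \<in> I \<Longrightarrow> \<bar>f i x\<bar> \<le> K i * (1 + norm x) ^ m" by metis
  have "\<bar>\<Sum>i\<in>I. f i x\<bar> \<le> (\<Sum>i\<in>I. K i) * (1 + norm x) ^ m" for x
    unfolding sum_distrib_right by (rule order_trans[OF sum_abs]) (intro sum_mono K)
  moreover have "(\<Sum>i\<in>I. K i) \<ge> 0" using K by (intro sum_nonneg)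
  moreover have "continuous_on UNIV (\<lambda>x. \<Sum>i\<in>I. f i x)"
    using assms by (intro continuous_on_sum) (auto simp: poly_growth_def)
  ultimately show ?thesis unfolding poly_growth_def by blast
qed

lemma monomial_coeff_list: "prod_list (map (($) (tilde x)) (coeff_list i)) = phi x $ i"
  by (simp add: prod_list_tilde phi_def count_coeff_list)

lemma abs_monomial_le:
  fixes x :: "real ^ 'd::finite"
  shows "\<bar>prod_list (map (($) (tilde x)) l)\<bar> \<le> (1 + norm x) ^ length l"
proof -
  have "\<bar>tilde x $ j\<bar> \<le> 1 + norm x" for j
    using component_le_norm_cart[of x] by (cases j) (auto simp: tilde_def intro: add_increasing)
  then show ?thesis by (induction l) (auto simp: abs_mult intro!: mult_mono)
qed

lemma poly_growth_monomial:
  fixes l :: "'d::finite option list"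
  assumes "length l \<le> m"
  shows "poly_growth m (\<lambda>x :: real ^ 'd. prod_list (map (($) (tilde x)) l))"
proof -
  have "\<bar>prod_list (map (($) (tilde x)) l)\<bar> \<le> 1 * (1 + norm x) ^ m" for x :: "real ^ 'd"
    using abs_monomial_le[of x l] power_increasing[OF assms, of "1 + norm x"] by simp
  moreover have "continuous_on UNIV (\<lambda>x :: real ^ 'd. prod_list (map (($) (tilde x)) l))"
    unfolding prod_list_tilde by (intro continuous_intros)
  ultimately show ?thesis unfolding poly_growth_def by (blast intro: zero_le_one)
qed

text \<open>
  Every entry is a linear combination of products of at most \<open>2g\<close> coordinates of \<open>tilde x\<close>.
\<close>

lemma poly_growth_debiased_tensor: "poly_growth (2 * g) (\<lambda>x. debiased_tensor g \<Sigma> x l)"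
proof -
  have summand: "poly_growth (2 * g) (\<lambda>x. (tensor_pow (vec_tensor (tilde x)) (2 * g - 2 * k) \<otimes>\<^sub>t tensor_pow (mat_tensor (tilde_mat \<Sigma>)) k) l)"
    if "k \<le> g" for k l
  proof (cases "length l = 2 * g")
    case True
    have "(tensor_pow (vec_tensor (tilde x)) (2 * g - 2 * k) \<otimes>\<^sub>t tensor_pow (mat_tensor (tilde_mat \<Sigma>)) k) l
        = tensor_pow (mat_tensor (tilde_mat \<Sigma>)) k (drop (2 * g - 2 * k) l) * prod_list (map (($) (tilde x)) (take (2 * g - 2 * k) l))" for x
      using tensor_prod_homogeneous[OF tensor_pow_tensors[OF vec_tensor_tensors[of "tilde x"], of "2 * g - 2 * k"], of l] True
      by (simp add: tensor_pow_vec)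
    then show ?thesis
      using poly_growth_cmult[OF poly_growth_monomial[of "take (2 * g - 2 * k) l" "2 * g"]] by simp
  next
    case False
    then have "(tensor_pow (vec_tensor (tilde x)) (2 * g - 2 * k) \<otimes>\<^sub>t tensor_pow (mat_tensor (tilde_mat \<Sigma>)) k) l = 0" for x
      using Hermite_summand_tensors[OF that] by (auto simp: tensors_def)
    then show ?thesis by (auto simp: poly_growth_def)
  qed
  show ?thesis
    unfolding debiased_tensor_def symmetrize_def divide_inverse mult.commute[of _ "inverse _"]
    by (intro poly_growth_sum poly_growth_cmult summand) auto
qed

text \<open>
  The largest summand dominates: the power of a sum is at most the power of \<open>card I\<close> times that of the
  maximum.
\<close>

lemma power_sum_le:
  fixes x :: "'i \<Rightarrow> real"
  assumes "finite I" "\<And>i. i \<in> I \<Longrightarrow> x i \<ge> 0"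
  shows "(\<Sum>i\<in>I. x i) ^ p \<le> real (card I) ^ p * (1 + (\<Sum>i\<in>I. x i ^ p))"
proof (cases "I = {}")
  case True
  then show ?thesis by (cases p) auto
next
  case False
  define m where "m = Max (x ` I)"
  have "m \<in> x ` I" unfolding m_def using assms False by (intro Max_in) auto
  then obtain j where j: "j \<in> I" "m = x j" by blast
  have "(\<Sum>i\<in>I. x i) \<le> real (card I) * m"
    using assms by (intro sum_bounded_above) (simp add: m_def)
  then have "(\<Sum>i\<in>I. x i) ^ p \<le> (real (card I) * m) ^ p"
    using assms by (intro power_mono sum_nonneg)
  also have "\<dots> = real (card I) ^ p * x j ^ p" by (simp add: power_mult_distrib j)
  also have "x j ^ p \<le> (\<Sum>i\<in>I. x i ^ p)" using assms j by (intro member_le_sum) auto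
  finally show ?thesis by (simp add: mult_left_mono distrib_left add_increasing)
qed

lemma multi_normal_functional:
  assumes "is_multi_normal 0 \<Sigma> (distr M borel e)" "e \<in> borel_measurable M"
  shows "distr M borel (\<lambda>\<omega>. a \<bullet> e \<omega>) = normal_law 0 (a \<bullet> (\<Sigma> *v a))"
proof -
  have "distr (distr M borel e) borel (\<lambda>x. a \<bullet> x) = normal_law 0 (a \<bullet> (\<Sigma> *v a))"
    using assms(1) by (simp add: is_multi_normal_def)
  then show ?thesis using assms(2) by (simp add: distr_distr comp_def)
qed

text \<open>
  The constant depends on \<open>\<Sigma>\<close> and \<open>p\<close> only, so it serves all noise vectors at once.  It comes
  from the laws of the coordinates: \<open>1 + \<parallel>x\<parallel>\<close> is at most the sum of the absolute values of the coordinates of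
  \<open>tilde x\<close>, and passing from \<open>p\<close> to \<open>2p\<close> leaves even moments only.
\<close>

lemma multi_normal_moment_bound:
  fixes \<Sigma> :: "real ^ 'd::finite ^ 'd"
  assumes \<Sigma>: "nonneg_definite \<Sigma>"
  shows "\<exists>K. \<forall>e. e \<in> borel_measurable M \<longrightarrow> prob_space M \<longrightarrow> is_multi_normal 0 \<Sigma> (distr M borel e) \<longrightarrow>
    integrable M (\<lambda>\<omega>. (1 + norm (e \<omega>)) ^ p) \<and> (\<integral>\<omega>. (1 + norm (e \<omega>)) ^ p \<partial>M) \<le> K"
proof -
  define D where "D = real CARD('d option)"
  define mom where "mom a = fact (2 * p) / (fact p * 2 ^ p) * (axis a 1 \<bullet> (\<Sigma> *v axis a 1)) ^ p" for a :: 'd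
  have bound: "(1 + norm x) ^ p \<le> D ^ (2 * p) * (2 + (\<Sum>a\<in>UNIV. (axis a 1 \<bullet> x) ^ (2 * p)))" for x :: "real ^ 'd"
  proof -
    have "(1 + norm x) ^ p \<le> (1 + norm x) ^ (2 * p)" by (intro power_increasing) auto
    also have "\<dots> \<le> (\<Sum>j\<in>UNIV. \<bar>tilde x $ j\<bar>) ^ (2 * p)"
      using norm_le_l1_cart[of x]
      by (intro power_mono) (auto simp: tilde_def UNIV_option_conv sum.reindex)
    also have "\<dots> \<le> D ^ (2 * p) * (1 + (\<Sum>j\<in>UNIV. \<bar>tilde x $ j\<bar> ^ (2 * p)))"
      unfolding D_def by (rule power_sum_le) auto
    also have "\<dots> = D ^ (2 * p) * (2 + (\<Sum>a\<in>UNIV. (axis a 1 \<bullet> x) ^ (2 * p)))"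
      by (simp add: tilde_def UNIV_option_conv sum.reindex power_even_abs inner_axis')
    finally show ?thesis .
  qed
  show ?thesis
  proof (intro exI allI impI)
    fix e :: "'a \<Rightarrow> real ^ 'd"
    assume e[measurable]: "e \<in> borel_measurable M" and "prob_space M" and N: "is_multi_normal 0 \<Sigma> (distr M borel e)"
    interpret prob_space M by fact
    have v: "axis a 1 \<bullet> (\<Sigma> *v axis a 1) \<ge> 0" for a using \<Sigma> by (simp add: nonneg_definite_def)
    have i: "integrable M (\<lambda>\<omega>. (axis a 1 \<bullet> e \<omega>) ^ (2 * p))" for a
      using central_normal_moments(1)[OF v[of a], of "2 * p"] unfolding multi_normal_functional[OF N e, symmetric]
      by (simp add: integrable_distr_eq)
    have m: "expectation (\<lambda>\<omega>. (axis a 1 \<bullet> e \<omega>) ^ (2 * p)) = mom a" for a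
      using central_normal_moments(2)[OF v[of a], of p] unfolding multi_normal_functional[OF N e, symmetric]
      by (simp add: integral_distr mom_def)
    have ib: "integrable M (\<lambda>\<omega>. D ^ (2 * p) * (2 + (\<Sum>a\<in>UNIV. (axis a 1 \<bullet> e \<omega>) ^ (2 * p))))"
      by (intro integrable_mult_right Bochner_Integration.integrable_add Bochner_Integration.integrable_sum i integrable_const)
    have int: "integrable M (\<lambda>\<omega>. (1 + norm (e \<omega>)) ^ p)"
    proof (rule Bochner_Integration.integrable_bound[OF ib])
      show "AE \<omega> in M. norm ((1 + norm (e \<omega>)) ^ p) \<le> norm (D ^ (2 * p) * (2 + (\<Sum>a\<in>UNIV. (axis a 1 \<bullet> e \<omega>) ^ (2 * p))))"
        using bound by (intro AE_I2) (auto intro: order_trans[OF _ abs_ge_self])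
    qed measurable
    have le: "expectation (\<lambda>\<omega>. (1 + norm (e \<omega>)) ^ p)
        \<le> expectation (\<lambda>\<omega>. D ^ (2 * p) * (2 + (\<Sum>a\<in>UNIV. (axis a 1 \<bullet> e \<omega>) ^ (2 * p))))"
      by (rule integral_mono[OF int ib bound])
    have "expectation (\<lambda>\<omega>. 2 + (\<Sum>a\<in>UNIV. (axis a 1 \<bullet> e \<omega>) ^ (2 * p))) = 2 + (\<Sum>a\<in>UNIV. mom a)"
      using i by (simp add: m prob_space)
    then have eq: "expectation (\<lambda>\<omega>. D ^ (2 * p) * (2 + (\<Sum>a\<in>UNIV. (axis a 1 \<bullet> e \<omega>) ^ (2 * p)))) = D ^ (2 * p) * (2 + (\<Sum>a\<in>UNIV. mom a))"
      by simp
    show "integrable M (\<lambda>\<omega>. (1 + norm (e \<omega>)) ^ p) \<and> expectation (\<lambda>\<omega>. (1 + norm (e \<omega>)) ^ p) \<le> D ^ (2 * p) * (2 + (\<Sum>a\<in>UNIV. mom a))"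
      using int le unfolding eq by blast
  qed
qed

lemma integrable_poly_growth_multi_normal:
  fixes f :: "real ^ 'd::finite \<Rightarrow> real"
  assumes f: "poly_growth m f" and "prob_space M" and e[measurable]: "e \<in> borel_measurable M"
    and \<Sigma>: "nonneg_definite \<Sigma>" and N: "is_multi_normal 0 \<Sigma> (distr M borel e)"
  shows "integrable M (\<lambda>\<omega>. f (c + e \<omega>))"
proof -
  obtain K where K: "K \<ge> 0" "\<And>x. \<bar>f x\<bar> \<le> K * (1 + norm x) ^ m" using f by (auto simp: poly_growth_def)
  have [measurable]: "f \<in> borel_measurable borel"
    using f by (intro borel_measurable_continuous_onI) (simp add: poly_growth_def)
  have "integrable M (\<lambda>\<omega>. (1 + norm (e \<omega>)) ^ m)"
    using multi_normal_moment_bound[OF \<Sigma>, of M m] assms by blast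
  then have "integrable M (\<lambda>\<omega>. K * (1 + norm c) ^ m * (1 + norm (e \<omega>)) ^ m)" by simp
  then show ?thesis
  proof (rule Bochner_Integration.integrable_bound)
    have "\<bar>f (c + e \<omega>)\<bar> \<le> K * (1 + norm c) ^ m * (1 + norm (e \<omega>)) ^ m" for \<omega>
    proof -
      have "1 + norm (c + e \<omega>) \<le> (1 + norm c) * (1 + norm (e \<omega>))"
      proof -
        have "(1 + norm c) * (1 + norm (e \<omega>)) = 1 + norm c + norm (e \<omega>) + norm c * norm (e \<omega>)"
          by (simp add: algebra_simps)
        moreover have "0 \<le> norm c * norm (e \<omega>)" by simp
        ultimately show ?thesis using norm_triangle_ineq[of c "e \<omega>"] by linarith
      qed
      then have "(1 + norm (c + e \<omega>)) ^ m \<le> ((1 + norm c) * (1 + norm (e \<omega>))) ^ m"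
        by (intro power_mono) auto
      then show ?thesis
        using mult_left_mono[OF _ K(1), of "(1 + norm (c + e \<omega>)) ^ m"] K(2)[of "c + e \<omega>"]
        by (fastforce simp: power_mult_distrib mult.assoc)
    qed
    then show "AE \<omega> in M. norm (f (c + e \<omega>)) \<le> norm (K * (1 + norm c) ^ m * (1 + norm (e \<omega>)) ^ m)"
      using K(1) by (intro AE_I2) (auto intro: order_trans[OF _ abs_ge_self])
  qed measurable
qed

section \<open>Unbiasedness of the debiased tensor\<close>

text \<open>
  The difference \<open>T\<close> of the two sides is a symmetric tensor of order \<open>2g\<close>, so it suffices that all its
  contractions with \<open>tilde y\<close> vanish.  Under the expectation the contraction is a Hermite polynomial in
  the univariate normal variable \<open>y \<bullet> e\<close>.
\<close>

lemma expectation_debiased_tensor: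
  fixes \<Sigma> :: "real ^ 'd::finite ^ 'd"
  assumes "prob_space M" and e[measurable]: "e \<in> borel_measurable M"
    and \<Sigma>: "nonneg_definite \<Sigma>" and N: "is_multi_normal 0 \<Sigma> (distr M borel e)"
  shows "(\<integral>\<omega>. debiased_tensor CARD('g::finite) \<Sigma> (c + e \<omega>) l \<partial>M) = tensor_pow (vec_tensor (tilde c)) (2 * CARD('g)) l"
proof -
  let ?g = "CARD('g)"
  interpret prob_space M by fact
  define T where "T l = expectation (\<lambda>\<omega>. debiased_tensor ?g \<Sigma> (c + e \<omega>) l) - tensor_pow (vec_tensor (tilde c)) (2 * ?g) l" for l
  have int: "integrable M (\<lambda>\<omega>. debiased_tensor ?g \<Sigma> (c + e \<omega>) l)" for l
    by (rule integrable_poly_growth_multi_normal[OF poly_growth_debiased_tensor \<open>prob_space M\<close> e \<Sigma> N])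
  \<comment> \<open>Tensor orders are cardinalities of types; the sum type has the order \<open>2g\<close>.\<close>
  have card: "CARD('g + 'g) = 2 * ?g" by simp
  have "T \<in> sym_tensors CARD('g + 'g)"
    unfolding card sym_tensors_altdef
  proof (intro CollectI conjI allI impI)
    have "debiased_tensor ?g \<Sigma> x \<in> tensors (2 * ?g)" for x
      using debiased_tensor_sym[of ?g \<Sigma> x] unfolding sym_tensors_altdef by blast
    then show "T \<in> tensors (2 * ?g)" by (auto simp: T_def tensors_def tensor_pow_vec)
    fix l l' :: "'d option list" assume ms: "mset l = mset l'"
    have "debiased_tensor ?g \<Sigma> x l = debiased_tensor ?g \<Sigma> x l'" for x
      using debiased_tensor_sym[of ?g \<Sigma> x] ms unfolding sym_tensors_altdef by blast
    moreover have "tensor_pow (vec_tensor (tilde c)) (2 * ?g) l = tensor_pow (vec_tensor (tilde c)) (2 * ?g) l'"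
      using tensor_pow_sym[of "tilde c" "2 * ?g"] ms unfolding sym_tensors_altdef by blast
    ultimately show "T l = T l'" by (simp add: T_def)
  qed
  moreover have "contract (tilde y) CARD('g + 'g) T = 0" for y :: "real ^ 'd"
  proof -
    define v where "v = y \<bullet> (\<Sigma> *v y)"
    have v: "v \<ge> 0" using \<Sigma> by (simp add: v_def nonneg_definite_def)
    define H where "H z = (\<Sum>k\<le>?g. C_coeff (2 * ?g) k * (- 1) ^ k * v ^ k * ((1 + y \<bullet> c) + z) ^ (2 * ?g - 2 * k))" for z
    have [measurable]: "H \<in> borel_measurable borel" unfolding H_def by measurable
    have "contract (tilde y) (2 * ?g) T = (\<Sum>l | length l = 2 * ?g.
          expectation (\<lambda>\<omega>. debiased_tensor ?g \<Sigma> (c + e \<omega>) l) * prod_list (map (($) (tilde y)) l))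
        - contract (tilde y) (2 * ?g) (tensor_pow (vec_tensor (tilde c)) (2 * ?g))"
      by (simp add: contract_def T_def left_diff_distrib sum_subtractf)
    also have "(\<Sum>l | length l = 2 * ?g. expectation (\<lambda>\<omega>. debiased_tensor ?g \<Sigma> (c + e \<omega>) l) * prod_list (map (($) (tilde y)) l))
        = expectation (\<lambda>\<omega>. contract (tilde y) (2 * ?g) (debiased_tensor ?g \<Sigma> (c + e \<omega>)))"
      unfolding contract_def using int by (subst Bochner_Integration.integral_sum) auto
    also have "\<dots> = expectation (\<lambda>\<omega>. H (y \<bullet> e \<omega>))"
      by (simp add: contract_debiased_tensor H_def v_def inner_add_right add.assoc)
    also have "\<dots> = (\<integral>z. H z \<partial>normal_law 0 v)"
      unfolding v_def multi_normal_functional[OF N e, symmetric] by (simp add: integral_distr)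
    also have "\<dots> = (1 + y \<bullet> c) ^ (2 * ?g)"
      unfolding H_def by (rule Hermite_debiases_power[OF v])
    also have "contract (tilde y) (2 * ?g) (tensor_pow (vec_tensor (tilde c)) (2 * ?g)) = (1 + y \<bullet> c) ^ (2 * ?g)"
      using contract_tensor_pow[OF vec_tensor_tensors, of "tilde y" "2 * ?g" "tilde c"]
      by (simp add: contract_vec_tensor inner_tilde flip: One_nat_def)
    finally show ?thesis unfolding card by simp
  qed
  ultimately have "T l = 0" by (rule symmetric_tensor_eq_0)
  then show ?thesis by (simp add: T_def)
qed

lemma expectation_debiased_term:
  fixes \<Sigma> :: "real ^ 'd::finite ^ 'd"
  assumes "prob_space M" "e \<in> borel_measurable M" "nonneg_definite \<Sigma>" "is_multi_normal 0 \<Sigma> (distr M borel e)"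
  shows "(\<integral>\<omega>. (debiased_term \<Sigma> (c + e \<omega>) :: ('d, 'g::finite) moment_matrix) $ i $ j \<partial>M) = outer (phi c) (phi c) $ i $ j"
proof -
  show ?thesis
    unfolding debiased_term_entry expectation_debiased_tensor[OF assms] tensor_pow_vec
    by (simp add: outer_def length_coeff_list monomial_coeff_list)
qed

section \<open>The centred summands\<close>

lemma covariance_matrix_minus_mean:
  fixes U :: "'w \<Rightarrow> real ^ 'k::finite"
  assumes "prob_space M" and int: "\<And>a. integrable M (\<lambda>\<omega>. U \<omega> $ a)" and mean: "\<And>a. (\<integral>\<omega>. U \<omega> $ a \<partial>M) = c $ a"
  shows "covariance_matrix M (\<lambda>\<omega>. U \<omega> - c) = covariance_matrix M U"
proof -
  interpret prob_space M by fact
  have "(\<integral>\<omega>. U \<omega> $ a - c $ a \<partial>M) = 0" for a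
    using int by (simp add: mean prob_space)
  then show ?thesis by (simp add: covariance_matrix_def mean)
qed

text \<open>
  Truncation of a sum \<open>a + b\<close>: whichever of \<open>a\<close> and \<open>b\<close> is larger exceeds \<open>t / 2\<close>.  In the case of \<open>b\<close>
  the indicator is replaced by \<open>(2 b / t)\<^sup>2\<close>, which costs two more moments of \<open>b\<close> and gains \<open>t\<^sup>-\<^sup>2\<close>.
\<close>

lemma truncated_square_add_le:
  fixes a b t :: real
  assumes "a \<ge> 0" "b \<ge> 0" "t > 0" "0 \<le> x" "x \<le> a + b"
  shows "x\<^sup>2 * of_bool (x > t) \<le> 4 * (a\<^sup>2 * of_bool (a > t / 2)) + 16 * b ^ 4 / t\<^sup>2"
proof (cases "x > t")
  case True
  show ?thesis
  proof (cases "b \<le> a")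
    case b: True
    then have "x \<le> 2 * a" using assms by simp
    then have "x\<^sup>2 \<le> (2 * a)\<^sup>2" "a > t / 2" using assms True power_mono[of x "2 * a" 2] by auto
    moreover have "16 * b ^ 4 / t\<^sup>2 \<ge> 0" by simp
    ultimately show ?thesis using True by (simp add: power_mult_distrib add_increasing2)
  next
    case False
    then have "x \<le> 2 * b" using assms by simp
    then have x: "x\<^sup>2 \<le> (2 * b)\<^sup>2" and "t \<le> 2 * b" using assms True power_mono[of x "2 * b" 2] by auto
    then have "t\<^sup>2 \<le> (2 * b)\<^sup>2" using assms by (intro power_mono) auto
    then have "x\<^sup>2 * t\<^sup>2 \<le> (2 * b)\<^sup>2 * (2 * b)\<^sup>2" using x by (intro mult_mono) auto
    also have "\<dots> = 16 * b ^ 4" by (simp add: power2_eq_square power4_eq_xxxx)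
    finally have "x\<^sup>2 \<le> 16 * b ^ 4 / t\<^sup>2" using assms by (simp add: pos_le_divide_eq)
    moreover have "4 * (a\<^sup>2 * of_bool (a > t / 2)) \<ge> 0" "x\<^sup>2 * of_bool (x > t) \<le> x\<^sup>2" by simp_all
    ultimately show ?thesis by linarith
  qed
qed simp

lemma vec_of_linear:
  "vec_of (A - B) = vec_of A - vec_of B" "vec_of (c *\<^sub>R A) = c *\<^sub>R vec_of A" "vec_of (sum f I) = (\<Sum>i\<in>I. vec_of (f i))"
proof -
  show "vec_of (A - B) = vec_of A - vec_of B" "vec_of (c *\<^sub>R A) = c *\<^sub>R vec_of A"
    by (simp_all add: vec_of_def vec_eq_iff)
  show "vec_of (sum f I) = (\<Sum>i\<in>I. vec_of (f i))"
    by (simp add: vec_of_def vec_eq_iff)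
qed

definition centered_term :: "real ^ 'd ^ 'd \<Rightarrow> real ^ 'd::finite \<Rightarrow> real ^ 'd \<Rightarrow> real ^ (('d, 'g::finite) multi_index \<times> ('d, 'g) multi_index)" where
  "centered_term \<Sigma> c e = vec_of (debiased_term \<Sigma> (c + e)) - vec_of (outer (phi c) (phi c))"

lemma centered_term_nth:
  "(centered_term \<Sigma> c e :: real ^ (('d::finite, 'g::finite) multi_index \<times> ('d, 'g) multi_index)) $ p
     = debiased_tensor CARD('g) \<Sigma> (c + e) (coeff_list (snd p) @ coeff_list (fst p)) - phi c $ snd p * phi c $ fst p"
  by (simp add: centered_term_def vec_of_def debiased_term_entry outer_def)

lemma centered_term_measurable: "centered_term \<Sigma> c \<in> borel_measurable borel"
proof (rule borel_measurable_continuous_onI)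
  have "continuous_on UNIV (\<lambda>e. debiased_tensor CARD('b) \<Sigma> (c + e) l)" for l :: "'a option list"
  proof -
    have "continuous_on UNIV (\<lambda>x. debiased_tensor CARD('b) \<Sigma> x l)"
      using poly_growth_debiased_tensor by (auto simp: poly_growth_def)
    from continuous_on_compose2[OF this, of UNIV "\<lambda>e. c + e"] show ?thesis
      by (simp add: continuous_on_add)
  qed
  then have "continuous_on UNIV (\<lambda>e. \<chi> p. (centered_term \<Sigma> c e :: real ^ (('a, 'b) multi_index \<times> ('a, 'b) multi_index)) $ p)"
    unfolding centered_term_nth by (intro continuous_on_vec_lambda continuous_on_diff continuous_on_const)
  then show "continuous_on UNIV (centered_term \<Sigma> c :: _ \<Rightarrow> real ^ (('a, 'b) multi_index \<times> ('a, 'b) multi_index))"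
    by simp
qed

text \<open>
  Separating the signal \<open>c\<close> from the noise \<open>e\<close> by \<open>(a + b)\<^sup>m \<le> 2\<^sup>m (a\<^sup>m + b\<^sup>m)\<close> is what allows the Lindeberg
  condition to be checked for both parts on their own.
\<close>

lemma norm_centered_term_le:
  fixes \<Sigma> :: "real ^ 'd::finite ^ 'd"
  shows "\<exists>K>0. \<forall>c e. norm (centered_term \<Sigma> c e :: real ^ (('d, 'g::finite) multi_index \<times> ('d, 'g) multi_index))
    \<le> K * norm c ^ (2 * CARD('g)) + K * (1 + norm e) ^ (2 * CARD('g))"
proof -
  let ?m = "2 * CARD('g)"
  let ?I = "UNIV :: (('d, 'g) multi_index \<times> ('d, 'g) multi_index) set"
  have "\<forall>p :: ('d, 'g) multi_index \<times> ('d, 'g) multi_index. \<exists>K\<ge>0. \<forall>x. \<bar>debiased_tensor CARD('g) \<Sigma> x (coeff_list (snd p) @ coeff_list (fst p))\<bar> \<le> K * (1 + norm x) ^ ?m"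
    using poly_growth_debiased_tensor by (auto simp: poly_growth_def)
  then obtain k :: "('d, 'g) multi_index \<times> ('d, 'g) multi_index \<Rightarrow> real" where k: "\<And>p. k p \<ge> 0"
    "\<And>p x. \<bar>debiased_tensor CARD('g) \<Sigma> x (coeff_list (snd p) @ coeff_list (fst p))\<bar> \<le> k p * (1 + norm x) ^ ?m"
    by metis
  define K where "K = (\<Sum>p\<in>?I. k p + 1) * 2 ^ ?m"
  have Kpos: "(\<Sum>p\<in>?I. k p + 1) > 0" using k(1) by (intro sum_pos) (auto intro: add_nonneg_pos)
  have "norm (centered_term \<Sigma> c e :: real ^ (('d, 'g) multi_index \<times> ('d, 'g) multi_index)) \<le> K * norm c ^ ?m + K * (1 + norm e) ^ ?m" for c e
  proof -
    define s where "s = norm c + (1 + norm e)"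
    have entry: "\<bar>(centered_term \<Sigma> c e :: real ^ (('d, 'g) multi_index \<times> ('d, 'g) multi_index)) $ p\<bar> \<le> (k p + 1) * s ^ ?m" for p
    proof -
      have "\<bar>debiased_tensor CARD('g) \<Sigma> (c + e) (coeff_list (snd p) @ coeff_list (fst p))\<bar> \<le> k p * (1 + norm (c + e)) ^ ?m"
        by (rule k(2))
      also have "\<dots> \<le> k p * s ^ ?m"
        using norm_triangle_ineq[of c e] by (intro mult_left_mono power_mono k(1)) (auto simp: s_def)
      finally have 1: "\<bar>debiased_tensor CARD('g) \<Sigma> (c + e) (coeff_list (snd p) @ coeff_list (fst p))\<bar> \<le> k p * s ^ ?m" .
      have "\<bar>phi c $ snd p * phi c $ fst p\<bar> = \<bar>prod_list (map (($) (tilde c)) (coeff_list (snd p) @ coeff_list (fst p)))\<bar>"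
        by (simp add: monomial_coeff_list)
      also have "\<dots> \<le> (1 + norm c) ^ ?m"
        using abs_monomial_le[of c "coeff_list (snd p) @ coeff_list (fst p)"] by (simp add: length_coeff_list mult_2)
      also have "\<dots> \<le> s ^ ?m" by (intro power_mono) (auto simp: s_def)
      finally have 2: "\<bar>phi c $ snd p * phi c $ fst p\<bar> \<le> s ^ ?m" .
      show ?thesis
        unfolding centered_term_nth distrib_right mult_1 using 1 2 by linarith
    qed
    have "norm (centered_term \<Sigma> c e :: real ^ (('d, 'g) multi_index \<times> ('d, 'g) multi_index))
        \<le> (\<Sum>p\<in>?I. \<bar>(centered_term \<Sigma> c e :: real ^ (('d, 'g) multi_index \<times> ('d, 'g) multi_index)) $ p\<bar>)"
      by (rule norm_le_l1_cart)
    also have "\<dots> \<le> (\<Sum>p\<in>?I. (k p + 1) * s ^ ?m)" by (intro sum_mono entry)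
    also have "\<dots> = (\<Sum>p\<in>?I. k p + 1) * s ^ ?m" by (rule sum_distrib_right[symmetric])
    also have "s ^ ?m \<le> 2 ^ ?m * (norm c ^ ?m + (1 + norm e) ^ ?m)"
    proof -
      have "s \<le> 2 * max (norm c) (1 + norm e)"
      proof -
        have "a + b \<le> 2 * max a b" for a b :: real by (simp add: max_def)
        then show ?thesis unfolding s_def .
      qed
      then have "s ^ ?m \<le> (2 * max (norm c) (1 + norm e)) ^ ?m" by (intro power_mono) (auto simp: s_def)
      also have "\<dots> = 2 ^ ?m * max (norm c) (1 + norm e) ^ ?m" by (simp only: power_mult_distrib)
      also have "max (norm c) (1 + norm e) ^ ?m \<le> norm c ^ ?m + (1 + norm e) ^ ?m"
        by (simp add: max_def)
      finally show ?thesis by simp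
    qed
    finally show ?thesis using Kpos by (simp add: K_def distrib_left mult.assoc)
  qed
  moreover have "K > 0" using Kpos by (simp add: K_def)
  ultimately show ?thesis by blast
qed

lemma centered_term_noise:
  fixes \<Sigma> :: "real ^ 'd::finite ^ 'd"
  defines "V \<equiv> (centered_term \<Sigma> :: _ \<Rightarrow> _ \<Rightarrow> real ^ (('d, 'g::finite) multi_index \<times> ('d, 'g) multi_index))"
  assumes "prob_space M" and e[measurable]: "e \<in> borel_measurable M"
    and \<Sigma>: "nonneg_definite \<Sigma>" and N: "is_multi_normal 0 \<Sigma> (distr M borel e)"
  shows "(\<integral>\<omega>. V c (e \<omega>) $ p \<partial>M) = 0" (is ?mean)
    and "integrable M (\<lambda>\<omega>. (norm (V c (e \<omega>)))\<^sup>2)" (is ?int)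
    and "covariance_matrix M (\<lambda>\<omega>. vec_of (debiased_term \<Sigma> (c + e \<omega>) :: ('d, 'g) moment_matrix))
        = covariance_matrix M (\<lambda>\<omega>. V c (e \<omega>))" (is ?cov)
proof -
  interpret prob_space M by fact
  let ?D = "\<lambda>\<omega>. debiased_term \<Sigma> (c + e \<omega>) :: ('d, 'g) moment_matrix"
  have intD: "integrable M (\<lambda>\<omega>. ?D \<omega> $ i $ j)" for i j
    unfolding debiased_term_entry
    by (rule integrable_poly_growth_multi_normal[OF poly_growth_debiased_tensor assms(2) e \<Sigma> N])
  have meanD: "(\<integral>\<omega>. ?D \<omega> $ i $ j \<partial>M) = outer (phi c) (phi c) $ i $ j" for i j
    by (rule expectation_debiased_term[OF assms(2) e \<Sigma> N])
  have mean: "(\<integral>\<omega>. vec_of (?D \<omega>) $ p \<partial>M) = vec_of (outer (phi c) (phi c)) $ p" for p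
    by (simp add: vec_of_def meanD)
  have int: "integrable M (\<lambda>\<omega>. vec_of (?D \<omega>) $ p)" for p
    using intD by (simp add: vec_of_def)
  show ?mean using int mean by (simp add: V_def centered_term_def prob_space)
  show ?cov
    unfolding V_def centered_term_def by (rule covariance_matrix_minus_mean[OF assms(2) int mean, symmetric])
  obtain K where K: "K > 0" "\<And>c e. norm (V c e) \<le> K * norm c ^ (2 * CARD('g)) + K * (1 + norm e) ^ (2 * CARD('g))"
    using norm_centered_term_le[of \<Sigma>, where 'g = 'g] unfolding V_def by blast
  have Vm: "(\<lambda>\<omega>. V c (e \<omega>)) \<in> borel_measurable M"
    using measurable_compose[OF e centered_term_measurable] by (simp add: V_def)
  have "integrable M (\<lambda>\<omega>. (1 + norm (e \<omega>)) ^ (4 * CARD('g)))"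
    using multi_normal_moment_bound[OF \<Sigma>, of M "4 * CARD('g)"] e N prob_space_axioms by blast
  then have i: "integrable M (\<lambda>\<omega>. 2 * (K * norm c ^ (2 * CARD('g)))\<^sup>2 + 2 * K\<^sup>2 * (1 + norm (e \<omega>)) ^ (4 * CARD('g)))"
    by simp
  show ?int
  proof (rule Bochner_Integration.integrable_bound[OF i])
    have "(norm (V c (e \<omega>)))\<^sup>2 \<le> 2 * (K * norm c ^ (2 * CARD('g)))\<^sup>2 + 2 * K\<^sup>2 * (1 + norm (e \<omega>)) ^ (4 * CARD('g))" for \<omega>
    proof -
      have "(norm (V c (e \<omega>)))\<^sup>2 \<le> (K * norm c ^ (2 * CARD('g)) + K * (1 + norm (e \<omega>)) ^ (2 * CARD('g)))\<^sup>2"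
        using K(2) by (intro power_mono) auto
      also have "\<dots> \<le> 2 * (K * norm c ^ (2 * CARD('g)))\<^sup>2 + 2 * (K * (1 + norm (e \<omega>)) ^ (2 * CARD('g)))\<^sup>2"
        using sum_squares_bound[of "K * norm c ^ (2 * CARD('g))" "K * (1 + norm (e \<omega>)) ^ (2 * CARD('g))"]
        by (simp add: power2_sum)
      also have "(K * (1 + norm (e \<omega>)) ^ (2 * CARD('g)))\<^sup>2 = K\<^sup>2 * (1 + norm (e \<omega>)) ^ (4 * CARD('g))"
        by (simp add: power_mult_distrib flip: power_mult)
      finally show ?thesis by simp
    qed
    then show "AE \<omega> in M. norm ((norm (V c (e \<omega>)))\<^sup>2)
        \<le> norm (2 * (K * norm c ^ (2 * CARD('g)))\<^sup>2 + 2 * K\<^sup>2 * (1 + norm (e \<omega>)) ^ (4 * CARD('g)))"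
      by (intro AE_I2) (auto intro: order_trans[OF _ abs_ge_self])
  qed (use Vm in measurable)
qed

text \<open>
  For the signal part the truncated second moments are those of the assumption at level \<open>\<eta> / (2 K)\<close>.
  For the noise part the fourth moments of \<open>(1 + \<parallel>e\<^sub>i\<parallel>)\<^sup>2\<^sup>g\<close> are bounded uniformly in \<open>i\<close> and \<open>truncated_square_add_le\<close>
  with \<open>t = sqrt n * \<eta>\<close> yields the order \<open>1 / n\<close>.
\<close>

lemma centered_terms_Lindeberg:
  fixes \<Sigma> :: "real ^ 'd::finite ^ 'd"
  defines "V \<equiv> (centered_term \<Sigma> :: _ \<Rightarrow> _ \<Rightarrow> real ^ (('d, 'g::finite) multi_index \<times> ('d, 'g) multi_index))"
  assumes M: "prob_space M" and e: "\<And>i. i \<ge> 1 \<Longrightarrow> e i \<in> borel_measurable M"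
    and \<Sigma>: "nonneg_definite \<Sigma>" and N: "\<And>i. i \<ge> 1 \<Longrightarrow> is_multi_normal 0 \<Sigma> (distr M borel (e i))"
    and \<theta>: "\<And>\<eta>. \<eta> > 0 \<Longrightarrow>
           (\<lambda>n. (1 / real n) * (\<Sum>i=1..n. norm (\<theta> i) ^ (4 * CARD('g)) *
              of_bool (norm (\<theta> i) ^ (2 * CARD('g)) > sqrt (real n) * \<eta>))) \<longlonglongrightarrow> 0"
    and \<eta>: "\<eta> > 0"
  shows "(\<lambda>n. (1 / real n) * (\<Sum>i=1..n.
        \<integral>\<omega>. (norm (V (\<theta> i) (e i \<omega>)))\<^sup>2 * of_bool (norm (V (\<theta> i) (e i \<omega>)) > sqrt (real n) * \<eta>) \<partial>M)) \<longlonglongrightarrow> 0"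
proof -
  interpret prob_space M by fact
  let ?m = "2 * CARD('g)"
  obtain K where K: "K > 0" "\<And>c e. norm (V c e) \<le> K * norm c ^ ?m + K * (1 + norm e) ^ ?m"
    using norm_centered_term_le[of \<Sigma>, where 'g = 'g] unfolding V_def by blast
  obtain L where L: "\<And>f. f \<in> borel_measurable M \<Longrightarrow> is_multi_normal 0 \<Sigma> (distr M borel f) \<Longrightarrow>
      integrable M (\<lambda>\<omega>. (1 + norm (f \<omega>)) ^ (8 * CARD('g))) \<and> expectation (\<lambda>\<omega>. (1 + norm (f \<omega>)) ^ (8 * CARD('g))) \<le> L"
    using multi_normal_moment_bound[OF \<Sigma>, of M "8 * CARD('g)"] prob_space_axioms by blast
  define T where "T n i = norm (\<theta> i) ^ (4 * CARD('g)) * of_bool (norm (\<theta> i) ^ ?m > sqrt (real n) * (\<eta> / (2 * K)))" for n i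
  have bound: "(\<integral>\<omega>. (norm (V (\<theta> i) (e i \<omega>)))\<^sup>2 * of_bool (norm (V (\<theta> i) (e i \<omega>)) > sqrt (real n) * \<eta>) \<partial>M)
      \<le> 4 * K\<^sup>2 * T n i + 16 * K ^ 4 * L / (real n * \<eta>\<^sup>2)" if i: "i \<ge> 1" and n: "n \<ge> 1" for i n
  proof -
    have Vm[measurable]: "(\<lambda>\<omega>. V (\<theta> i) (e i \<omega>)) \<in> borel_measurable M"
      using measurable_compose[OF e[OF i] centered_term_measurable] by (simp add: V_def)
    have Li: "integrable M (\<lambda>\<omega>. (1 + norm (e i \<omega>)) ^ (8 * CARD('g)))"
      "expectation (\<lambda>\<omega>. (1 + norm (e i \<omega>)) ^ (8 * CARD('g))) \<le> L"
      using L[OF e[OF i] N[OF i]] by auto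
    have t: "sqrt (real n) * \<eta> > 0" using n \<eta> by simp
    define q where "q = 16 * K ^ 4 / (real n * \<eta>\<^sup>2)"
    have q: "q \<ge> 0" by (simp add: q_def)
    have "(\<integral>\<omega>. (norm (V (\<theta> i) (e i \<omega>)))\<^sup>2 * of_bool (norm (V (\<theta> i) (e i \<omega>)) > sqrt (real n) * \<eta>) \<partial>M)
        \<le> (\<integral>\<omega>. 4 * K\<^sup>2 * T n i + q * (1 + norm (e i \<omega>)) ^ (8 * CARD('g)) \<partial>M)"
    proof (rule integral_mono)
      have "integrable M (\<lambda>\<omega>. (norm (V (\<theta> i) (e i \<omega>)))\<^sup>2)"
        using centered_term_noise(2)[OF M e[OF i] \<Sigma> N[OF i]] by (simp add: V_def)
      then show "integrable M (\<lambda>\<omega>. (norm (V (\<theta> i) (e i \<omega>)))\<^sup>2 * of_bool (norm (V (\<theta> i) (e i \<omega>)) > sqrt (real n) * \<eta>))"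
        by (rule Bochner_Integration.integrable_bound) auto
      show "integrable M (\<lambda>\<omega>. 4 * K\<^sup>2 * T n i + q * (1 + norm (e i \<omega>)) ^ (8 * CARD('g)))"
        using Li by simp
      fix \<omega>
      have "(norm (V (\<theta> i) (e i \<omega>)))\<^sup>2 * of_bool (norm (V (\<theta> i) (e i \<omega>)) > sqrt (real n) * \<eta>)
          \<le> 4 * ((K * norm (\<theta> i) ^ ?m)\<^sup>2 * of_bool (K * norm (\<theta> i) ^ ?m > sqrt (real n) * \<eta> / 2))
            + 16 * (K * (1 + norm (e i \<omega>)) ^ ?m) ^ 4 / (sqrt (real n) * \<eta>)\<^sup>2"
        using K by (intro truncated_square_add_le t) auto
      also have "(K * norm (\<theta> i) ^ ?m > sqrt (real n) * \<eta> / 2) = (norm (\<theta> i) ^ ?m > sqrt (real n) * (\<eta> / (2 * K)))"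
        using K(1) by (simp add: field_simps)
      also have "(K * norm (\<theta> i) ^ ?m)\<^sup>2 = K\<^sup>2 * norm (\<theta> i) ^ (4 * CARD('g))"
        by (simp add: power_mult_distrib flip: power_mult)
      also have "16 * (K * (1 + norm (e i \<omega>)) ^ ?m) ^ 4 / (sqrt (real n) * \<eta>)\<^sup>2 = q * (1 + norm (e i \<omega>)) ^ (8 * CARD('g))"
        by (simp add: q_def power_mult_distrib flip: power_mult)
      finally show "(norm (V (\<theta> i) (e i \<omega>)))\<^sup>2 * of_bool (norm (V (\<theta> i) (e i \<omega>)) > sqrt (real n) * \<eta>)
          \<le> 4 * K\<^sup>2 * T n i + q * (1 + norm (e i \<omega>)) ^ (8 * CARD('g))"
        by (simp add: T_def mult.assoc)
    qed
    also have "\<dots> = 4 * K\<^sup>2 * T n i + q * expectation (\<lambda>\<omega>. (1 + norm (e i \<omega>)) ^ (8 * CARD('g)))"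
      using Li by (simp add: prob_space)
    also have "\<dots> \<le> 4 * K\<^sup>2 * T n i + q * L"
      using Li q by (intro add_left_mono mult_left_mono) auto
    finally show ?thesis by (simp add: q_def)
  qed
  show ?thesis
  proof (rule tendsto_sandwich[OF _ _ tendsto_const])
    show "\<forall>\<^sub>F n in sequentially. (1 / real n) * (\<Sum>i=1..n.
        \<integral>\<omega>. (norm (V (\<theta> i) (e i \<omega>)))\<^sup>2 * of_bool (norm (V (\<theta> i) (e i \<omega>)) > sqrt (real n) * \<eta>) \<partial>M)
        \<le> 4 * K\<^sup>2 * ((1 / real n) * (\<Sum>i=1..n. T n i)) + (16 * K ^ 4 * L / \<eta>\<^sup>2) * (1 / real n)"
      using eventually_ge_at_top[of 1]
    proof eventually_elim
      case (elim n)
      have "(\<Sum>i=1..n. \<integral>\<omega>. (norm (V (\<theta> i) (e i \<omega>)))\<^sup>2 * of_bool (norm (V (\<theta> i) (e i \<omega>)) > sqrt (real n) * \<eta>) \<partial>M)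
          \<le> (\<Sum>i=1..n. 4 * K\<^sup>2 * T n i + 16 * K ^ 4 * L / (real n * \<eta>\<^sup>2))"
        using elim by (intro sum_mono bound) auto
      also have "\<dots> = 4 * K\<^sup>2 * (\<Sum>i=1..n. T n i) + 16 * K ^ 4 * L / \<eta>\<^sup>2"
        using elim by (simp add: sum.distrib sum_distrib_left)
      finally have "(1 / real n) * (\<Sum>i=1..n. \<integral>\<omega>. (norm (V (\<theta> i) (e i \<omega>)))\<^sup>2 * of_bool (norm (V (\<theta> i) (e i \<omega>)) > sqrt (real n) * \<eta>) \<partial>M)
          \<le> (1 / real n) * (4 * K\<^sup>2 * (\<Sum>i=1..n. T n i) + 16 * K ^ 4 * L / \<eta>\<^sup>2)"
        by (intro mult_left_mono) auto
      then show ?case by (simp add: distrib_left mult_ac)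
    qed
    have "(\<lambda>n. 4 * K\<^sup>2 * ((1 / real n) * (\<Sum>i=1..n. T n i)) + (16 * K ^ 4 * L / \<eta>\<^sup>2) * (1 / real n)) \<longlonglongrightarrow> 4 * K\<^sup>2 * 0 + (16 * K ^ 4 * L / \<eta>\<^sup>2) * 0"
      unfolding T_def using \<eta> K(1)
      by (intro tendsto_add tendsto_mult_left \<theta> lim_1_over_n) auto
    then show "(\<lambda>n. 4 * K\<^sup>2 * ((1 / real n) * (\<Sum>i=1..n. T n i)) + (16 * K ^ 4 * L / \<eta>\<^sup>2) * (1 / real n)) \<longlonglongrightarrow> 0"
      by simp
  qed (auto intro!: always_eventually divide_nonneg_nonneg sum_nonneg integral_nonneg_AE)
qed

theorem theorem4p2:
  fixes M :: "'w measure"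
    and \<theta> :: "nat \<Rightarrow> real ^ 'd::finite"
    and \<epsilon> X :: "nat \<Rightarrow> 'w \<Rightarrow> real ^ 'd"
    and \<Sigma> :: "real ^ 'd ^ 'd"
    and \<SS> :: "real ^ (('d, 'g::finite) multi_index \<times> ('d, 'g) multi_index)
                    ^ (('d, 'g) multi_index \<times> ('d, 'g) multi_index)"
  assumes "prob_space M"
    and "nonneg_definite \<Sigma>"
    and "prob_space.indep_vars M (\<lambda>_. borel) \<epsilon> {1..}"
    and "\<And>i. i \<ge> 1 \<Longrightarrow> is_multi_normal 0 \<Sigma> (distr M borel (\<epsilon> i))"
    and "X = (\<lambda>i \<omega>. \<theta> i + \<epsilon> i \<omega>)"
    and "(\<lambda>n. (1 / real n) *\<^sub>R (\<Sum>i=1..n. covariance_matrix M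
            (\<lambda>\<omega>. vec_of (debiased_term \<Sigma> (X i \<omega>) :: ('d, 'g) moment_matrix)))) \<longlonglongrightarrow> \<SS>"
    and "\<And>\<eta>. \<eta> > 0 \<Longrightarrow>
           (\<lambda>n. (1 / real n) * (\<Sum>i=1..n. norm (\<theta> i) ^ (4 * CARD('g)) *
              of_bool (norm (\<theta> i) ^ (2 * CARD('g)) > sqrt (real n) * \<eta>))) \<longlonglongrightarrow> 0"
  shows "(AE \<omega> in M. (\<lambda>n. frobenius_norm
              (debiased_moment_matrix \<Sigma> n (\<lambda>i. X i \<omega>) - moment_matrix n \<theta>
                 :: ('d, 'g) moment_matrix)) \<longlonglongrightarrow> 0)
       \<and> (\<exists>N. is_multi_normal 0 \<SS> N \<and>
            weakly_converges
              (\<lambda>n. distr M borel (\<lambda>\<omega>. sqrt (real n) *\<^sub>R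
                 (vec_of (debiased_moment_matrix \<Sigma> n (\<lambda>i. X i \<omega>) :: ('d, 'g) moment_matrix)
                    - vec_of (moment_matrix n \<theta>)))) N)"
proof -
  interpret prob_space M by fact
  define V where "V i \<omega> = (centered_term \<Sigma> (\<theta> i) (\<epsilon> i \<omega>)
      :: real ^ (('d, 'g) multi_index \<times> ('d, 'g) multi_index))" for i \<omega>
  have e: "\<epsilon> i \<in> borel_measurable M" if "i \<ge> 1" for i
    using assms(3) that by (auto simp: indep_vars_def2)
  have indep: "indep_vars (\<lambda>_. borel) V {1..}"
    unfolding V_def by (rule indep_vars_compose2[OF assms(3) centered_term_measurable])
  have Vm: "V i \<in> borel_measurable M" if "i \<ge> 1" for i
    using measurable_compose[OF e[OF that] centered_term_measurable] by (simp add: V_def[abs_def])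
  have mean: "(\<integral>\<omega>. V i \<omega> $ p \<partial>M) = 0" if "i \<ge> 1" for i p
    unfolding V_def by (rule centered_term_noise(1)[OF assms(1) e[OF that] assms(2) assms(4)[OF that]])
  have int: "integrable M (\<lambda>\<omega>. (norm (V i \<omega>))\<^sup>2)" if "i \<ge> 1" for i
    unfolding V_def by (rule centered_term_noise(2)[OF assms(1) e[OF that] assms(2) assms(4)[OF that]])
  have cov_i: "covariance_matrix M (\<lambda>\<omega>. vec_of (debiased_term \<Sigma> (X i \<omega>) :: ('d, 'g) moment_matrix)) = covariance_matrix M (V i)"
    if "i \<ge> 1" for i
    unfolding V_def[abs_def] assms(5) by (rule centered_term_noise(3)[OF assms(1) e[OF that] assms(2) assms(4)[OF that]])
  have cov: "(\<lambda>n. (1 / real n) *\<^sub>R (\<Sum>i=1..n. covariance_matrix M (V i))) \<longlonglongrightarrow> \<SS>"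
    using assms(6) by (simp add: cov_i)
  have diff: "vec_of (debiased_moment_matrix \<Sigma> n (\<lambda>i. X i \<omega>) :: ('d, 'g) moment_matrix) - vec_of (moment_matrix n \<theta>)
      = (1 / real n) *\<^sub>R (\<Sum>i=1..n. V i \<omega>)" for n \<omega>
    by (simp add: debiased_moment_matrix_def moment_matrix_def vec_of_linear V_def centered_term_def assms(5)
        sum_subtractf scaleR_diff_right)
  have "AE \<omega> in M. \<forall>p\<in>UNIV. (\<lambda>n. (\<Sum>i=1..n. V i \<omega> $ p) / real n) \<longlonglongrightarrow> 0"
  proof (rule AE_finite_allI)
    fix p :: "('d, 'g) multi_index \<times> ('d, 'g) multi_index"
    have nth: "x $ p = axis p 1 \<bullet> x" for x :: "real ^ (('d, 'g) multi_index \<times> ('d, 'g) multi_index)"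
      by (simp add: inner_axis')
    have var: "expectation (\<lambda>\<omega>. (V i \<omega> $ p)\<^sup>2) = covariance_matrix M (V i) $ p $ p" if "i \<ge> 1" for i
      using mean[OF that] by (simp add: covariance_matrix_def power2_eq_square)
    have "(\<lambda>n. ((1 / real n) *\<^sub>R (\<Sum>i=1..n. covariance_matrix M (V i))) $ p $ p) \<longlonglongrightarrow> \<SS> $ p $ p"
      by (intro tendsto_vec_nth cov)
    from convergent_imp_Bseq[OF convergentI[OF this]]
    obtain C where C: "C > 0" "\<And>n. norm (((1 / real n) *\<^sub>R (\<Sum>i=1..n. covariance_matrix M (V i))) $ p $ p) \<le> C"
      by (auto simp: Bseq_def)
    show "AE \<omega> in M. (\<lambda>n. (\<Sum>i=1..n. V i \<omega> $ p) / real n) \<longlonglongrightarrow> 0"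
    proof (rule strong_law_bounded_average_variance)
      show "indep_vars (\<lambda>_. borel) (\<lambda>i \<omega>. V i \<omega> $ p) {1..}"
        unfolding nth by (rule indep_vars_compose2[OF indep]) auto
      show "integrable M (\<lambda>\<omega>. (V i \<omega> $ p)\<^sup>2)" if "i \<ge> 1" for i
        unfolding nth by (rule integrable_inner_square[OF assms(1) Vm[OF that] int[OF that] mean[OF that]])
      show "expectation (\<lambda>\<omega>. V i \<omega> $ p) = 0" if "i \<ge> 1" for i by (rule mean[OF that])
      show "(\<Sum>i=1..n. expectation (\<lambda>\<omega>. (V i \<omega> $ p)\<^sup>2)) \<le> C * real n" for n
      proof (cases "n = 0")
        case False
        have "(\<Sum>i=1..n. expectation (\<lambda>\<omega>. (V i \<omega> $ p)\<^sup>2)) = real n * ((1 / real n) *\<^sub>R (\<Sum>i=1..n. covariance_matrix M (V i))) $ p $ p"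
          using False by (simp add: var)
        also have "\<dots> \<le> real n * C" using C(2)[of n] unfolding real_norm_def abs_le_iff by (intro mult_left_mono) auto
        finally show ?thesis by (simp add: mult.commute)
      qed simp
    qed
  qed simp
  then have 1: "AE \<omega> in M. (\<lambda>n. frobenius_norm (debiased_moment_matrix \<Sigma> n (\<lambda>i. X i \<omega>) - moment_matrix n \<theta>
      :: ('d, 'g) moment_matrix)) \<longlonglongrightarrow> 0"
  proof eventually_elim
    case (elim \<omega>)
    have "(\<lambda>n. debiased_moment_matrix \<Sigma> n (\<lambda>i. X i \<omega>) - moment_matrix n \<theta> :: ('d, 'g) moment_matrix) \<longlonglongrightarrow> 0"
    proof (intro vec_tendstoI)
      fix i j
      have "(debiased_moment_matrix \<Sigma> n (\<lambda>i. X i \<omega>) - moment_matrix n \<theta> :: ('d, 'g) moment_matrix) $ i $ j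
          = (\<Sum>k=1..n. V k \<omega> $ (j, i)) / real n" for n
        using arg_cong[OF diff[of n \<omega>], of "\<lambda>v. v $ (j, i)"] by (simp add: vec_of_def)
      then show "(\<lambda>n. (debiased_moment_matrix \<Sigma> n (\<lambda>i. X i \<omega>) - moment_matrix n \<theta> :: ('d, 'g) moment_matrix) $ i $ j) \<longlonglongrightarrow> 0 $ i $ j"
        using elim by simp
    qed
    then show ?case unfolding frobenius_norm_eq_norm by (rule tendsto_norm_zero)
  qed
  \<comment> \<open>For \<open>n = 0\<close> both sides vanish, because \<open>sqrt 0 = 0\<close> and \<open>1 / 0 = 0\<close>.\<close>
  have scale: "sqrt (real n) *\<^sub>R (vec_of (debiased_moment_matrix \<Sigma> n (\<lambda>i. X i \<omega>) :: ('d, 'g) moment_matrix) - vec_of (moment_matrix n \<theta>))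
      = (1 / sqrt (real n)) *\<^sub>R (\<Sum>i=1..n. V i \<omega>)" for n \<omega>
    unfolding diff by (simp add: real_div_sqrt divide_simps flip: real_sqrt_mult)
  have "\<exists>N. is_multi_normal 0 \<SS> N \<and> weakly_converges (\<lambda>n. distr M borel (\<lambda>\<omega>. (1 / sqrt (real n)) *\<^sub>R (\<Sum>i=1..n. V i \<omega>))) N"
  proof (rule multivariate_Lindeberg_CLT[OF assms(1) indep int mean cov])
    fix \<eta> :: real assume "\<eta> > 0"
    then show "(\<lambda>n. (1 / real n) * (\<Sum>i=1..n. expectation (\<lambda>\<omega>. (norm (V i \<omega>))\<^sup>2 * of_bool (norm (V i \<omega>) > sqrt (real n) * \<eta>)))) \<longlonglongrightarrow> 0"
      unfolding V_def using e assms(1,2,4,7) by (intro centered_terms_Lindeberg) auto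
  qed
  then show ?thesis using 1 unfolding scale by blast
qed

end
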